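(* Let $p$ be a prime and let $G={\rm PSL}_2(p)$. Then (i) $i(G)\ge 17$ whenever $p\ge 29$; (ii) $c(G)\ge 18$ whenever $p\ge 23$; (iii) $s(G)\ge 6$ whenever $p\ge 41$; (iv) $n(G)\ge 12$ whenever $p\ge 23$.
   Context: For a finite group $G$ define: $i(G)$ = the number of isomorphism classes of non-identity proper subgroups $H$ of $G$ (that is, $1\ne H\ne G$); $c(G)$ = the number of conjugacy classes (under conjugation by $G$) of non-identity proper subgroups $H$ of $G$; $s(G)$ = the number of conjugacy classes of non-identity proper subgroups $H$ of $G$ that are self-normalising; $n(G)$ = the number of conjugacy classes of non-identity proper subgroups $H$ of $G$ that are not self-normalising. A subgroup $H\le G$ is self-normalising if $H=N_G(H)$. ${\rm PSL}_2(p)$ is the projective special linear group of degree 2 over the field with $p$ elements. *)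

theory Defs
  imports "HOL-Analysis.Analysis" "HOL-Algebra.Group_Action" "HOL-Computational_Algebra.Primes"
begin

definition SL :: "('f::field ^ 'n ^ 'n) monoid" where
  "SL = \<lparr>carrier = {A. det A = 1}, mult = (**), one = mat 1\<rparr>"

text \<open>The projective group is the quotient of the special linear group by the scalar matrices
  it contains; \<^term>\<open>mat c\<close> is the scalar matrix with diagonal entry \<^term>\<open>c\<close>.\<close>

definition PSL :: "('f::field ^ 'n ^ 'n) set monoid" where
  "PSL = SL Mod {A \<in> carrier SL. \<exists>c. A = mat c}"

definition nontriv_proper_subgroups :: "('a, 'b) monoid_scheme \<Rightarrow> 'a set set" where
  "nontriv_proper_subgroups G = {H. subgroup H G \<and> H \<noteq> {\<one>\<^bsub>G\<^esub>} \<and> H \<noteq> carrier G}"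

definition self_normalising :: "('a, 'b) monoid_scheme \<Rightarrow> 'a set \<Rightarrow> bool" where
  "self_normalising G H \<longleftrightarrow> normalizer G H = H"

definition iso_rel_on :: "('a, 'b) monoid_scheme \<Rightarrow> 'a set set \<Rightarrow> ('a set \<times> 'a set) set" where
  "iso_rel_on G S = {(H, K). H \<in> S \<and> K \<in> S \<and> G\<lparr>carrier := H\<rparr> \<cong> G\<lparr>carrier := K\<rparr>}"

text \<open>The same action as in \<open>group.action_by_conjugation_on_subgroups_set\<close>.\<close>

definition conj_action :: "('a, 'b) monoid_scheme \<Rightarrow> 'a \<Rightarrow> 'a set \<Rightarrow> 'a set" where
  "conj_action G =
     (\<lambda>g. \<lambda>H \<in> {H. subgroup H G}. g <#\<^bsub>G\<^esub> H #>\<^bsub>G\<^esub> (inv\<^bsub>G\<^esub> g))"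

text \<open>The four counts below are cardinalities, so they are meaningful for finite groups only
  (\<^const>\<open>card\<close> of an infinite set is \<open>0\<close>).\<close>

definition num_iso_classes :: "('a, 'b) monoid_scheme \<Rightarrow> nat" where
  "num_iso_classes G =
     card (nontriv_proper_subgroups G // iso_rel_on G (nontriv_proper_subgroups G))"

definition num_conj_classes :: "('a, 'b) monoid_scheme \<Rightarrow> nat" where
  "num_conj_classes G = card (orbits G (nontriv_proper_subgroups G) (conj_action G))"

definition num_self_norm_classes :: "('a, 'b) monoid_scheme \<Rightarrow> nat" where
  "num_self_norm_classes G =
     card (orbits G {H \<in> nontriv_proper_subgroups G. self_normalising G H} (conj_action G))"

definition num_non_self_norm_classes :: "('a, 'b) monoid_scheme \<Rightarrow> nat" where
  "num_non_self_norm_classes G =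
     card (orbits G {H \<in> nontriv_proper_subgroups G. \<not> self_normalising G H} (conj_action G))"

end

theory Submission
  imports Defs "HOL-Algebra.Multiplicative_Group" "HOL-Number_Theory.Residues"
begin

text \<open>
  Write \<open>a = (p - 1) / 2\<close> and \<open>b = (p + 1) / 2\<close>, and let \<open>\<tau>\<close> count divisors. These numbers are
  consecutive, and for a prime \<open>p > 3\<close> the product \<open>a b\<close> is divisible by 6. All four lower bounds
  come from exhibiting enough subgroups of \<open>G = PSL(2, p)\<close>, namely the following.

  \<^item> \<open>G\<close> has a cyclic \<^emph>\<open>split torus\<close> of order \<open>a\<close> (diagonal matrices) and a cyclic \<^emph>\<open>nonsplit torus\<close>
  of order \<open>b\<close> (elements of norm 1 in a quadratic extension of the prime field), each inverted by
  an involution \<open>w\<close>. Each \<open>d > 1\<close> dividing \<open>a\<close> or \<open>b\<close> therefore gives a cyclic subgroup of order \<open>d\<close>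
  and, for \<open>d > 2\<close>, dihedral subgroups of order \<open>2 d\<close>.

  \<^item> For every divisor \<open>d\<close> of \<open>a\<close> the Borel subgroup of upper triangular matrices contains a subgroup
  of order \<open>p d\<close>.

  \<^item> Writing \<open>-1 = u\<^sup>2 + v\<^sup>2\<close> gives quaternion units in \<open>SL(2, p)\<close>, whose images generate a Klein
  four-group \<open>V\<close>. Its normaliser \<open>S\<close> contains a tetrahedral subgroup \<open>A\<close>, and \<open>S\<close> is octahedral if 2 is
  a square modulo \<open>p\<close> and equal to \<open>A\<close> otherwise.

  The normalisers can be computed because an element that conjugates a nontrivial element of a torus
  \<open>T\<close> into \<open>T\<close> lies in \<open>T \<union> T w\<close>. The cyclic subgroups are normalised by \<open>w\<close>. A dihedral subgroup of
  order \<open>2 d\<close> with \<open>d > 2\<close> is self-normalising if the index \<open>|T| / d\<close> is odd; if the index is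
  even, there are two classes of them, neither self-normalising (locale \<open>torus\<close>). Among the
  subgroups of order \<open>p d\<close> exactly the full Borel subgroup is self-normalising (locale \<open>borel\<close>). If 2
  is a square, then \<open>S\<close> is self-normalising, and a diagonal matrix of nonsquare determinant carries it to a
  self-normalising subgroup of another class; if 2 is not a square, then \<open>A\<close> is self-normalising (locales
  \<open>klein\<close> and \<open>klein_root\<close>). Finally, 2 is a square exactly if one of \<open>a\<close> and \<open>b\<close> is divisible by 4,
  as this is the condition for a torus to contain an element of order 4, and the elements of order 4 are the
  images of the matrices of determinant 1 whose squared trace is 2.

  Subgroups of different kinds are told apart by a small isomorphism invariant, the \<open>shape\<close>. Counting gives
  \<open>i(G) \<ge> 3 \<tau>(a) + 2 \<tau>(b) - 3\<close>; \<open>n(G) \<ge> 2 \<tau>(a) + \<tau>(b) - 2 + 2 y\<close>, where \<open>y\<close> is the number of \<open>d > 2\<close>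
  dividing \<open>a\<close> or \<open>b\<close> with even quotient; and \<open>s(G) \<ge> z + 3\<close> or \<open>s(G) \<ge> z + 2\<close>, according to
  whether 2 is a square or not, where \<open>z\<close> counts the \<open>d > 2\<close> with odd quotient. The stated bounds then
  follow by distinguishing which of \<open>a\<close> and \<open>b\<close> are divisible by 2 and by 3. The bound for \<open>c(G)\<close>
  is \<open>c(G) \<ge> n(G) + s(G) \<ge> 12 + 6\<close>, except for \<open>p = 37\<close>, where \<open>z + 2\<close> is only 5 but \<open>n(G) \<ge> 14\<close>.
\<close>

section \<open>Shapes of subgroups and the counting of classes\<close>

datatype shape = Cyclic nat | Dihedral nat | Borel nat | Polyhedral

text \<open>The shape guesses the isomorphism type of a subgroup by a sequence of tests that involve only products
  and cardinalities, so that its invariance under isomorphism is immediate. Elements of order \<open>p\<close>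
  single out the subgroups of a Borel subgroup. In a cyclic or dihedral group any two elements with nontrivial
  square commute, because both are rotations; in the tetrahedral and octahedral groups this fails. The last case
  is a default value, reached only by dihedral groups among the subgroups considered here; the Klein four-group
  counts as \<^term>\<open>Dihedral 2\<close>.\<close>

definition shape_of :: "('a, 'b) monoid_scheme \<Rightarrow> nat \<Rightarrow> 'a set \<Rightarrow> shape" where
  "shape_of G p H =
    (if \<exists>x\<in>H. x \<noteq> \<one>\<^bsub>G\<^esub> \<and> x [^]\<^bsub>G\<^esub> p = \<one>\<^bsub>G\<^esub> then Borel (card H div p)
     else if \<exists>x\<in>H. \<exists>y\<in>H. x \<otimes>\<^bsub>G\<^esub> x \<noteq> \<one>\<^bsub>G\<^esub> \<and> y \<otimes>\<^bsub>G\<^esub> y \<noteq> \<one>\<^bsub>G\<^esub> \<and> x \<otimes>\<^bsub>G\<^esub> y \<noteq> y \<otimes>\<^bsub>G\<^esub> x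
       then Polyhedral
     else if \<exists>x\<in>H. \<forall>y\<in>H. \<exists>k::nat. y = x [^]\<^bsub>G\<^esub> k then Cyclic (card H)
     else Dihedral (card H div 2))"

context group
begin

abbreviation "NP \<equiv> nontriv_proper_subgroups G"
abbreviation "sn \<equiv> self_normalising G"

definition cnj :: "'a \<Rightarrow> 'a \<Rightarrow> 'a" where "cnj g x = g \<otimes> x \<otimes> inv g"

lemma cnj_closed [simp]: "g \<in> carrier G \<Longrightarrow> x \<in> carrier G \<Longrightarrow> cnj g x \<in> carrier G"
  by (simp add: cnj_def)

lemma inv_cancel:
  assumes "g \<in> carrier G" "x \<in> carrier G"
  shows "inv g \<otimes> (g \<otimes> x) = x" "g \<otimes> (inv g \<otimes> x) = x"
  using assms by (simp_all flip: m_assoc)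

lemma cnj_mult:
  "g \<in> carrier G \<Longrightarrow> x \<in> carrier G \<Longrightarrow> y \<in> carrier G \<Longrightarrow> cnj g (x \<otimes> y) = cnj g x \<otimes> cnj g y"
  unfolding cnj_def by (simp add: m_assoc inv_cancel)

lemma cnj_one [simp]: "g \<in> carrier G \<Longrightarrow> cnj g \<one> = \<one>"
  by (simp add: cnj_def)

lemma cnj_by_mult:
  "g \<in> carrier G \<Longrightarrow> h \<in> carrier G \<Longrightarrow> x \<in> carrier G \<Longrightarrow> cnj (g \<otimes> h) x = cnj g (cnj h x)"
  unfolding cnj_def by (simp add: m_assoc inv_mult_group)

lemma cnj_by_one [simp]: "x \<in> carrier G \<Longrightarrow> cnj \<one> x = x"
  by (simp add: cnj_def)

lemma cnj_inv [simp]: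
  assumes "g \<in> carrier G" "x \<in> carrier G"
  shows "cnj (inv g) (cnj g x) = x" "cnj g (cnj (inv g) x) = x"
  using assms by (simp_all flip: cnj_by_mult)

lemma cnj_eq_iff:
  assumes "g \<in> carrier G" "x \<in> carrier G" "y \<in> carrier G"
  shows "cnj g x = y \<longleftrightarrow> g \<otimes> x = y \<otimes> g"
  using assms unfolding cnj_def by (metis inv_closed inv_solve_right m_closed inv_inv)

lemma cnj_inject:
  assumes "g \<in> carrier G" "x \<in> carrier G" "y \<in> carrier G"
  shows "cnj g x = cnj g y \<longleftrightarrow> x = y"
  using assms cnj_inv(1) by metis

lemma cnj_eq_one_iff [simp]: "g \<in> carrier G \<Longrightarrow> x \<in> carrier G \<Longrightarrow> cnj g x = \<one> \<longleftrightarrow> x = \<one>"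
  using cnj_inject[of g x \<one>] by simp

lemma cnj_pow: "g \<in> carrier G \<Longrightarrow> x \<in> carrier G \<Longrightarrow> cnj g (x [^] (n::nat)) = cnj g x [^] n"
  by (induction n) (simp_all add: cnj_mult)

lemma cnj_image_one: "H \<subseteq> carrier G \<Longrightarrow> cnj \<one> ` H = H"
  by (auto simp: subset_iff image_iff)

lemma cnj_image_subset: "g \<in> carrier G \<Longrightarrow> H \<subseteq> carrier G \<Longrightarrow> cnj g ` H \<subseteq> carrier G"
  by auto

lemma conj_action_eq:
  assumes "subgroup H G" "g \<in> carrier G"
  shows "conj_action G g H = cnj g ` H"
  using assms unfolding conj_action_def cnj_def l_coset_def r_coset_def by (auto simp: image_iff)

lemma self_normalising_iff:
  assumes H: "subgroup H G"
  shows "sn H \<longleftrightarrow> (\<forall>g\<in>carrier G. cnj g ` H = H \<longrightarrow> g \<in> H)"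
proof -
  have sub: "H \<subseteq> carrier G" using H subgroup.subset by blast
  have eq: "normalizer G H = {g \<in> carrier G. cnj g ` H = H}"
    using sub unfolding normalizer_def stabilizer_def cnj_def l_coset_def r_coset_def
    by (auto simp: image_iff)
  have "cnj g ` H = H" if "g \<in> H" for g
  proof
    show "cnj g ` H \<subseteq> H"
      using that H unfolding cnj_def by (auto intro!: subgroup.m_closed subgroup.m_inv_closed)
    have "cnj (inv g) x \<in> H" if "x \<in> H" for x
      using that \<open>g \<in> H\<close> H unfolding cnj_def
      by (auto intro!: subgroup.m_closed subgroup.m_inv_closed)
    moreover have "x = cnj g (cnj (inv g) x)" if "x \<in> H" for x
      using that \<open>g \<in> H\<close> sub by (simp add: subset_iff)
    ultimately show "H \<subseteq> cnj g ` H" by blast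
  qed
  then show ?thesis
    unfolding self_normalising_def eq using sub by blast
qed

lemma cnj_image_eqI:
  assumes "finite H" "g \<in> carrier G" "H \<subseteq> carrier G" "\<And>x. x \<in> H \<Longrightarrow> cnj g x \<in> H"
  shows "cnj g ` H = H"
proof (rule card_subset_eq)
  have "inj_on (cnj g) H"
    using assms by (auto intro!: inj_onI simp: cnj_inject subset_iff)
  then show "card (cnj g ` H) = card H" by (rule card_image)
qed (use assms in auto)

lemma shape_of_hom_image:
  assumes H: "subgroup H G" and inj: "inj_on f H" and sub: "f ` H \<subseteq> carrier G"
    and hom: "\<And>x y. x \<in> H \<Longrightarrow> y \<in> H \<Longrightarrow> f (x \<otimes> y) = f x \<otimes> f y"
  shows "shape_of G p (f ` H) = shape_of G p H"
proof -
  have one: "\<one> \<in> H" using H by (rule subgroup.one_closed)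
  have f1: "f \<one> = \<one>"
    using hom[OF one one] sub one by (metis image_subset_iff l_one one_closed r_cancel_one')
  have pw: "x [^] n \<in> H" if "x \<in> H" for x and n :: nat
    using that H one by (induction n) (auto simp: subgroup.m_closed)
  have fpw: "f x [^] n = f (x [^] n)" if "x \<in> H" for x and n :: nat
    using that by (induction n) (auto simp: f1 hom pw)
  have eq: "f x = f y \<longleftrightarrow> x = y" if "x \<in> H" "y \<in> H" for x y
    using that inj by (auto dest: inj_onD)
  have eq1: "f x = \<one> \<longleftrightarrow> x = \<one>" if "x \<in> H" for x
    using eq[OF that one] f1 by simp
  have m: "f x \<otimes> f y = f (x \<otimes> y)" "x \<otimes> y \<in> H" if "x \<in> H" "y \<in> H" for x y
    using that hom H by (auto simp: subgroup.m_closed)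
  have a: "(\<exists>x\<in>f ` H. x \<noteq> \<one> \<and> x [^] p = \<one>) \<longleftrightarrow> (\<exists>x\<in>H. x \<noteq> \<one> \<and> x [^] p = \<one>)"
    by (auto simp: fpw eq1 pw)
  have b: "(\<exists>x\<in>f ` H. \<exists>y\<in>f ` H. x \<otimes> x \<noteq> \<one> \<and> y \<otimes> y \<noteq> \<one> \<and> x \<otimes> y \<noteq> y \<otimes> x) \<longleftrightarrow>
      (\<exists>x\<in>H. \<exists>y\<in>H. x \<otimes> x \<noteq> \<one> \<and> y \<otimes> y \<noteq> \<one> \<and> x \<otimes> y \<noteq> y \<otimes> x)"
    by (simp add: m eq eq1)
  have c: "(\<exists>x\<in>f ` H. \<forall>y\<in>f ` H. \<exists>k::nat. y = x [^] k) \<longleftrightarrow> (\<exists>x\<in>H. \<forall>y\<in>H. \<exists>k::nat. y = x [^] k)"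
    by (simp add: fpw eq pw)
  show ?thesis
    unfolding shape_of_def a b c using inj by (simp add: card_image)
qed

lemma shape_of_cnj:
  assumes "subgroup H G" "g \<in> carrier G"
  shows "shape_of G p (cnj g ` H) = shape_of G p H"
proof -
  have sub: "H \<subseteq> carrier G" using assms subgroup.subset by blast
  show ?thesis
    using assms sub by (intro shape_of_hom_image) (auto simp: subset_iff cnj_mult cnj_inject intro!: inj_onI)
qed

lemma shape_of_iso:
  assumes H: "subgroup H G" and K: "subgroup K G" and iso: "G\<lparr>carrier := H\<rparr> \<cong> G\<lparr>carrier := K\<rparr>"
  shows "shape_of G p H = shape_of G p K"
proof -
  obtain f where "f \<in> iso (G\<lparr>carrier := H\<rparr>) (G\<lparr>carrier := K\<rparr>)"
    using iso unfolding is_iso_def by blast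
  then have bij: "bij_betw f H K" and hom: "\<And>x y. x \<in> H \<Longrightarrow> y \<in> H \<Longrightarrow> f (x \<otimes> y) = f x \<otimes> f y"
    by (auto simp: iso_def hom_def)
  have "K \<subseteq> carrier G" using K subgroup.subset by blast
  then show ?thesis
    using shape_of_hom_image[OF H, of f p] bij hom by (auto simp: bij_betw_def)
qed

lemma finite_nontriv_proper_subgroups: "finite (carrier G) \<Longrightarrow> finite (NP)"
  by (rule finite_subset[of _ "Pow (carrier G)"])
     (auto simp: nontriv_proper_subgroups_def dest: subgroup.subset)

lemma mem_conj_orbit:
  assumes "subgroup H G"
  shows "K \<in> orbit G (conj_action G) H \<longleftrightarrow> (\<exists>g\<in>carrier G. K = cnj g ` H)"
  unfolding orbit_def using conj_action_eq[OF assms] by (auto; metis)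

lemma self_mem_conj_orbit: "subgroup H G \<Longrightarrow> H \<in> orbit G (conj_action G) H"
  using cnj_image_one[of H] subgroup.subset by (metis mem_conj_orbit one_closed)

text \<open>Subgroups of distinct shapes are not isomorphic, so a set of realised shapes injects into the isomorphism classes.\<close>

lemma card_iso_classes_ge:
  assumes fin: "finite (carrier G)"
    and L: "\<And>l. l \<in> L \<Longrightarrow> \<exists>H\<in>NP. shape_of G p H = l"
  shows "card L \<le> num_iso_classes G"
proof -
  let ?E = NP and ?R = "iso_rel_on G NP"
  obtain f where f: "\<And>l. l \<in> L \<Longrightarrow> f l \<in> ?E \<and> shape_of G p (f l) = l"
    using L by metis
  have refl: "G\<lparr>carrier := H\<rparr> \<cong> G\<lparr>carrier := H\<rparr>" for H
    by (rule iso_refl)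
  have "inj_on (\<lambda>l. ?R `` {f l}) L"
  proof (rule inj_onI)
    fix k l assume kl: "k \<in> L" "l \<in> L" and eq: "?R `` {f k} = ?R `` {f l}"
    have "(f l, f l) \<in> ?R"
      using f[OF kl(2)] refl unfolding iso_rel_on_def by blast
    then have "(f k, f l) \<in> ?R" using eq by blast
    then have "G\<lparr>carrier := f k\<rparr> \<cong> G\<lparr>carrier := f l\<rparr>"
      unfolding iso_rel_on_def by blast
    then show "k = l"
      using shape_of_iso[of "f k" "f l" p] f kl by (auto simp: nontriv_proper_subgroups_def)
  qed
  moreover have "(\<lambda>l. ?R `` {f l}) ` L \<subseteq> ?E // ?R"
    using f by (auto simp: quotient_def)
  moreover have "finite (?E // ?R)"
    using finite_nontriv_proper_subgroups[OF fin] by (simp add: quotient_def)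
  ultimately show ?thesis
    unfolding num_iso_classes_def by (metis card_inj_on_le)
qed

text \<open>Shapes separate conjugacy classes only up to isomorphism. The shapes in \<open>L2\<close> contribute two classes each:
  they are realised by two subgroups that are shown separately not to be conjugate.\<close>

lemma card_conj_classes_ge:
  assumes fin: "finite E" and sub: "\<And>H. H \<in> E \<Longrightarrow> subgroup H G"
    and finL: "finite L1" "finite L2" and disj: "L1 \<inter> L2 = {}"
    and L1: "\<And>l. l \<in> L1 \<Longrightarrow> \<exists>H\<in>E. shape_of G p H = l"
    and L2: "\<And>l. l \<in> L2 \<Longrightarrow> \<exists>H\<in>E. \<exists>K\<in>E. shape_of G p H = l \<and> shape_of G p K = l \<and>
               (\<forall>g\<in>carrier G. cnj g ` H \<noteq> K)"
  shows "card L1 + 2 * card L2 \<le> card (orbits G E (conj_action G))"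
proof -
  obtain f1 where f1: "\<And>l. l \<in> L1 \<Longrightarrow> f1 l \<in> E \<and> shape_of G p (f1 l) = l"
    using L1 by metis
  obtain f2 f3 where f2: "\<And>l. l \<in> L2 \<Longrightarrow> f2 l \<in> E \<and> shape_of G p (f2 l) = l"
    and f3: "\<And>l. l \<in> L2 \<Longrightarrow> f3 l \<in> E \<and> shape_of G p (f3 l) = l"
    and nc: "\<And>l g. l \<in> L2 \<Longrightarrow> g \<in> carrier G \<Longrightarrow> cnj g ` f2 l \<noteq> f3 l"
    using L2 by metis
  let ?O = "\<lambda>H. orbit G (conj_action G) H"
  have key: "\<exists>g\<in>carrier G. cnj g ` H = K" if "H \<in> E" "K \<in> E" "?O H = ?O K" for H K
    using that self_mem_conj_orbit[of K] mem_conj_orbit[of H K] sub by metis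
  have shp: "shape_of G p H = shape_of G p K" if "H \<in> E" "K \<in> E" "?O H = ?O K" for H K
    using key[OF that] shape_of_cnj sub that by metis
  define I where "I = L1 \<times> {False} \<union> L2 \<times> UNIV"
  define f where "f = (\<lambda>(l, b). if l \<in> L1 then f1 l else if b then f3 l else f2 l)"
  have fE: "f (l, b) \<in> E" "shape_of G p (f (l, b)) = l" if "(l, b) \<in> I" for l b
    using that f1 f2 f3 by (auto simp: I_def f_def)
  have "inj_on (\<lambda>i. ?O (f i)) I"
  proof (rule inj_onI, clarify)
    fix k b l c assume kl: "(k, b) \<in> I" "(l, c) \<in> I" and eq: "?O (f (k, b)) = ?O (f (l, c))"
    have "k = l" using shp[OF _ _ eq] fE kl by metis
    moreover have "b = c"
    proof (rule ccontr)
      assume ne: "b \<noteq> c"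
      then have l: "l \<in> L2" "l \<notin> L1" using kl \<open>k = l\<close> disj by (auto simp: I_def)
      then have eq': "?O (f2 l) = ?O (f3 l)"
        using eq ne \<open>k = l\<close> by (cases b; cases c) (auto simp: f_def)
      show False
        using key[OF _ _ eq'] f2 f3 nc l by blast
    qed
    ultimately show "k = l \<and> b = c" by simp
  qed
  moreover have "(\<lambda>i. ?O (f i)) ` I \<subseteq> orbits G E (conj_action G)"
    using fE by (auto simp: orbits_def)
  moreover have "finite (orbits G E (conj_action G))"
    using fin by (simp add: orbits_def)
  ultimately have "card I \<le> card (orbits G E (conj_action G))"
    by (metis card_inj_on_le)
  moreover have "card I = card L1 + 2 * card L2"
    unfolding I_def using finL disj
    by (subst card_Un_disjoint) (auto simp: card_cartesian_product)
  ultimately show ?thesis by simp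
qed

text \<open>The normaliser of the image is the image of the normaliser. The lemma serves for inner automorphisms,
  where it says that self-normalisation is a property of the conjugacy class, and for the outer automorphism
  that produces the second class of octahedral subgroups.\<close>

lemma self_normalising_automorphism:
  assumes H: "subgroup H G" and \<phi>: "\<phi> \<in> iso G G"
    and sn: "sn H"
  shows "sn (\<phi> ` H)"
proof -
  interpret \<phi>: group_hom G G \<phi>
    using \<phi> is_group by (simp add: group_hom_def group_hom_axioms_def iso_def)
  have sub: "H \<subseteq> carrier G" using H subgroup.subset by blast
  have inj: "inj_on \<phi> (carrier G)" and surj: "\<phi> ` carrier G = carrier G"
    using \<phi> by (auto simp: iso_def bij_betw_def)
  have sg: "subgroup (\<phi> ` H) G"
    using H by (rule \<phi>.subgroup_img_is_subgroup)
  have cn: "\<phi> (cnj g x) = cnj (\<phi> g) (\<phi> x)" if "g \<in> carrier G" "x \<in> carrier G" for g x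
    using that by (simp add: cnj_def)
  show ?thesis
    unfolding self_normalising_iff[OF sg]
  proof (intro ballI impI)
    fix g assume g: "g \<in> carrier G" and eq: "cnj g ` \<phi> ` H = \<phi> ` H"
    obtain h where h: "h \<in> carrier G" "g = \<phi> h" using g surj by blast
    have "\<phi> ` (cnj h ` H) = cnj g ` \<phi> ` H"
      using h sub by (auto simp: image_image subset_iff cn intro!: image_cong)
    then have "\<phi> ` (cnj h ` H) = \<phi> ` H" using eq by simp
    then have "cnj h ` H = H"
      using inj_on_image_eq_iff[OF inj, of "cnj h ` H" H] sub h(1) by (simp add: cnj_image_subset)
    then have "h \<in> H" using sn h self_normalising_iff[OF H] by blast
    then show "g \<in> \<phi> ` H" using h by blast
  qed
qed

lemma cnj_iso: "g \<in> carrier G \<Longrightarrow> cnj g \<in> iso G G"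
  by (auto simp: iso_def hom_def cnj_mult bij_betw_def cnj_inject intro!: inj_onI)
     (metis cnj_closed cnj_inv(2) imageI inv_closed)

text \<open>By \<open>self_normalising_automorphism\<close> an orbit cannot contain both self-normalising and other subgroups.\<close>

lemma self_normalising_plus_not_le_conj_classes:
  assumes fin: "finite (carrier G)"
  shows "num_self_norm_classes G + num_non_self_norm_classes G \<le> num_conj_classes G"
proof -
  let ?E = NP
  let ?S = "{H \<in> ?E. sn H}" and ?N = "{H \<in> ?E. \<not> sn H}"
  let ?o = "\<lambda>E. orbits G E (conj_action G)"
  have sg: "subgroup H G" if "H \<in> ?E" for H using that by (simp add: nontriv_proper_subgroups_def)
  have "?o ?S \<inter> ?o ?N = {}"
  proof (rule ccontr)
    assume "?o ?S \<inter> ?o ?N \<noteq> {}"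
    then obtain H K where H: "H \<in> ?S" and K: "K \<in> ?N"
      and eq: "orbit G (conj_action G) H = orbit G (conj_action G) K"
      unfolding orbits_def by auto
    then have "K \<in> orbit G (conj_action G) H" using self_mem_conj_orbit sg by auto
    then obtain g where "g \<in> carrier G" "K = cnj g ` H" using mem_conj_orbit sg H by auto
    then have "sn K"
      using self_normalising_automorphism cnj_iso sg H by auto
    then show False using K by simp
  qed
  moreover have "?o ?E = ?o ?S \<union> ?o ?N" by (auto simp: orbits_def)
  moreover have "finite (?o ?E)"
    using finite_nontriv_proper_subgroups[OF fin] by (simp add: orbits_def)
  ultimately show ?thesis
    unfolding num_self_norm_classes_def num_non_self_norm_classes_def num_conj_classes_def
    by (simp add: card_Un_disjoint)
qed

end

section \<open>Cyclic and dihedral subgroups in the normaliser of a torus\<close>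

locale group_with_prime = group G for G (structure) +
  fixes p :: nat
  assumes fin: "finite (carrier G)" and prime_p: "prime p" and p_gt_3: "p > 3"
    and elem_of_order_p: "\<exists>u\<in>carrier G. u \<noteq> \<one> \<and> u [^] p = \<one>"
begin

text \<open>A subgroup without elements of order \<open>p\<close> misses an element of the group, so it is proper for free.\<close>

lemma nontriv_properI:
  assumes "subgroup H G" and "x \<in> H" "x \<noteq> \<one>" and "\<And>x. x \<in> H \<Longrightarrow> x [^] p = \<one> \<Longrightarrow> x = \<one>"
  shows "H \<in> NP"
  using assms elem_of_order_p unfolding nontriv_proper_subgroups_def by auto

lemma finite_subgroup: "subgroup H G \<Longrightarrow> finite H"
  using fin subgroup.subset finite_subset by blast

lemma one_if_pow_coprime:
  assumes "x \<in> carrier G" "x [^] p = \<one>" "x [^] (n::nat) = \<one>" "\<not> p dvd n"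
  shows "x = \<one>"
proof -
  have "ord x dvd p" "ord x dvd n"
    using assms pow_eq_id by auto
  then have "ord x dvd gcd p n" by simp
  moreover have "gcd p n = 1"
    using assms(4) prime_p prime_imp_coprime by (metis coprime_iff_gcd_eq_1)
  ultimately have "ord x dvd 1" by simp
  then have "x [^] (1::nat) = \<one>"
    using assms(1) pow_eq_id by blast
  then show ?thesis using assms(1) by simp
qed

end

text \<open>The abstract data of a maximal torus \<open>T\<close> generated by \<open>t\<close> and its normaliser \<open>T \<union> T w\<close>.
  The last assumption controls fusion: conjugating any nontrivial element of \<open>T\<close> into \<open>T\<close> is possible
  only inside the normaliser. In a linear group it holds because such an element already determines
  the pair of eigenlines that defines the torus.\<close>

locale torus = group_with_prime +
  fixes t w :: 'a and m :: nat
  assumes t_closed [simp]: "t \<in> carrier G" and w_closed [simp]: "w \<in> carrier G"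
    and ord_t: "ord t = m" and m_pos: "m > 0" and m_coprime: "\<not> p dvd 2 * m"
    and w_sq: "w \<otimes> w = \<one>" and w_t: "w \<otimes> t \<otimes> w = inv t"
    and w_notin: "w \<notin> range (\<lambda>k::int. t [^] k)"
    and fusion_in_torus: "\<lbrakk>g \<in> carrier G; t [^] (i::int) \<noteq> \<one>; cnj g (t [^] i) \<in> range (\<lambda>k::int. t [^] k)\<rbrakk>
      \<Longrightarrow> g \<in> range (\<lambda>k::int. t [^] k) \<union> range (\<lambda>k::int. t [^] k \<otimes> w)"
begin

definition rot :: "int \<Rightarrow> 'a" where "rot k = t [^] k"
definition ref :: "int \<Rightarrow> 'a" where "ref k = rot k \<otimes> w"

lemma rot_closed [simp]: "rot k \<in> carrier G" and ref_closed [simp]: "ref k \<in> carrier G"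
  by (simp_all add: rot_def ref_def)

lemma rot_0 [simp]: "rot 0 = \<one>" by (simp add: rot_def)

lemma rot_rot [simp]: "rot i \<otimes> rot j = rot (i + j)"
  by (simp add: rot_def int_pow_mult)

lemma inv_rot [simp]: "inv (rot k) = rot (- k)"
  by (simp add: rot_def int_pow_neg)

lemma inv_w: "inv w = w"
  using w_sq inv_equality[of w w] by simp

lemma w_rot: "w \<otimes> rot k = rot (- k) \<otimes> w"
proof -
  have "cnj w t = inv t" using w_t inv_w by (simp add: cnj_def)
  have h: "group_hom G G (cnj w)"
    using cnj_iso[of w] by (simp add: group_hom_def group_hom_axioms_def iso_def is_group)
  have "cnj w (rot k) = cnj w t [^] k"
    unfolding rot_def using group_hom.hom_int_pow[OF h] by simp
  also have "\<dots> = rot (- k)"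
    using \<open>cnj w t = inv t\<close> by (simp add: rot_def int_pow_inv int_pow_neg)
  finally show ?thesis by (simp add: cnj_eq_iff)
qed

lemma rot_ref [simp]: "rot i \<otimes> ref j = ref (i + j)"
  by (simp add: ref_def flip: m_assoc)

lemma ref_rot [simp]: "ref i \<otimes> rot j = ref (i - j)"
  by (simp add: ref_def m_assoc w_rot) (simp flip: m_assoc)

lemma ref_ref [simp]: "ref i \<otimes> ref j = rot (i - j)"
proof -
  have "ref i \<otimes> ref j = (ref i \<otimes> rot j) \<otimes> w"
    by (metis ref_def m_assoc ref_closed rot_closed w_closed)
  also have "\<dots> = rot (i - j)" by (simp only: ref_rot) (simp add: ref_def m_assoc w_sq)
  finally show ?thesis .
qed

lemma inv_ref [simp]: "inv (ref k) = ref k"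
  by (rule inv_equality) auto

lemma cnj_simps [simp]:
  "cnj (rot k) (rot l) = rot l" "cnj (rot k) (ref l) = ref (l + 2 * k)"
  "cnj (ref k) (rot l) = rot (- l)" "cnj (ref k) (ref l) = ref (2 * k - l)"
  by (simp_all add: cnj_def algebra_simps)

lemma rot_eq_one [simp]: "rot k = \<one> \<longleftrightarrow> int m dvd k"
  by (simp add: rot_def int_pow_eq_id ord_t)

lemma rot_eq_rot: "rot i = rot j \<longleftrightarrow> int m dvd i - j"
  by (simp add: rot_def int_pow_eq ord_t dvd_diff_commute)

lemma ref_eq_ref: "ref i = ref j \<longleftrightarrow> int m dvd i - j"
  by (simp add: ref_def rot_eq_rot)

lemma ref_neq_rot [simp]: "ref i \<noteq> rot j" "rot j \<noteq> ref i"
proof -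
  have "w = rot (j - i)" if "ref i = rot j"
  proof -
    have "w = rot (- i) \<otimes> ref i" by (simp add: ref_def flip: m_assoc)
    then show ?thesis using that by simp
  qed
  then show "ref i \<noteq> rot j" "rot j \<noteq> ref i"
    using w_notin by (auto simp: rot_def)
qed

lemma ref_neq_one [simp]: "ref i \<noteq> \<one>"
  using ref_neq_rot(1)[of i 0] by simp

lemma rot_pow [simp]: "rot i [^] (n::nat) = rot (i * int n)"
  by (simp add: rot_def int_pow_pow flip: int_pow_int)

lemma ref_pow_p: "ref i [^] p = \<one> \<Longrightarrow> False"
proof -
  assume "ref i [^] p = \<one>"
  moreover have "ref i [^] (2::nat) = \<one>" by (simp add: numeral_2_eq_2)
  moreover have "\<not> p dvd 2" using p_gt_3 by (auto dest: dvd_imp_le)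
  ultimately show False using one_if_pow_coprime[of "ref i" 2] by simp
qed

text \<open>The order of the torus is prime to \<open>p\<close>, so raising to the power \<open>p\<close> is injective on it.\<close>

lemma rot_pow_p: "rot i [^] p = \<one> \<longleftrightarrow> rot i = \<one>"
proof -
  have "\<not> p dvd m" using m_coprime by (metis dvd_mult)
  then have "coprime (int p) (int m)"
    using prime_p by (simp add: prime_imp_coprime)
  then show ?thesis
    by (simp add: coprime_commute coprime_dvd_mult_left_iff)
qed

lemma normalising_rot:
  assumes "g \<in> carrier G" "\<not> int m dvd i" "cnj g (rot i) = rot j"
  shows "(\<exists>k. g = rot k) \<or> (\<exists>k. g = ref k)"
  using fusion_in_torus[OF assms(1), of i] assms by (auto simp flip: rot_def ref_def)

definition cyc :: "int \<Rightarrow> 'a set" where "cyc n = rot ` {k. n dvd k}"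

text \<open>Subgroups are indexed by the index \<open>n\<close> of their rotations in the torus. The reflections in the dihedral
  subgroup form one coset of the rotation subgroup, chosen by the offset \<open>j\<close>; up to conjugation only the
  parity of \<open>j\<close> matters, and only if \<open>n\<close> is even.\<close>

definition dih :: "int \<Rightarrow> int \<Rightarrow> 'a set" where
  "dih n j = cyc n \<union> ref ` {k. n dvd k - j}"

context
  fixes n :: int and d :: nat
  assumes m_eq: "int m = n * int d"
begin

lemma n_pos: "n > 0" and d_pos: "d > 0"
proof -
  have "n * int d > 0" using m_eq m_pos by simp
  then show "n > 0" "d > 0" by (auto simp: zero_less_mult_iff)
qed

lemma rot_mem_cyc: "rot k \<in> cyc n \<longleftrightarrow> n dvd k"
proof
  assume "rot k \<in> cyc n"
  then obtain l where "n dvd l" "int m dvd k - l" by (auto simp: cyc_def rot_eq_rot)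
  then have "n dvd k - l" using m_eq dvd_mult_left by metis
  then show "n dvd k" using \<open>n dvd l\<close> by (metis dvd_add diff_add_cancel)
qed (auto simp: cyc_def)

lemma ref_notin_cyc [simp]: "ref k \<notin> cyc n" by (auto simp: cyc_def)

lemma rot_mem_dih: "rot k \<in> dih n j \<longleftrightarrow> n dvd k"
  by (auto simp: dih_def rot_mem_cyc)

lemma ref_mem_dih: "ref k \<in> dih n j \<longleftrightarrow> n dvd k - j"
proof
  assume "ref k \<in> dih n j"
  then obtain l where "n dvd l - j" "int m dvd k - l" by (auto simp: dih_def ref_eq_ref cyc_def)
  then have "n dvd k - l" using m_eq dvd_mult_left by metis
  then show "n dvd k - j" using \<open>n dvd l - j\<close> dvd_add[of n "k - l" "l - j"] by simp
qed (auto simp: dih_def)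

lemma subgroup_cyc: "subgroup (cyc n) G"
  by (rule subgroupI) (auto simp: cyc_def intro!: imageI)

lemma subgroup_dih: "subgroup (dih n j) G"
proof (rule subgroupI)
  show "dih n j \<noteq> {}" by (auto simp: dih_def cyc_def)
  fix x y assume x: "x \<in> dih n j"
  then show "inv x \<in> dih n j" by (auto simp: dih_def cyc_def)
  assume y: "y \<in> dih n j"
  have a: "n dvd k - j - (l - j)" if "n dvd k - j" "n dvd l - j" for k l
    using that by (rule dvd_diff)
  have b: "n dvd l - j - k" "n dvd k + (l - j)" if "n dvd k" "n dvd l - j" for k l
    using that by (auto intro: dvd_diff dvd_add)
  consider k l where "x = rot k" "y = rot l" "n dvd k" "n dvd l"
    | k l where "x = rot k" "y = ref l" "n dvd k" "n dvd l - j"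
    | k l where "x = ref k" "y = rot l" "n dvd k - j" "n dvd l"
    | k l where "x = ref k" "y = ref l" "n dvd k - j" "n dvd l - j"
    using x y by (auto simp: dih_def cyc_def)
  then show "x \<otimes> y \<in> dih n j"
    using a b by cases (auto simp: rot_mem_dih ref_mem_dih algebra_simps)
qed (auto simp: dih_def cyc_def)

lemma inj_rot_progression: "inj_on (\<lambda>i. rot (j + n * int i)) {..<d}"
proof (rule inj_onI)
  fix x y assume xy: "x \<in> {..<d}" "y \<in> {..<d}" "rot (j + n * int x) = rot (j + n * int y)"
  then have "n * int d dvd n * (int x - int y)"
    by (simp add: rot_eq_rot m_eq algebra_simps)
  then have "int d dvd int x - int y" using n_pos by simp
  moreover have "\<bar>int x - int y\<bar> < int d" using xy by auto
  ultimately show "x = y" using dvd_imp_le_int[of "int x - int y" "int d"] by auto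
qed

lemma progression_mod:
  assumes "n dvd k - j"
  shows "\<exists>i<d. int m dvd k - (j + n * int i)"
proof -
  obtain l where l: "k - j = n * l" using assms by blast
  have "nat (l mod int d) < d" using d_pos by (simp add: nat_less_iff)
  moreover have "k - (j + n * int (nat (l mod int d))) = n * (l - l mod int d)"
    using l d_pos by (simp add: algebra_simps)
  moreover have "int d dvd l - l mod int d" by (simp add: minus_mod_eq_mult_div)
  ultimately show ?thesis unfolding m_eq by (metis mult_dvd_mono dvd_refl)
qed

lemma cyc_eq: "cyc n = (\<lambda>i. rot (n * int i)) ` {..<d}"
proof
  show "cyc n \<subseteq> (\<lambda>i. rot (n * int i)) ` {..<d}"
    using progression_mod[of _ 0] by (fastforce simp: cyc_def rot_eq_rot image_iff)
qed (auto simp: cyc_def)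

lemma card_cyc: "card (cyc n) = d"
  using inj_rot_progression[of 0] by (simp add: cyc_eq card_image)

lemma card_dih: "card (dih n j) = 2 * d"
proof -
  have e: "ref ` {k. n dvd k - j} = (\<lambda>i. ref (j + n * int i)) ` {..<d}"
  proof
    show "ref ` {k. n dvd k - j} \<subseteq> (\<lambda>i. ref (j + n * int i)) ` {..<d}"
      using progression_mod[of _ j] by (fastforce simp: ref_eq_ref image_iff)
  qed auto
  have "inj_on (\<lambda>i. ref (j + n * int i)) {..<d}"
    using inj_rot_progression[of j] by (auto simp: inj_on_def rot_eq_rot ref_eq_ref)
  then have "card (ref ` {k. n dvd k - j}) = d"
    unfolding e by (simp add: card_image)
  moreover have "finite (cyc n)" by (simp add: cyc_eq)
  moreover have "cyc n \<inter> ref ` {k. n dvd k - j} = {}" by (auto simp: cyc_def)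
  ultimately show ?thesis
    unfolding dih_def using card_cyc e by (subst card_Un_disjoint) auto
qed

lemma shape_cyc: "shape_of G p (cyc n) = Cyclic d"
proof -
  have 1: "\<not> (\<exists>x\<in>cyc n. x \<noteq> \<one> \<and> x [^] p = \<one>)"
    using rot_pow_p by (fastforce simp: cyc_def)
  have 2: "\<not> (\<exists>x\<in>cyc n. \<exists>y\<in>cyc n. x \<otimes> x \<noteq> \<one> \<and> y \<otimes> y \<noteq> \<one> \<and> x \<otimes> y \<noteq> y \<otimes> x)"
    by (auto simp: cyc_def add.commute)
  have "rot n \<in> cyc n" "\<forall>y\<in>cyc n. \<exists>k::nat. y = rot n [^] k"
    by (simp add: rot_mem_cyc) (auto simp: cyc_eq)
  then have 3: "\<exists>x\<in>cyc n. \<forall>y\<in>cyc n. \<exists>k::nat. y = x [^] k" by blast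
  show ?thesis unfolding shape_of_def using 1 2 3 card_cyc by simp
qed

lemma shape_dih:
  assumes "d > 1"
  shows "shape_of G p (dih n j) = Dihedral d"
proof -
  have 1: "\<not> (\<exists>x\<in>dih n j. x \<noteq> \<one> \<and> x [^] p = \<one>)"
    using rot_pow_p ref_pow_p by (fastforce simp: dih_def cyc_def)
  have 2: "\<not> (\<exists>x\<in>dih n j. \<exists>y\<in>dih n j. x \<otimes> x \<noteq> \<one> \<and> y \<otimes> y \<noteq> \<one> \<and> x \<otimes> y \<noteq> y \<otimes> x)"
    by (auto simp: dih_def cyc_def add.commute)
  have 3: "\<not> (\<exists>x\<in>dih n j. \<forall>y\<in>dih n j. \<exists>k::nat. y = x [^] k)"
  proof safe
    fix x assume x: "x \<in> dih n j" and gen: "\<forall>y\<in>dih n j. \<exists>k::nat. y = x [^] k"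
    have rotn: "rot n \<in> dih n j" and refj: "ref j \<in> dih n j"
      by (simp_all add: rot_mem_dih ref_mem_dih)
    have n: "\<not> int m dvd n"
      using n_pos d_pos assms unfolding m_eq by (auto simp: zdvd_not_zless dest!: zdvd_imp_le)
    from x consider l where "x = rot l" | l where "x = ref l" by (auto simp: dih_def cyc_def)
    then show False
    proof cases
      case 1
      then show False using gen refj by fastforce
    next
      case 2
      obtain k :: nat where k: "rot n = ref l [^] k" using gen rotn 2 by metis
      have sq: "ref l [^] (2 * i) = \<one>" for i :: nat
      proof -
        have "ref l [^] (2 * i) = (ref l [^] (2::nat)) [^] i" by (simp add: nat_pow_pow)
        then show ?thesis by (simp add: numeral_2_eq_2)
      qed
      show False
      proof (cases "even k")
        case True
        then have "rot n = \<one>" using k sq by (elim evenE) simp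
        then show False using n by simp
      next
        case False
        then obtain i where "k = 2 * i + 1" by (elim oddE)
        then have "rot n = ref l" using k sq by simp
        then show False by simp
      qed
    qed
  qed
  show ?thesis unfolding shape_of_def using 1 2 3 card_dih by simp
qed

lemma rot_n_neq_one: "d > 1 \<Longrightarrow> rot n \<noteq> \<one>"
  using n_pos d_pos unfolding rot_eq_one m_eq by (auto dest!: zdvd_imp_le)

lemma cyc_class:
  assumes d: "d > 1"
  shows "cyc n \<in> NP" "\<not> sn (cyc n)"
proof -
  show "cyc n \<in> NP"
  proof (rule nontriv_properI[OF subgroup_cyc])
    show "rot n \<in> cyc n" by (simp add: rot_mem_cyc)
    show "rot n \<noteq> \<one>" using d by (rule rot_n_neq_one)
    fix x assume "x \<in> cyc n" "x [^] p = \<one>"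
    then show "x = \<one>" using rot_pow_p by (auto simp: cyc_def simp del: rot_pow rot_eq_one)
  qed
  have "cnj (ref 0) ` cyc n = cyc n"
    by (rule cnj_image_eqI[OF finite_subgroup[OF subgroup_cyc]]) (auto simp: cyc_def)
  moreover have "ref 0 \<notin> cyc n" by simp
  ultimately show "\<not> sn (cyc n)"
    using self_normalising_iff[OF subgroup_cyc] by (metis ref_closed)
qed

lemma dih_nontriv_proper: "dih n j \<in> NP"
proof (rule nontriv_properI[OF subgroup_dih])
  show "ref j \<in> dih n j" by (simp add: ref_mem_dih)
  show "ref j \<noteq> \<one>" by simp
  fix x assume "x \<in> dih n j" "x [^] p = \<one>"
  then show "x = \<one>"
    using rot_pow_p ref_pow_p by (auto simp: dih_def cyc_def simp del: rot_pow rot_eq_one)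
qed

text \<open>For \<open>d > 2\<close> the rotation \<open>rot n\<close> has order greater than 2, so a conjugating element cannot map it to a reflection
  and hence lies in the normaliser of the torus. There conjugation moves the offset of a reflection by an
  even amount, possibly after a sign change, and this yields the congruences.\<close>

lemma dih_conjugator:
  assumes d: "d > 2" and g: "g \<in> carrier G" and eq: "cnj g ` dih n i = dih n j"
  shows "(\<exists>k. g = rot k \<and> n dvd 2 * k + i - j) \<or> (\<exists>k. g = ref k \<and> n dvd 2 * k - i - j)"
proof -
  have nm: "\<not> int m dvd n" using rot_n_neq_one d by simp
  have "cnj g (rot n) \<in> dih n j"
    using eq by (metis rot_mem_dih dvd_refl imageI)
  moreover have "cnj g (rot n) \<noteq> ref k" for k
  proof
    assume e: "cnj g (rot n) = ref k"
    \<comment> \<open>A reflection is an involution, but the square of \<open>rot n\<close> is nontrivial.\<close>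
    have "cnj g (rot n \<otimes> rot n) = \<one>"
      using g e by (simp add: cnj_mult del: rot_rot)
    then have "rot (n + n) = \<one>" using g by simp
    then have "n * int d dvd n * 2" by (simp add: m_eq algebra_simps)
    then have "int d dvd 2" using n_pos by simp
    then show False using d zdvd_imp_le by fastforce
  qed
  ultimately obtain l where "cnj g (rot n) = rot l" by (auto simp: dih_def cyc_def)
  then have gg: "(\<exists>k. g = rot k) \<or> (\<exists>k. g = ref k)" using normalising_rot g nm by blast
  have r: "cnj g (ref i) \<in> dih n j"
    using eq by (metis ref_mem_dih diff_self dvd_0_right imageI)
  from gg show ?thesis
  proof
    assume "\<exists>k. g = rot k"
    then obtain k where k: "g = rot k" by blast
    then have "n dvd i + 2 * k - j" using r by (simp add: ref_mem_dih)
    then show ?thesis using k by (auto simp: algebra_simps)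
  next
    assume "\<exists>k. g = ref k"
    then obtain k where k: "g = ref k" by blast
    then have "n dvd 2 * k - i - j" using r by (simp add: ref_mem_dih)
    then show ?thesis using k by auto
  qed
qed

lemma dih_self_normalising:
  assumes "d > 2" "odd n"
  shows "sn (dih n 0)"
  unfolding self_normalising_iff[OF subgroup_dih]
proof (intro ballI impI)
  fix g assume g: "g \<in> carrier G" "cnj g ` dih n 0 = dih n 0"
  have "coprime n 2" using assms(2) by simp
  then have half: "n dvd k" if "n dvd 2 * k" for k
    using that coprime_dvd_mult_right_iff by blast
  have "(\<exists>k. g = rot k \<and> n dvd 2 * k) \<or> (\<exists>k. g = ref k \<and> n dvd 2 * k)"
    using dih_conjugator[OF assms(1) g] by (simp only: add_0_right diff_0_right)
  then show "g \<in> dih n 0"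
  proof (elim disjE exE conjE)
    fix k assume "g = rot k" "n dvd 2 * k"
    then show ?thesis using half[of k] by (simp only: rot_mem_dih)
  next
    fix k assume "g = ref k" "n dvd 2 * k"
    then show ?thesis using half[of k] by (simp only: ref_mem_dih diff_0_right)
  qed
qed

text \<open>Half of the basic rotation shifts offsets by a full \<open>n\<close>, so it normalises the subgroup without belonging to it.\<close>

lemma dih_not_self_normalising:
  assumes "even n"
  shows "\<not> sn (dih n j)"
proof -
  obtain h where h: "n = 2 * h" using assms by blast
  have "cnj (rot h) ` dih n j = dih n j"
  proof (rule cnj_image_eqI[OF finite_subgroup[OF subgroup_dih]])
    show "cnj (rot h) x \<in> dih n j" if "x \<in> dih n j" for x
    proof -
      have "n dvd k + n - j" if "n dvd k - j" for k
        using that by (metis dvd_add_triv_right_iff diff_add_eq add_diff_eq)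
      then show ?thesis
        using that unfolding dih_def cyc_def by (auto simp flip: h)
    qed
  qed (auto simp: dih_def cyc_def)
  moreover have "\<not> n dvd h" using h n_pos by (auto dest!: zdvd_imp_le)
  then have "rot h \<notin> dih n j" by (simp only: rot_mem_dih not_False_eq_True)
  ultimately show ?thesis
    using self_normalising_iff[OF subgroup_dih] by (metis rot_closed)
qed

text \<open>Conjugation preserves the parity of the offset when \<open>n\<close> is even.\<close>

lemma dih_not_conjugate:
  assumes "d > 2" "even n" "g \<in> carrier G"
  shows "cnj g ` dih n 0 \<noteq> dih n 1"
proof
  assume "cnj g ` dih n 0 = dih n 1"
  from dih_conjugator[OF assms(1,3) this] obtain k where "n dvd 2 * k - 1"
    by (elim disjE exE conjE) (simp_all only: add_0_right diff_0_right)
  then have "2 dvd 2 * k - 1" using assms(2) by (rule dvd_trans[rotated])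
  then show False by presburger
qed

end

lemma cyclic_class:
  assumes "d dvd m" "d > 1"
  shows "\<exists>H\<in>NP. \<not> sn H \<and> shape_of G p H = Cyclic d"
proof -
  have "int m = int (m div d) * int d" using assms by (metis dvd_div_mult_self of_nat_mult)
  then show ?thesis using cyc_class shape_cyc assms by metis
qed

lemma dihedral_class:
  assumes "d dvd m" "d > 2" "odd (m div d)"
  shows "\<exists>H\<in>NP. sn H \<and> shape_of G p H = Dihedral d"
proof -
  have m: "int m = int (m div d) * int d" using assms by (metis dvd_div_mult_self of_nat_mult)
  show ?thesis
    using dih_nontriv_proper[OF m, of 0] dih_self_normalising[OF m] shape_dih[OF m, of 0] assms by auto
qed

lemma dihedral_classes:
  assumes "d dvd m" "d > 2" "even (m div d)"
  shows "\<exists>H\<in>NP. \<exists>K\<in>NP.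
    \<not> sn H \<and> \<not> sn K \<and>
    shape_of G p H = Dihedral d \<and> shape_of G p K = Dihedral d \<and> (\<forall>g\<in>carrier G. cnj g ` H \<noteq> K)"
proof -
  have m: "int m = int (m div d) * int d" using assms by (metis dvd_div_mult_self of_nat_mult)
  show ?thesis
    using dih_nontriv_proper[OF m] dih_not_self_normalising[OF m] shape_dih[OF m]
      dih_not_conjugate[OF m] assms
    by (intro bexI[of _ "dih (int (m div d)) 0"] bexI[of _ "dih (int (m div d)) 1"]) auto
qed

lemma dihedral_exists:
  assumes "d dvd m" "d > 2"
  shows "\<exists>H\<in>NP. shape_of G p H = Dihedral d"
  using dihedral_class[OF assms] dihedral_classes[OF assms] by blast

end

section \<open>Subgroups of a Borel subgroup\<close>

text \<open>A subgroup \<open>U\<close> of order \<open>p\<close>, whose normaliser is the semidirect product of \<open>U\<close> with a cyclic group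
  generated by \<open>h\<close>. As for tori, the normaliser assumption applies already to elements that carry a single
  nontrivial element of \<open>U\<close> into \<open>U\<close>.\<close>

locale borel = group_with_prime +
  fixes U :: "'a set" and h :: 'a and a :: nat
  assumes subgroup_U: "subgroup U G" and card_U: "card U = p"
    and h_closed [simp]: "h \<in> carrier G" and ord_h: "ord h = a" and a_pos: "a > 0"
    and a_coprime: "\<not> p dvd a"
    and cnj_h: "x \<in> U \<Longrightarrow> cnj h x \<in> U"
    and normaliser_U: "\<lbrakk>g \<in> carrier G; x \<in> U; x \<noteq> \<one>; cnj g x \<in> U\<rbrakk> \<Longrightarrow> \<exists>y\<in>U. \<exists>i::int. g = y \<otimes> h [^] i"
    and borel_proper: "\<exists>g\<in>carrier G. \<forall>y\<in>U. \<forall>i::int. g \<noteq> y \<otimes> h [^] i"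
begin

definition tor :: "int \<Rightarrow> 'a" where "tor i = h [^] i"

lemma tor_closed [simp]: "tor i \<in> carrier G" by (simp add: tor_def)

lemma tor_tor [simp]: "tor i \<otimes> tor j = tor (i + j)" by (simp add: tor_def int_pow_mult)

lemma inv_tor [simp]: "inv (tor i) = tor (- i)" by (simp add: tor_def int_pow_neg)

lemma tor_0 [simp]: "tor 0 = \<one>" by (simp add: tor_def)

lemma tor_eq_one: "tor k = \<one> \<longleftrightarrow> int a dvd k" by (simp add: tor_def int_pow_eq_id ord_h)

lemma U_closed [simp]: "x \<in> U \<Longrightarrow> x \<in> carrier G"
  using subgroup_U subgroup.mem_carrier by metis

lemma U_pow_p:
  assumes "x \<in> U"
  shows "x [^] p = \<one>"
proof -
  interpret U: group "G\<lparr>carrier := U\<rparr>" using subgroup_U by (rule subgroup_imp_group)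
  have "x [^]\<^bsub>G\<lparr>carrier := U\<rparr>\<^esub> order (G\<lparr>carrier := U\<rparr>) = \<one>\<^bsub>G\<lparr>carrier := U\<rparr>\<^esub>"
    using assms by (intro U.pow_order_eq_1) auto
  then show ?thesis by (simp add: order_def card_U flip: nat_pow_consistent)
qed

lemma dvd_if_dvd_mult_p: "int a dvd i * int p \<Longrightarrow> int a dvd i"
proof -
  have "coprime (int p) (int a)"
    using a_coprime prime_p by (simp add: prime_imp_coprime)
  then show "int a dvd i * int p \<Longrightarrow> int a dvd i"
    by (simp add: coprime_commute coprime_dvd_mult_left_iff)
qed

text \<open>The elements of \<open>U\<close> have \<open>p\<close>-th power 1, while the order of \<open>h\<close> is prime to \<open>p\<close>; hence the product of
  \<open>U\<close> and the powers of \<open>h\<close> is semidirect.\<close>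

lemma tor_in_U: "tor i \<in> U \<longleftrightarrow> int a dvd i"
proof
  assume "tor i \<in> U"
  then have "tor i [^] p = \<one>" by (rule U_pow_p)
  then have "tor (i * int p) = \<one>"
    by (simp add: tor_def int_pow_pow flip: int_pow_int)
  then show "int a dvd i" unfolding tor_eq_one by (rule dvd_if_dvd_mult_p)
next
  assume "int a dvd i"
  then have "tor i = \<one>" by (simp add: tor_eq_one)
  then show "tor i \<in> U" using subgroup_U by (simp add: subgroup.one_closed)
qed

lemma cnj_tor:
  assumes "x \<in> U"
  shows "cnj (tor i) x \<in> U"
proof -
  have pow: "cnj (h [^] k) x \<in> U" for k :: nat
    using assms by (induction k arbitrary: x) (simp_all add: cnj_by_mult cnj_h)
  have "int (nat (i mod int a)) = i mod int a" using a_pos by simp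
  moreover have "tor i = tor (i mod int a)"
    by (simp add: tor_def int_pow_eq ord_h mod_eq_dvd_iff flip: mod_eq_dvd_iff)
  ultimately show ?thesis
    using pow[of "nat (i mod int a)"] by (simp add: tor_def flip: int_pow_int)
qed

definition bor :: "int \<Rightarrow> 'a set" where "bor n = {x \<otimes> tor i | x i. x \<in> U \<and> n dvd i}"

lemma U_tor_mult:
  assumes "x \<in> U" "y \<in> U"
  shows "(x \<otimes> tor i) \<otimes> (y \<otimes> tor j) = (x \<otimes> cnj (tor i) y) \<otimes> tor (i + j)" "x \<otimes> cnj (tor i) y \<in> U"
proof -
  have "tor i \<otimes> y = cnj (tor i) y \<otimes> tor i"
    using cnj_eq_iff[of "tor i" y "cnj (tor i) y"] assms by simp
  then have "(x \<otimes> tor i) \<otimes> (y \<otimes> tor j) = x \<otimes> ((cnj (tor i) y \<otimes> tor i) \<otimes> tor j)"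
    using assms by (simp add: m_assoc flip: m_assoc[of "tor i" y])
  also have "\<dots> = (x \<otimes> cnj (tor i) y) \<otimes> tor (i + j)"
    using assms by (simp add: m_assoc)
  finally show "(x \<otimes> tor i) \<otimes> (y \<otimes> tor j) = (x \<otimes> cnj (tor i) y) \<otimes> tor (i + j)" .
  show "x \<otimes> cnj (tor i) y \<in> U"
    using assms cnj_tor subgroup_U by (simp add: subgroup.m_closed)
qed

lemma U_tor_pow:
  assumes "x \<in> U"
  shows "\<exists>y\<in>U. (x \<otimes> tor i) [^] (k::nat) = y \<otimes> tor (i * int k)"
proof (induction k)
  case 0
  then show ?case using subgroup_U subgroup.one_closed by force
next
  case (Suc k)
  then obtain y where y: "y \<in> U" "(x \<otimes> tor i) [^] k = y \<otimes> tor (i * int k)" by blast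
  then have "(x \<otimes> tor i) [^] Suc k = (y \<otimes> cnj (tor (i * int k)) x) \<otimes> tor (i * int k + i)"
    using U_tor_mult(1)[OF y(1) assms] by simp
  then show ?case using U_tor_mult(2)[OF y(1) assms] by (auto simp: algebra_simps)
qed

lemma U_tor_inject:
  assumes "x \<in> U" "y \<in> U" "x \<otimes> tor i = y \<otimes> tor j"
  shows "int a dvd i - j"
proof -
  have "inv y \<otimes> (x \<otimes> tor i) = tor j"
    using assms by (simp add: inv_cancel)
  then have "(inv y \<otimes> x) \<otimes> tor i = tor j"
    using assms by (simp add: m_assoc)
  then have "inv y \<otimes> x = tor (j - i)"
    using assms inv_solve_right[of "inv y \<otimes> x" "tor j" "tor i"] by simp
  moreover have "inv y \<otimes> x \<in> U"
    using assms subgroup_U by (simp add: subgroup.m_closed subgroup.m_inv_closed)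
  ultimately show ?thesis by (simp add: tor_in_U dvd_diff_commute)
qed

context
  fixes n :: int and d :: nat
  assumes a_eq: "int a = n * int d"
begin

lemma bor_n_pos: "n > 0" and bor_d_pos: "d > 0"
proof -
  have "n * int d > 0" using a_eq a_pos by simp
  then show "n > 0" "d > 0" by (auto simp: zero_less_mult_iff)
qed

lemma U_tor_mem_bor:
  assumes "x \<in> U"
  shows "x \<otimes> tor i \<in> bor n \<longleftrightarrow> n dvd i"
proof
  assume "x \<otimes> tor i \<in> bor n"
  then obtain y j where y: "y \<in> U" "n dvd j" "x \<otimes> tor i = y \<otimes> tor j" by (auto simp: bor_def)
  then have "int a dvd i - j" using U_tor_inject assms by blast
  then have "n dvd i - j" using a_eq dvd_mult_left by metis
  then show "n dvd i" using y(2) by (metis dvd_add diff_add_cancel)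
qed (use assms in \<open>auto simp: bor_def\<close>)

lemma subgroup_bor: "subgroup (bor n) G"
proof (rule subgroupI)
  show "bor n \<subseteq> carrier G" by (auto simp: bor_def)
  have "\<one> \<in> U" using subgroup_U by (rule subgroup.one_closed)
  then show "bor n \<noteq> {}" using U_tor_mem_bor[of \<one> 0] by auto
  fix g assume "g \<in> bor n"
  then obtain x i where x: "x \<in> U" "n dvd i" "g = x \<otimes> tor i" by (auto simp: bor_def)
  have "inv g = cnj (tor (- i)) (inv x) \<otimes> tor (- i)"
    using x by (simp add: inv_mult_group cnj_def m_assoc)
  moreover have "cnj (tor (- i)) (inv x) \<in> U"
    using x subgroup_U by (simp add: cnj_tor subgroup.m_inv_closed)
  ultimately show "inv g \<in> bor n" using x by (simp add: U_tor_mem_bor)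
  fix g' assume "g' \<in> bor n"
  then obtain y j where y: "y \<in> U" "n dvd j" "g' = y \<otimes> tor j" by (auto simp: bor_def)
  show "g \<otimes> g' \<in> bor n"
    using x y U_tor_mult[OF x(1) y(1)] by (simp add: U_tor_mem_bor)
qed

lemma card_bor: "card (bor n) = p * d"
proof -
  let ?f = "\<lambda>(x, i). x \<otimes> tor (n * int i)"
  have "inj_on ?f (U \<times> {..<d})"
  proof (rule inj_onI, clarsimp)
    fix x i y j
    assume xy: "x \<in> U" "y \<in> U" and ij: "i < d" "j < d"
      and eq: "x \<otimes> tor (n * int i) = y \<otimes> tor (n * int j)"
    have "n * int d dvd n * (int i - int j)"
      using U_tor_inject[OF xy eq] by (simp add: a_eq algebra_simps)
    then have "int d dvd int i - int j" using bor_n_pos by simp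
    moreover have "\<bar>int i - int j\<bar> < int d" using ij by auto
    ultimately have "i = j" using dvd_imp_le_int[of "int i - int j" "int d"] by auto
    then show "x = y \<and> i = j" using eq xy by simp
  qed
  moreover have "bor n = ?f ` (U \<times> {..<d})"
  proof
    show "bor n \<subseteq> ?f ` (U \<times> {..<d})"
    proof
      fix g assume "g \<in> bor n"
      then obtain x l where x: "x \<in> U" "g = x \<otimes> tor (n * l)" by (auto simp: bor_def)
      have "int d dvd l - l mod int d" by (simp add: minus_mod_eq_mult_div)
      then have "int a dvd n * l - n * (l mod int d)"
        unfolding a_eq by (simp flip: right_diff_distrib)
      then have "tor (n * l) = tor (n * int (nat (l mod int d)))"
        using bor_d_pos by (simp add: tor_def int_pow_eq ord_h dvd_diff_commute)
      moreover have "nat (l mod int d) < d" using bor_d_pos by (simp add: nat_less_iff)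
      ultimately show "g \<in> ?f ` (U \<times> {..<d})" using x by force
    qed
  qed (auto simp: U_tor_mem_bor)
  ultimately show ?thesis by (simp add: card_image card_cartesian_product card_U)
qed

lemma nontrivial_in_U: "\<exists>x\<in>U. x \<noteq> \<one>"
proof (rule ccontr)
  assume "\<not> ?thesis"
  then have "card U \<le> card {\<one>}" by (intro card_mono) auto
  then show False using card_U p_gt_3 by simp
qed

lemma U_sub_bor: "x \<in> U \<Longrightarrow> x \<in> bor n"
  using U_tor_mem_bor[of x 0] by simp

lemma shape_bor: "shape_of G p (bor n) = Borel d"
proof -
  have "\<exists>x\<in>bor n. x \<noteq> \<one> \<and> x [^] p = \<one>"
    using nontrivial_in_U U_sub_bor U_pow_p by blast
  then show ?thesis using card_bor p_gt_3 by (simp add: shape_of_def)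
qed

lemma bor_nontriv_proper: "bor n \<in> NP"
proof -
  have "bor n \<noteq> {\<one>}" using nontrivial_in_U U_sub_bor by blast
  moreover obtain g where "g \<in> carrier G" "\<forall>y\<in>U. \<forall>i::int. g \<noteq> y \<otimes> h [^] i"
    using borel_proper by blast
  then have "g \<in> carrier G" "g \<notin> bor n" by (auto simp: bor_def tor_def)
  then have "bor n \<noteq> carrier G" by blast
  ultimately show ?thesis using subgroup_bor by (simp add: nontriv_proper_subgroups_def)
qed

lemma bor_not_self_normalising:
  assumes "n > 1"
  shows "\<not> sn (bor n)"
proof -
  have "cnj (tor 1) ` bor n = bor n"
  proof (rule cnj_image_eqI[OF finite_subgroup[OF subgroup_bor]])
    fix g assume "g \<in> bor n"
    then obtain x i where x: "x \<in> U" "n dvd i" "g = x \<otimes> tor i" by (auto simp: bor_def)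
    have "cnj (tor 1) (tor i) = tor i" by (simp add: cnj_def)
    then have "cnj (tor 1) g = cnj (tor 1) x \<otimes> tor i" using x by (simp add: cnj_mult)
    then show "cnj (tor 1) g \<in> bor n" using x cnj_tor by (simp add: U_tor_mem_bor)
  qed (auto simp: bor_def)
  moreover have "\<one> \<in> U" using subgroup_U by (rule subgroup.one_closed)
  then have "tor 1 \<notin> bor n" using U_tor_mem_bor[of \<one> 1] assms by simp
  ultimately show ?thesis using self_normalising_iff[OF subgroup_bor] by (metis tor_closed)
qed

text \<open>The elements with \<open>p\<close>-th power 1 in the Borel subgroup are those of \<open>U\<close>: modulo \<open>U\<close> the Borel subgroup is cyclic
  of order prime to \<open>p\<close>. So whatever normalises the Borel subgroup normalises \<open>U\<close>.\<close>

lemma bor_self_normalising: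
  assumes "n = 1"
  shows "sn (bor n)"
  unfolding self_normalising_iff[OF subgroup_bor]
proof (intro ballI impI)
  fix g assume g: "g \<in> carrier G" "cnj g ` bor n = bor n"
  obtain u where u: "u \<in> U" "u \<noteq> \<one>" using nontrivial_in_U by blast
  have "cnj g u \<in> bor n" using g u U_sub_bor by blast
  then obtain x i where x: "x \<in> U" "cnj g u = x \<otimes> tor i" by (auto simp: bor_def)
  have "cnj g u [^] p = \<one>" using U_pow_p[OF u(1)] g u by (simp flip: cnj_pow)
  then obtain y where y: "y \<in> U" "y \<otimes> tor (i * int p) = \<one>"
    using U_tor_pow[OF x(1), of i p] x(2) by metis
  have "\<one> \<in> U" using subgroup_U by (rule subgroup.one_closed)
  then have "int a dvd i * int p - 0"
    using y by (intro U_tor_inject[of y \<one>]) auto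
  then have "int a dvd i" by (simp add: dvd_if_dvd_mult_p[of i])
  then have "tor i = \<one>" by (simp add: tor_eq_one)
  then have "cnj g u \<in> U" using x by simp
  then show "g \<in> bor n" using normaliser_U[OF g(1) u] assms by (auto simp: bor_def tor_def)
qed

end

lemma borel_class:
  assumes "d dvd a"
  shows "\<exists>H\<in>NP. (sn H \<longleftrightarrow> d = a) \<and> shape_of G p H = Borel d"
proof -
  have eq: "int a = int (a div d) * int d" using assms by (metis dvd_div_mult_self of_nat_mult)
  have "sn (bor (int (a div d))) \<longleftrightarrow> d = a"
  proof (cases "d = a")
    case True
    then show ?thesis using bor_self_normalising[OF eq] a_pos by simp
  next
    case False
    then have "a div d \<noteq> 1" "a div d \<noteq> 0" using assms a_pos by auto
    then show ?thesis using bor_not_self_normalising[OF eq] False by simp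
  qed
  then show ?thesis using bor_nontriv_proper[OF eq] shape_bor[OF eq] by blast
qed

end

section \<open>Klein four-groups, tetrahedral and octahedral subgroups\<close>

text \<open>A self-centralising Klein four-group, with an element \<open>c\<close> that permutes its involutions cyclically.\<close>

locale klein = group_with_prime +
  fixes x y c :: 'a
  assumes xyc_closed [simp]: "x \<in> carrier G" "y \<in> carrier G" "c \<in> carrier G"
    and x_sq: "x \<otimes> x = \<one>" and y_sq: "y \<otimes> y = \<one>" and yx: "y \<otimes> x = x \<otimes> y"
    and x_neq_one: "x \<noteq> \<one>" and y_neq_one: "y \<noteq> \<one>" and x_neq_y: "x \<noteq> y"
    and cnj_c: "cnj c x = y" "cnj c y = x \<otimes> y"
    and centraliser: "\<lbrakk>g \<in> carrier G; cnj g x = x; cnj g y = y\<rbrakk> \<Longrightarrow> g \<in> {\<one>, x, y, x \<otimes> y}"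
begin

definition z :: 'a where "z = x \<otimes> y"
definition V :: "'a set" where "V = {\<one>, x, y, z}"

lemma z_closed [simp]: "z \<in> carrier G" by (simp add: z_def)

lemma V_closed: "v \<in> V \<Longrightarrow> v \<in> carrier G" by (auto simp: V_def)

lemma V_mult [simp]:
  "x \<otimes> x = \<one>" "y \<otimes> y = \<one>" "z \<otimes> z = \<one>" "x \<otimes> y = z" "y \<otimes> x = z"
  "x \<otimes> z = y" "z \<otimes> x = y" "y \<otimes> z = x" "z \<otimes> y = x"
proof -
  have 1: "x \<otimes> (x \<otimes> g) = g" "y \<otimes> (y \<otimes> g) = g" "y \<otimes> (x \<otimes> g) = x \<otimes> (y \<otimes> g)" if "g \<in> carrier G" for g
    using that by (simp_all add: x_sq y_sq yx flip: m_assoc)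
  show "x \<otimes> x = \<one>" "y \<otimes> y = \<one>" "z \<otimes> z = \<one>" "x \<otimes> y = z" "y \<otimes> x = z"
    "x \<otimes> z = y" "z \<otimes> x = y" "y \<otimes> z = x" "z \<otimes> y = x"
    by (simp_all add: z_def x_sq y_sq yx m_assoc 1)
qed

lemma V_distinct [simp]:
  "x \<noteq> \<one>" "y \<noteq> \<one>" "z \<noteq> \<one>" "x \<noteq> y" "x \<noteq> z" "y \<noteq> z" "y \<noteq> x" "z \<noteq> x" "z \<noteq> y"
proof -
  show *: "x \<noteq> \<one>" "y \<noteq> \<one>" "x \<noteq> y" "y \<noteq> x"
    using x_neq_one y_neq_one x_neq_y by auto
  have "x \<noteq> z" using V_mult(6) V_mult(1) y_neq_one by metis
  moreover have "y \<noteq> z" using V_mult(8) V_mult(2) x_neq_one by metis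
  moreover have "z \<noteq> \<one>" using V_mult(6) * by (metis r_one xyc_closed(1))
  ultimately show "z \<noteq> \<one>" "x \<noteq> z" "y \<noteq> z" "z \<noteq> x" "z \<noteq> y" by auto
qed

lemma V_inv [simp]: "inv x = x" "inv y = y" "inv z = z"
  by (auto intro: inv_equality)

lemma cnj_V [simp]: "v \<in> V \<Longrightarrow> u \<in> V \<Longrightarrow> cnj u v = v"
  by (auto simp: V_def cnj_def)

lemma cnj_z: "g \<in> carrier G \<Longrightarrow> cnj g z = cnj g x \<otimes> cnj g y"
  using cnj_mult[of g x y] by simp

lemma cnj_c_simps [simp]: "cnj c x = y" "cnj c y = z" "cnj c z = x"
  using cnj_c by (simp_all add: cnj_z)

lemma centraliser_V: "g \<in> carrier G \<Longrightarrow> cnj g x = x \<Longrightarrow> cnj g y = y \<Longrightarrow> g \<in> V"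
  using centraliser by (simp add: V_def)

lemma subgroup_V: "subgroup V G"
  by (rule subgroupI) (auto simp: V_def)

text \<open>The tetrahedral subgroup \<open>A\<close> and the normaliser \<open>S\<close> of \<open>V\<close> are given by their action on the three involutions
  of \<open>V\<close>: the elements of \<open>A\<close> act by even permutations. As \<open>V\<close> is its own centraliser, everything
  about both groups can be read off from this action, without listing elements.\<close>

definition A :: "'a set" where
  "A = {g \<in> carrier G. (cnj g x = x \<and> cnj g y = y) \<or> (cnj g x = y \<and> cnj g y = z) \<or> (cnj g x = z \<and> cnj g y = x)}"

definition S :: "'a set" where
  "S = {g \<in> carrier G. cnj g x \<in> {x, y, z} \<and> cnj g y \<in> {x, y, z}}"

lemma V_sub_A: "V \<subseteq> A"
  using V_closed by (auto simp: A_def) (simp_all add: V_def)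

lemma A_sub_S: "A \<subseteq> S" by (auto simp: A_def S_def)

lemma S_closed: "g \<in> S \<Longrightarrow> g \<in> carrier G" by (simp add: S_def)

lemma cnj_inv_eq: "g \<in> carrier G \<Longrightarrow> u \<in> carrier G \<Longrightarrow> v \<in> carrier G \<Longrightarrow> cnj g u = v \<Longrightarrow> cnj (inv g) v = u"
  using cnj_inv(1) by metis

lemma S_cases:
  assumes "g \<in> S"
  obtains "cnj g x = x" "cnj g y = y" "cnj g z = z"
    | "cnj g x = y" "cnj g y = z" "cnj g z = x"
    | "cnj g x = z" "cnj g y = x" "cnj g z = y"
    | "cnj g x = x" "cnj g y = z" "cnj g z = y"
    | "cnj g x = y" "cnj g y = x" "cnj g z = z"
    | "cnj g x = z" "cnj g y = y" "cnj g z = x"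
proof -
  have "g \<in> carrier G" using assms by (simp add: S_def)
  moreover from this have "cnj g x \<noteq> cnj g y" by (simp add: cnj_inject)
  ultimately show ?thesis
    using assms that unfolding S_def by (auto simp: cnj_z)
qed

lemma A_cases:
  assumes "g \<in> A"
  obtains "cnj g x = x" "cnj g y = y" "cnj g z = z"
    | "cnj g x = y" "cnj g y = z" "cnj g z = x"
    | "cnj g x = z" "cnj g y = x" "cnj g z = y"
  using assms that unfolding A_def by (auto simp: cnj_z)

lemma subgroup_A: "subgroup A G"
proof (rule subgroupI)
  show "A \<subseteq> carrier G" by (auto simp: A_def)
  show "A \<noteq> {}" using V_sub_A by (auto simp: V_def)
  fix g assume g: "g \<in> A"
  then have gc: "g \<in> carrier G" by (simp add: A_def)
  show "inv g \<in> A" using g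
    by (cases rule: A_cases) (use gc cnj_inv_eq[OF gc] in \<open>auto simp: A_def\<close>)
  fix h assume h: "h \<in> A"
  then have hc: "h \<in> carrier G" by (simp add: A_def)
  show "g \<otimes> h \<in> A" using g
    by (cases rule: A_cases; use h in \<open>cases rule: A_cases\<close>)
       (use gc hc in \<open>simp_all add: A_def cnj_by_mult\<close>)
qed

lemma S_permutes: "g \<in> S \<Longrightarrow> v \<in> {x, y, z} \<Longrightarrow> cnj g v \<in> {x, y, z}"
  by (erule S_cases) auto

lemma subgroup_S: "subgroup S G"
proof (rule subgroupI)
  show "S \<subseteq> carrier G" by (auto simp: S_def)
  show "S \<noteq> {}" using V_sub_A A_sub_S by (auto simp: V_def)
  fix g assume g: "g \<in> S"
  then have gc: "g \<in> carrier G" by (simp add: S_def)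
  show "inv g \<in> S" using g
    by (cases rule: S_cases) (use gc cnj_inv_eq[OF gc] in \<open>auto simp: S_def\<close>)
  fix h assume h: "h \<in> S"
  then have hc: "h \<in> carrier G" by (simp add: S_def)
  have "cnj h x \<in> {x, y, z}" "cnj h y \<in> {x, y, z}" using h by (simp_all add: S_def)
  then have "cnj g (cnj h x) \<in> {x, y, z}" "cnj g (cnj h y) \<in> {x, y, z}"
    using S_permutes[OF g] by blast+
  then show "g \<otimes> h \<in> S" using gc hc unfolding S_def by (simp add: cnj_by_mult)
qed

lemma c_in_A: "c \<in> A" by (simp add: A_def)

lemma V_pow2: "v \<in> V \<Longrightarrow> v \<otimes> v = \<one>" by (auto simp: V_def)

text \<open>The square or the cube of a permutation of three points is the identity.\<close>

lemma S_sq_or_cube: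
  assumes "g \<in> S"
  shows "g \<otimes> g \<in> V \<or> g \<otimes> g \<otimes> g \<in> V"
proof -
  have g: "g \<in> carrier G" using assms by (simp add: S_def)
  then have sq: "cnj (g \<otimes> g) v = cnj g (cnj g v)"
    and cube: "cnj (g \<otimes> g \<otimes> g) v = cnj g (cnj g (cnj g v))" if "v \<in> carrier G" for v
    using that by (simp_all add: cnj_by_mult)
  have 1: "g \<otimes> g \<in> V" if "cnj g (cnj g x) = x" "cnj g (cnj g y) = y"
    using that g by (intro centraliser_V) (simp_all add: sq)
  have 2: "g \<otimes> g \<otimes> g \<in> V" if "cnj g (cnj g (cnj g x)) = x" "cnj g (cnj g (cnj g y)) = y"
    using that g by (intro centraliser_V) (simp_all add: cube)
  from assms show ?thesis
    by (cases rule: S_cases) (use 1 2 in simp_all)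
qed

lemma V_pow_eq_one: "v \<in> V \<Longrightarrow> v [^] (n::nat) = (if even n then \<one> else v)"
  by (induction n) (auto simp: V_def)

lemma S_pow_12:
  assumes "g \<in> S"
  shows "g [^] (12::nat) = \<one>"
proof -
  have g: "g \<in> carrier G" using assms by (rule S_closed)
  have pow: "g [^] (2::nat) = g \<otimes> g" "g [^] (3::nat) = g \<otimes> g \<otimes> g"
    using g by (simp_all add: numeral_2_eq_2 numeral_3_eq_3)
  from S_sq_or_cube[OF assms] show ?thesis
  proof
    assume "g \<otimes> g \<in> V"
    then have "(g [^] (2::nat)) [^] (6::nat) = \<one>"
      by (simp add: V_pow_eq_one pow)
    then show ?thesis using g by (simp add: nat_pow_pow)
  next
    assume "g \<otimes> g \<otimes> g \<in> V"
    then have "(g [^] (3::nat)) [^] (4::nat) = \<one>"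
      by (simp add: V_pow_eq_one pow)
    then show ?thesis using g by (simp add: nat_pow_pow)
  qed
qed

lemma S_no_order_p:
  assumes "g \<in> S" "g [^] p = \<one>"
  shows "g = \<one>"
proof (rule one_if_pow_coprime[OF _ assms(2) S_pow_12[OF assms(1)]])
  show "g \<in> carrier G" using assms(1) by (rule S_closed)
  show "\<not> p dvd 12"
  proof
    assume "p dvd 12"
    then have "p dvd 2 ^ 2 * 3" by simp
    then have "p dvd 2 \<or> p dvd 3" using prime_p by (metis prime_dvd_mult_iff prime_dvd_power)
    then show False using p_gt_3 by (auto dest!: dvd_imp_le)
  qed
qed

lemma V_sub_S: "V \<subseteq> S" using V_sub_A A_sub_S by blast

text \<open>A 3-cycle does not square to the identity. In particular \<open>V\<close> is characteristic in \<open>A\<close>.\<close>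

lemma V_eq_involutions_A: "V = {g \<in> A. g \<otimes> g = \<one>}"
proof
  show "V \<subseteq> {g \<in> A. g \<otimes> g = \<one>}" using V_sub_A V_pow2 by blast
  show "{g \<in> A. g \<otimes> g = \<one>} \<subseteq> V"
  proof safe
    fix g assume g: "g \<in> A" "g \<otimes> g = \<one>"
    then have gc: "g \<in> carrier G" by (simp add: A_def)
    have "cnj g (cnj g x) = x" using g gc by (simp flip: cnj_by_mult)
    with g(1) gc show "g \<in> V"
      by (cases rule: A_cases) (auto intro: centraliser_V)
  qed
qed

lemma Klein_class:
  shows "V \<in> NP" "\<not> sn V" "shape_of G p V = Dihedral 2"
proof -
  have no_p: "v = \<one>" if "v \<in> V" "v [^] p = \<one>" for v
    using that S_no_order_p V_sub_S by blast
  then show "V \<in> NP"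
    by (intro nontriv_properI[OF subgroup_V, of x]) (auto simp: V_def)
  have "cnj c ` V = V" by (auto simp: V_def)
  moreover have "c \<notin> V" using cnj_V[of x c] cnj_c_simps(1) by (auto simp: V_def)
  ultimately show "\<not> sn V"
    using self_normalising_iff[OF subgroup_V] by (metis xyc_closed(3))
  have "\<not> (\<exists>u\<in>V. \<forall>v\<in>V. \<exists>k::nat. v = u [^] k)"
  proof safe
    fix u assume u: "u \<in> V" "\<forall>v\<in>V. \<exists>k::nat. v = u [^] k"
    then have "\<forall>v\<in>V. v = \<one> \<or> v = u" using V_pow_eq_one by metis
    then have "V \<subseteq> {\<one>, u}" by blast
    then have "{x, y, z} \<subseteq> {u}" by (auto simp: V_def)
    then have "x = u" "y = u" by auto
    then show False using x_neq_y by simp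
  qed
  moreover have "card V = 4" using V_distinct(1-3)[symmetric] by (simp add: V_def card_insert_if)
  moreover have "\<not> (\<exists>v\<in>V. v \<noteq> \<one> \<and> v [^] p = \<one>)" using no_p by blast
  moreover have "\<not> (\<exists>u\<in>V. \<exists>v\<in>V. u \<otimes> u \<noteq> \<one> \<and> v \<otimes> v \<noteq> \<one> \<and> u \<otimes> v \<noteq> v \<otimes> u)"
    using V_pow2 by blast
  ultimately show "shape_of G p V = Dihedral 2" by (simp add: shape_of_def)
qed

lemma c_sq_neq_one: "c \<otimes> c \<noteq> \<one>"
proof
  assume "c \<otimes> c = \<one>"
  then have "c \<in> V" using V_eq_involutions_A c_in_A by blast
  then have "cnj c x = x" by (intro cnj_V) (auto simp: V_def)
  then show False by simp
qed

text \<open>The two elements that do not commute are \<open>c\<close> and its conjugate \<open>x c x\<close>. If they did, conjugation by \<open>c\<close> would give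
  \<open>y c y = x c x\<close>, so \<open>c\<close> would commute with \<open>z = x y\<close>, but it carries \<open>z\<close> to \<open>x\<close>.\<close>

lemma polyhedral_class:
  assumes "subgroup H G" "A \<subseteq> H" "H \<subseteq> S"
  shows "H \<in> NP" "shape_of G p H = Polyhedral"
proof -
  have no_p: "v = \<one>" if "v \<in> H" "v [^] p = \<one>" for v
    using that S_no_order_p assms by blast
  then show "H \<in> NP"
    using assms V_sub_A by (intro nontriv_properI[OF assms(1), of x]) (auto simp: V_def)
  let ?d = "cnj x c"
  have d: "?d \<in> A"
    using c_in_A V_sub_A subgroup_A unfolding cnj_def by (auto simp: V_def intro: subgroup.m_closed)
  have "?d \<otimes> ?d = cnj x (c \<otimes> c)" by (simp add: cnj_mult)
  then have dd: "?d \<otimes> ?d \<noteq> \<one>" using c_sq_neq_one by simp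
  have "c \<otimes> ?d \<noteq> ?d \<otimes> c"
  proof
    assume "c \<otimes> ?d = ?d \<otimes> c"
    then have "cnj c ?d = ?d" by (simp add: cnj_eq_iff)
    moreover have "cnj c ?d = cnj c x \<otimes> cnj c c \<otimes> cnj c x" by (simp add: cnj_def[of x] cnj_mult)
    moreover have "cnj c c = c" by (simp add: cnj_def m_assoc)
    ultimately have "y \<otimes> c \<otimes> y = x \<otimes> c \<otimes> x" by (simp add: cnj_def[of x])
    then have "z \<otimes> c = c \<otimes> z"
      by (smt (verit) V_mult m_assoc xyc_closed m_closed r_one l_one z_closed)
    then have "cnj c z = z" using cnj_eq_iff[of c z z] by simp
    then show False by simp
  qed
  then have "\<exists>u\<in>H. \<exists>v\<in>H. u \<otimes> u \<noteq> \<one> \<and> v \<otimes> v \<noteq> \<one> \<and> u \<otimes> v \<noteq> v \<otimes> u"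
    using c_sq_neq_one dd d c_in_A assms(2) by blast
  moreover have "\<not> (\<exists>v\<in>H. v \<noteq> \<one> \<and> v [^] p = \<one>)" using no_p by blast
  ultimately show "shape_of G p H = Polyhedral" by (simp add: shape_of_def)
qed

lemma normalises_V_imp_S:
  assumes "g \<in> carrier G" "cnj g ` V \<subseteq> V"
  shows "g \<in> S"
proof -
  have "cnj g x \<in> V - {\<one>}" "cnj g y \<in> V - {\<one>}" using assms by (auto simp: V_def)
  then show ?thesis using assms(1) by (auto simp: S_def V_def)
qed

text \<open>A normalising element preserves \<open>V\<close>, so it acts on the involutions. If this action is odd, then multiplication
  by a power of \<open>c\<close> turns it into the transposition that fixes \<open>x\<close>, which the hypothesis rules out.\<close>

lemma tetrahedral_self_normalising:
  assumes no_swap: "\<And>g. g \<in> carrier G \<Longrightarrow> cnj g x = x \<Longrightarrow> cnj g y = z \<Longrightarrow> False"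
  shows "sn A"
  unfolding self_normalising_iff[OF subgroup_A]
proof (intro ballI impI)
  fix g assume g: "g \<in> carrier G" "cnj g ` A = A"
  have "cnj g v \<in> V" if "v \<in> V" for v
  proof -
    have "cnj g v \<in> A" using g that V_sub_A by blast
    moreover have "cnj g v \<otimes> cnj g v = \<one>"
      using that g V_closed V_pow2 by (simp flip: cnj_mult)
    ultimately show ?thesis using V_eq_involutions_A by blast
  qed
  then have "g \<in> S" using normalises_V_imp_S g by blast
  then show "g \<in> A"
  proof (cases rule: S_cases)
    case 4
    then show ?thesis using no_swap g by blast
  next
    case 5
    then show ?thesis using no_swap[of "c \<otimes> c \<otimes> g"] g by (simp add: cnj_by_mult)
  next
    case 6
    then show ?thesis using no_swap[of "c \<otimes> g"] g by (simp add: cnj_by_mult)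
  qed (use g in \<open>auto simp: A_def\<close>)
qed

end

text \<open>A square root \<open>r\<close> of the involution \<open>x\<close> realises a transposition, so that all permutations of the involutions
  occur in \<open>S\<close> and \<open>S\<close> is octahedral.\<close>

locale klein_root = klein +
  fixes r :: 'a
  assumes r_closed [simp]: "r \<in> carrier G" and r_sq: "r \<otimes> r = x" and cnj_r_y: "cnj r y = x \<otimes> y"
begin

lemma cnj_r [simp]: "cnj r x = x" "cnj r y = z" "cnj r z = y"
proof -
  show x: "cnj r x = x" by (simp add: cnj_eq_iff) (metis r_sq m_assoc r_closed)
  show y: "cnj r y = z" using cnj_r_y by simp
  show "cnj r z = y" using x y by (simp add: cnj_z)
qed

text \<open>The squares of those elements whose fourth power is 1. In the octahedral group \<open>S\<close> they form \<open>V\<close>, and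
  any isomorphism respects them; so this is a description of \<open>V\<close> as a characteristic subgroup of \<open>S\<close>.\<close>

definition squares :: "'a set \<Rightarrow> 'a set" where
  "squares H = (\<lambda>g. g \<otimes> g) ` {g \<in> H. g \<otimes> g \<otimes> (g \<otimes> g) = \<one>}"

lemma squares_S: "squares S = V"
proof
  show "squares S \<subseteq> V"
  proof (clarsimp simp: squares_def)
    fix g assume g: "g \<in> S" "g \<otimes> g \<otimes> (g \<otimes> g) = \<one>"
    then have gc [simp]: "g \<in> carrier G" using S_closed by blast
    show "g \<otimes> g \<in> V"
    proof (cases "g \<otimes> g \<in> V")
      case False
      then have "g \<otimes> g \<otimes> g \<in> V" using S_sq_or_cube g by blast
      \<comment> \<open>The sixth and the fourth power of \<open>g\<close> are trivial, hence so is the square.\<close>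
      then have "g \<otimes> g \<otimes> g \<otimes> (g \<otimes> g \<otimes> g) = \<one>" by (rule V_pow2)
      then have "(g \<otimes> g \<otimes> (g \<otimes> g)) \<otimes> (g \<otimes> g) = \<one>" by (simp add: m_assoc)
      then have "g \<otimes> g = \<one>" using g by simp
      then show ?thesis by (simp add: V_def)
    qed
  qed
  have r: "r \<in> S" by (simp add: S_def)
  have c: "c \<in> S" using c_in_A A_sub_S by blast
  have cS: "cnj c g \<in> S" if "g \<in> S" for g
    using that c subgroup_S unfolding cnj_def by (simp add: subgroup.m_closed subgroup.m_inv_closed)
  have sq: "cnj c g \<otimes> cnj c g = cnj c (g \<otimes> g)" if "g \<in> carrier G" for g
    using that by (simp add: cnj_mult)
  have "\<one> \<in> squares S"
    using subgroup_S by (auto simp: squares_def subgroup.one_closed intro!: image_eqI[of _ _ \<one>])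
  moreover have "x \<in> squares S"
    using r by (auto simp: squares_def r_sq intro!: image_eqI[of _ _ r])
  moreover have "y \<in> squares S"
    using cS[OF r] by (auto simp: squares_def sq r_sq intro!: image_eqI[of _ _ "cnj c r"])
  moreover have "z \<in> squares S"
    using cS[OF cS[OF r]] by (auto simp: squares_def sq r_sq intro!: image_eqI[of _ _ "cnj c (cnj c r)"])
  ultimately show "V \<subseteq> squares S" by (auto simp: V_def)
qed

lemma squares_image:
  assumes "H \<subseteq> carrier G" "f \<in> iso G G"
  shows "squares (f ` H) = f ` squares H"
proof -
  have hom: "f (a \<otimes> b) = f a \<otimes> f b" if "a \<in> carrier G" "b \<in> carrier G" for a b
    using assms that by (auto simp: iso_def hom_def)
  have "group_hom G G f"
    using assms is_group by (simp add: group_hom_def group_hom_axioms_def iso_def)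
  then have "f \<one> = \<one>" by (rule group_hom.hom_one)
  moreover have "inj_on f (carrier G)" using assms by (simp add: iso_def bij_betw_def)
  ultimately have one: "f a = \<one> \<longleftrightarrow> a = \<one>" if "a \<in> carrier G" for a
    using that by (metis inj_onD one_closed)
  have *: "f a \<otimes> f a = f (a \<otimes> a)" "f a \<otimes> f a \<otimes> (f a \<otimes> f a) = \<one> \<longleftrightarrow> a \<otimes> a \<otimes> (a \<otimes> a) = \<one>"
    if "a \<in> H" for a
  proof -
    have a: "a \<in> carrier G" using assms that by blast
    then show "f a \<otimes> f a = f (a \<otimes> a)" by (simp add: hom)
    show "f a \<otimes> f a \<otimes> (f a \<otimes> f a) = \<one> \<longleftrightarrow> a \<otimes> a \<otimes> (a \<otimes> a) = \<one>"
      using a by (simp add: one flip: hom)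
  qed
  show ?thesis
  proof -
    have "{g \<in> f ` H. g \<otimes> g \<otimes> (g \<otimes> g) = \<one>} = f ` {g \<in> H. g \<otimes> g \<otimes> (g \<otimes> g) = \<one>}"
      using *(2) by auto
    then show ?thesis
      unfolding squares_def using *(1) by (auto simp: image_image intro!: image_cong)
  qed
qed

lemma squares_imp_V:
  assumes f: "f \<in> iso G G" and g: "g \<in> carrier G" and eq: "cnj g ` S = f ` S"
  shows "cnj g ` V = f ` V"
proof -
  have "S \<subseteq> carrier G" using S_closed by blast
  then have "cnj g ` squares S = f ` squares S"
    using squares_image[of S "cnj g"] squares_image[of S f] cnj_iso[OF g] f eq by simp
  then show ?thesis by (simp add: squares_S)
qed

lemma octahedral_self_normalising: "sn S"
  unfolding self_normalising_iff[OF subgroup_S]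
proof (intro ballI impI)
  fix g assume g: "g \<in> carrier G" "cnj g ` S = S"
  have "cnj g ` S = cnj \<one> ` S"
    using g cnj_image_one[of S] S_closed by blast
  then have "cnj g ` V = cnj \<one> ` V"
    using squares_imp_V[OF cnj_iso[OF one_closed] g(1)] by simp
  then have "cnj g ` V = V" using cnj_image_one[of V] V_closed by blast
  then show "g \<in> S" using normalises_V_imp_S g by blast
qed

lemma S_transitive:
  assumes "u \<in> {x, y, z}" "v \<in> {x, y, z}" "u \<noteq> v"
  shows "\<exists>s\<in>carrier G. cnj s u = x \<and> cnj s v = y"
proof -
  consider "u = x" "v = y" | "u = y" "v = z" | "u = z" "v = x"
    | "u = x" "v = z" | "u = y" "v = x" | "u = z" "v = y" using assms by auto
  then show ?thesis
  proof cases
    case 1 then show ?thesis by (intro bexI[of _ \<one>]) auto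
  next
    case 2 then show ?thesis by (intro bexI[of _ "c \<otimes> c"]) (auto simp: cnj_by_mult)
  next
    case 3 then show ?thesis by (intro bexI[of _ c]) auto
  next
    case 4 then show ?thesis by (intro bexI[of _ r]) auto
  next
    case 5 then show ?thesis by (intro bexI[of _ "r \<otimes> (c \<otimes> c)"]) (auto simp: cnj_by_mult)
  next
    case 6 then show ?thesis by (intro bexI[of _ "r \<otimes> c"]) (auto simp: cnj_by_mult)
  qed
qed

text \<open>If \<open>g\<close> carried \<open>S\<close> to its image under the automorphism \<open>f\<close>, then \<open>f\<close> followed by conjugation with the
  inverse of \<open>g\<close> would permute the involutions of \<open>V\<close>. All permutations are realised inside \<open>S\<close>, so after a further
  conjugation the involutions would be fixed one by one, against the hypothesis.\<close>

lemma octahedral_not_conjugate: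
  assumes f: "f \<in> iso G G"
    and outer: "\<And>g. g \<in> carrier G \<Longrightarrow> cnj g (f x) = x \<Longrightarrow> cnj g (f y) = y \<Longrightarrow> False"
    and g: "g \<in> carrier G"
  shows "cnj g ` S \<noteq> f ` S"
proof
  assume "cnj g ` S = f ` S"
  then have eq: "cnj g ` V = f ` V" using squares_imp_V[OF f g] by blast
  have fc: "f v \<in> carrier G" if "v \<in> carrier G" for v
    using f that by (auto simp: iso_def hom_def)
  have inj: "inj_on f (carrier G)" using f by (simp add: iso_def bij_betw_def)
  have h: "group_hom G G f"
    using f is_group by (simp add: group_hom_def group_hom_axioms_def iso_def)
  have 1: "cnj (inv g) (f v) \<in> {x, y, z}" if v: "v \<in> V" "v \<noteq> \<one>" for v
  proof -
    obtain u where u: "u \<in> V" "f v = cnj g u" using eq v by blast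
    have "f v \<noteq> f \<one>" using inj v V_closed by (metis inj_onD one_closed)
    then have "f v \<noteq> \<one>" using group_hom.hom_one[OF h] by simp
    then have "u \<noteq> \<one>" using u g by auto
    then show ?thesis using u g V_closed by (auto simp: V_def)
  qed
  have "f x \<noteq> f y" using inj x_neq_y by (metis inj_onD xyc_closed(1,2))
  then have "cnj (inv g) (f x) \<noteq> cnj (inv g) (f y)"
    using g fc by (simp add: cnj_inject)
  then obtain s where s: "s \<in> carrier G" "cnj s (cnj (inv g) (f x)) = x" "cnj s (cnj (inv g) (f y)) = y"
    using S_transitive 1[of x] 1[of y] by (auto simp: V_def)
  then show False
    using outer[of "s \<otimes> inv g"] g fc by (simp add: cnj_by_mult)
qed

lemma octahedral_classes:
  assumes f: "f \<in> iso G G"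
    and outer: "\<And>g. g \<in> carrier G \<Longrightarrow> cnj g (f x) = x \<Longrightarrow> cnj g (f y) = y \<Longrightarrow> False"
  shows "\<exists>H\<in>NP. \<exists>K\<in>NP.
    sn H \<and> sn K \<and>
    shape_of G p H = Polyhedral \<and> shape_of G p K = Polyhedral \<and> (\<forall>g\<in>carrier G. cnj g ` H \<noteq> K)"
proof (intro bexI conjI)
  have inj: "inj_on f (carrier G)" and surj: "f ` carrier G = carrier G"
    using f by (auto simp: iso_def bij_betw_def)
  have h: "group_hom G G f"
    using f is_group by (simp add: group_hom_def group_hom_axioms_def iso_def)
  have sub: "S \<subseteq> carrier G" using S_closed by blast
  show "sn S" by (rule octahedral_self_normalising)
  show "sn (f ` S)"
    using self_normalising_automorphism[OF subgroup_S f octahedral_self_normalising] .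
  show S: "shape_of G p S = Polyhedral" "S \<in> NP"
    using polyhedral_class[OF subgroup_S A_sub_S] by simp_all
  show "shape_of G p (f ` S) = Polyhedral"
    using shape_of_hom_image[OF subgroup_S, of f p] S(1) inj surj sub f
    by (auto simp: inj_on_subset iso_def hom_def subset_iff)
  show "\<forall>g\<in>carrier G. cnj g ` S \<noteq> f ` S"
    by (intro ballI octahedral_not_conjugate[OF f outer])
  have "subgroup (f ` S) G" using h subgroup_S by (rule group_hom.subgroup_img_is_subgroup)
  moreover have "f ` S \<noteq> {\<one>}"
  proof
    assume "f ` S = {\<one>}"
    then have "f x = f \<one>" using V_sub_S group_hom.hom_one[OF h] by (auto simp: V_def)
    then show False using inj x_neq_one by (metis inj_onD one_closed xyc_closed(1))
  qed
  moreover have "f ` S \<noteq> carrier G"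
  proof
    assume "f ` S = carrier G"
    then have "S = carrier G"
      using inj_on_image_eq_iff[OF inj sub, of "carrier G"] surj by simp
    then show False using S(2) by (simp add: nontriv_proper_subgroups_def)
  qed
  ultimately show "f ` S \<in> NP"
    by (simp add: nontriv_proper_subgroups_def)
qed

end

section \<open>The prime field and the projective group\<close>

lemma (in field) finite_mult_group_generator:
  assumes fin: "finite (carrier R)"
  shows "\<exists>g\<in>carrier R. g \<noteq> \<zero> \<and> (\<forall>n::nat. g [^] n = \<one> \<longleftrightarrow> (card (carrier R) - 1) dvd n) \<and>
           (\<forall>x\<in>carrier R. x \<noteq> \<zero> \<longrightarrow> (\<exists>k::nat. x = g [^] k))"
proof -
  interpret M: group "mult_of R" by (rule field_mult_group)
  obtain g where g: "g \<in> carrier (mult_of R)" "carrier (mult_of R) = {g [^] i | i::nat. i \<in> UNIV}"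
    using finite_field_mult_group_has_gen[OF fin] by blast
  have finM: "finite (carrier (mult_of R))" using fin by simp
  have pow: "g [^]\<^bsub>mult_of R\<^esub> (n::nat) = g [^] n" for n
    by (simp add: nat_pow_mult_of)
  have "M.ord g \<noteq> 0" using M.ord_ge_1[OF finM g(1)] by simp
  then have "generate (mult_of R) {g} = carrier (mult_of R)"
    using M.generate_pow_nat[OF g(1)] g(2) by (simp add: pow)
  then have "M.ord g = card (carrier R) - 1"
    using M.generate_pow_card[OF g(1)] fin by simp
  then show ?thesis
    using M.pow_eq_id[OF g(1)] g pow by (intro bexI[of _ g]) auto
qed

definition Mat :: "'f::field \<Rightarrow> 'f \<Rightarrow> 'f \<Rightarrow> 'f \<Rightarrow> 'f ^ 2 ^ 2" where
  "Mat a b c d = (\<chi> i j. if i = 1 then (if j = 1 then a else b) else (if j = 1 then c else d))"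

lemma Mat_nth [simp]:
  "Mat a b c d $ 1 $ 1 = a" "Mat a b c d $ 1 $ 2 = b" "Mat a b c d $ 2 $ 1 = c" "Mat a b c d $ 2 $ 2 = d"
  by (simp_all add: Mat_def)

lemma Mat_eq_iff [simp]: "Mat a b c d = Mat a' b' c' d' \<longleftrightarrow> a = a' \<and> b = b' \<and> c = c' \<and> d = d'"
  by (simp add: vec_eq_iff forall_2)

lemma Mat_exhaust:
  obtains a b c d where "A = Mat a b c d"
  by (rule that[of "A $ 1 $ 1" "A $ 1 $ 2" "A $ 2 $ 1" "A $ 2 $ 2"]) (simp add: vec_eq_iff forall_2)

lemma Mat_mult [simp]:
  "Mat a b c d ** Mat a' b' c' d' =
    Mat (a * a' + b * c') (a * b' + b * d') (c * a' + d * c') (c * b' + d * d')"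
  by (simp add: vec_eq_iff forall_2 matrix_matrix_mult_def sum_2)

lemma det_Mat [simp]: "det (Mat a b c d) = a * d - b * c"
  by (simp add: det_2)

lemma mat_eq_Mat: "mat k = Mat k 0 0 k"
  by (simp add: vec_eq_iff forall_2 mat_def)

lemma uminus_Mat [simp]: "- Mat a b c d = Mat (- a) (- b) (- c) (- d)"
  by (simp add: vec_eq_iff forall_2)

lemma add_Mat [simp]: "Mat a b c d + Mat a' b' c' d' = Mat (a + a') (b + b') (c + c') (d + d')"
  by (simp add: vec_eq_iff forall_2)

lemma det_uminus_2 [simp]: "det (- A :: 'f::field ^ 2 ^ 2) = det A"
  by (cases A rule: Mat_exhaust) simp

lemma uminus_matrix_mult [simp]:
  fixes A B :: "'f::field ^ 2 ^ 2"
  shows "(- A) ** B = - (A ** B)" "A ** (- B) = - (A ** B)"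
  by (cases A rule: Mat_exhaust; cases B rule: Mat_exhaust; simp)+

primrec mpow :: "'f::field ^ 2 ^ 2 \<Rightarrow> nat \<Rightarrow> 'f ^ 2 ^ 2" where
  "mpow A 0 = mat 1"
| "mpow A (Suc n) = mpow A n ** A"

lemma mpow_add: "mpow A (m + n) = mpow A m ** mpow A n"
  by (induction n) (simp_all add: matrix_mul_assoc)

lemma mpow_mult: "mpow A (m * n) = mpow (mpow A m) n"
proof (induction n)
  case (Suc n)
  have "mpow A (m * Suc n) = mpow A (m * n + m)" by (simp add: add.commute)
  then show ?case using Suc by (simp only: mpow_add mpow.simps)
qed simp

lemma det_mpow: "det (mpow A n) = det A ^ n"
  by (induction n) (simp_all add: det_mul mult.commute)

text \<open>The image of a matrix in the projective group: its coset modulo the scalar matrices \<open>1\<close> and \<open>-1\<close>.\<close>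

definition pr :: "'f::field ^ 2 ^ 2 \<Rightarrow> ('f ^ 2 ^ 2) set" where "pr A = {A, - A}"

lemma pr_eq_iff: "pr A = pr B \<longleftrightarrow> A = B \<or> A = - B"
  by (auto simp: pr_def doubleton_eq_iff)

lemma pr_uminus [simp]: "pr (- A) = pr A" by (auto simp: pr_def)

lemma group_SL: "group (SL :: ('f::field ^ 2 ^ 2) monoid)"
proof (rule groupI)
  fix A :: "'f ^ 2 ^ 2" assume A: "A \<in> carrier SL"
  obtain a b c d where M: "A = Mat a b c d" by (rule Mat_exhaust)
  show "\<exists>B\<in>carrier SL. B \<otimes>\<^bsub>SL\<^esub> A = \<one>\<^bsub>SL\<^esub>"
    using A by (intro bexI[of _ "Mat d (- b) (- c) a"])
       (auto simp: SL_def M mat_eq_Mat algebra_simps)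
qed (auto simp: SL_def det_mul matrix_mul_assoc)

lemma scalars_SL: "{A \<in> carrier SL. \<exists>c. A = mat c} = pr (mat 1 :: 'f::field ^ 2 ^ 2)"
proof -
  have "c * c = 1 \<longleftrightarrow> c = 1 \<or> c = - 1" for c :: 'f by (rule square_eq_1_iff)
  then show ?thesis
    by (auto simp: SL_def pr_def mat_eq_Mat)
qed

lemma SL_simps [simp]:
  "carrier SL = {A. det A = 1}" "A \<otimes>\<^bsub>SL\<^esub> B = A ** B" "\<one>\<^bsub>SL\<^esub> = mat 1"
  by (simp_all add: SL_def)

lemma normal_scalars_SL: "pr (mat 1 :: 'f::field ^ 2 ^ 2) \<lhd> SL"
proof -
  let ?Z = "pr (mat 1 :: 'f ^ 2 ^ 2)"
  interpret SL: group "SL :: ('f ^ 2 ^ 2) monoid" by (rule group_SL)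
  have det1: "det (mat 1 :: 'f ^ 2 ^ 2) = 1" by (simp add: mat_eq_Mat)
  have inv: "inv\<^bsub>SL\<^esub> A = A" if "A \<in> ?Z" for A
    using that det1 by (intro SL.inv_equality) (auto simp: pr_def)
  have sub: "subgroup ?Z SL"
  proof (rule SL.subgroupI)
    show "?Z \<noteq> {}" by (simp add: pr_def)
    show "inv\<^bsub>SL\<^esub> A \<in> ?Z" if "A \<in> ?Z" for A
      using that by (simp add: inv)
  qed (use det1 in \<open>auto simp: pr_def\<close>)
  moreover have "A \<otimes>\<^bsub>SL\<^esub> B \<otimes>\<^bsub>SL\<^esub> inv\<^bsub>SL\<^esub> A \<in> ?Z" if "A \<in> carrier SL" "B \<in> ?Z" for A B
  proof -
    have "A ** inv\<^bsub>SL\<^esub> A = mat 1" using SL.r_inv[OF that(1)] by simp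
    then show ?thesis using that(2) by (auto simp: pr_def)
  qed
  ultimately show ?thesis
    unfolding SL.normal_inv_iff by blast
qed

locale psl2 =
  fixes p :: nat and G :: "('f::{field,finite} ^ 2 ^ 2) set monoid" (structure)
  assumes prime_p: "prime p" and p_gt_3: "p > 3" and card_field: "CARD('f) = p" and G_eq: "G = PSL"
begin

lemma G_Mod: "G = SL Mod pr (mat 1)"
  unfolding G_eq PSL_def scalars_SL ..

sublocale group G
  unfolding G_Mod by (rule normal.factorgroup_is_group[OF normal_scalars_SL])

lemma r_coset_scalars: "pr (mat 1) #>\<^bsub>SL\<^esub> A = pr A"
  by (auto simp: r_coset_def pr_def)

lemma carrier_G: "carrier G = pr ` {A. det A = 1}"
  unfolding G_Mod by (auto simp: FactGroup_def RCOSETS_def r_coset_scalars)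

lemma pr_closed [simp]: "det A = 1 \<Longrightarrow> pr A \<in> carrier G"
  by (simp add: carrier_G)

lemma pr_mult [simp]:
  assumes "det A = 1" "det B = 1"
  shows "pr A \<otimes> pr B = pr (A ** B)"
  using normal.rcos_sum[OF normal_scalars_SL, of A B] assms
  by (simp add: G_Mod r_coset_scalars)

lemma one_G: "\<one> = pr (mat 1)" by (simp add: G_Mod)

lemma carrierE:
  assumes "g \<in> carrier G"
  obtains a b c d where "g = pr (Mat a b c d)" "a * d - b * c = 1"
proof -
  obtain A where A: "g = pr A" "det A = 1" using assms by (auto simp: carrier_G)
  obtain a b c d where "A = Mat a b c d" by (rule Mat_exhaust)
  then show ?thesis using that A by simp
qed

lemma pr_mpow: "det A = 1 \<Longrightarrow> pr A [^] n = pr (mpow A n)"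
  by (induction n) (simp_all add: one_G det_mpow)

lemma finite_G: "finite (carrier G)" by simp

lemma cnj_pr_iff:
  assumes "det A = 1" "det B = 1" "det C = 1"
  shows "cnj (pr A) (pr B) = pr C \<longleftrightarrow> A ** B = C ** A \<or> A ** B = - (C ** A)"
  using assms by (simp add: cnj_eq_iff pr_eq_iff det_mul)

lemma odd_p: "odd p"
  using prime_p p_gt_3 primes_dvd_imp_eq[of 2 p] two_is_prime_nat by force

lemma of_nat_p: "of_nat p = (0 :: 'f)"
  using CHAR_dvd_CARD[where 'a = 'f] by (simp add: card_field of_nat_eq_0_iff_char_dvd)

lemma two_neq_zero [simp]: "(2 :: 'f) \<noteq> 0"
proof
  assume two: "(2 :: 'f) = 0"
  obtain k where "p = 2 * k + 1" using odd_p by (elim oddE)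
  then have "of_nat p = (2 :: 'f) * of_nat k + 1" by simp
  then show False using two of_nat_p by simp
qed

lemma minus_eq_self [simp]: "- x = x \<longleftrightarrow> x = (0 :: 'f)"
proof
  assume "- x = x"
  then have "2 * x = 0" by (metis add.right_inverse mult_2)
  then show "x = 0" by simp
qed simp

lemma self_eq_minus [simp]: "x = - x \<longleftrightarrow> x = (0 :: 'f)"
  using minus_eq_self by metis

text \<open>The field as a structure with explicit carrier, through which the cyclicity of its multiplicative group
  becomes available.\<close>

definition field_ring :: "'f ring" where
  "field_ring = \<lparr>carrier = UNIV, mult = (*), one = 1, zero = 0, add = (+)\<rparr>"

lemma field_field_ring: "field field_ring"
proof -
  have "cring field_ring"
  proof (rule cringI)
    show "abelian_group field_ring"
      by (rule abelian_groupI) (auto simp: field_ring_def add.assoc add.commute intro!: exI[of _ "- _"])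
    show "comm_monoid field_ring"
      by (rule comm_monoidI) (auto simp: field_ring_def mult.assoc mult.commute)
  qed (auto simp: field_ring_def algebra_simps)
  then show ?thesis
  proof (rule cring.cring_fieldI2)
    show "\<exists>b\<in>carrier field_ring. a \<otimes>\<^bsub>field_ring\<^esub> b = \<one>\<^bsub>field_ring\<^esub>"
      if "a \<noteq> \<zero>\<^bsub>field_ring\<^esub>" for a
      using that by (auto simp: field_ring_def intro!: exI[of _ "inverse a"])
  qed (auto simp: field_ring_def)
qed

lemma primitive_root:
  "\<exists>g :: 'f. g \<noteq> 0 \<and> (\<forall>n. g ^ n = 1 \<longleftrightarrow> (p - 1) dvd n) \<and> (\<forall>x. x \<noteq> 0 \<longrightarrow> (\<exists>k::nat. x = g ^ k))"
proof -
  have pow: "x [^]\<^bsub>field_ring\<^esub> n = x ^ n" for x :: 'f and n :: nat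
    by (induction n) (simp_all add: field_ring_def nat_pow_def)
  show ?thesis
    using field.finite_mult_group_generator[OF field_field_ring]
    by (simp add: pow) (simp add: field_ring_def card_field)
qed

lemma fermat: "x \<noteq> 0 \<Longrightarrow> x ^ (p - 1) = (1 :: 'f)"
  using primitive_root by (metis dvd_triv_left dvd_refl power_mult mult.commute power_one)

text \<open>Squaring is at most two-to-one, and one-to-one over zero.\<close>

lemma card_squares: "p < 2 * card (range (\<lambda>x :: 'f. x ^ 2))"
proof -
  let ?S = "range (\<lambda>x :: 'f. x ^ 2)"
  have fib: "card {x :: 'f. x ^ 2 = s} \<le> 2" for s
  proof (cases "\<exists>t. s = t ^ 2")
    case True
    then obtain t where "s = t ^ 2" by blast
    then have "{x. x ^ 2 = s} \<subseteq> {t, - t}" by (auto simp: power2_eq_iff)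
    then have "card {x. x ^ 2 = s} \<le> card {t, - t}" by (intro card_mono) auto
    also have "\<dots> \<le> 2" by (simp add: card_insert_if)
    finally show ?thesis .
  next
    case False
    then have "{x. x ^ 2 = s} = {}" by auto
    then show ?thesis by simp
  qed
  have "UNIV = {0 :: 'f} \<union> (\<Union>s\<in>?S - {0}. {x. x ^ 2 = s})" by auto
  then have "p = card ({0 :: 'f} \<union> (\<Union>s\<in>?S - {0}. {x. x ^ 2 = s}))"
    using card_field by metis
  also have "\<dots> \<le> 1 + card (\<Union>s\<in>?S - {0}. {x. x ^ 2 = s})"
    using card_Un_le[of "{0 :: 'f}"] by simp
  also have "\<dots> \<le> 1 + (\<Sum>s\<in>?S - {0}. card {x. x ^ 2 = s})"
    by (intro add_left_mono card_UN_le) simp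
  also have "\<dots> \<le> 1 + (\<Sum>s\<in>?S - {0}. 2)"
    by (intro add_left_mono sum_mono fib)
  also have "\<dots> = 1 + 2 * (card ?S - 1)"
    by (simp add: card_Diff_singleton_if image_iff)
  also have "\<dots> < 2 * card ?S"
  proof -
    have "card ?S > 0" by (simp add: card_gt_0_iff)
    then show ?thesis by linarith
  qed
  finally show ?thesis .
qed

text \<open>The values \<open>u\<^sup>2\<close> and the values \<open>c - d v\<^sup>2\<close> both fill more than half of the field, so they meet.\<close>

lemma conic:
  assumes "d \<noteq> (0 :: 'f)"
  shows "\<exists>u v. u ^ 2 + d * v ^ 2 = c"
proof -
  let ?S = "range (\<lambda>x :: 'f. x ^ 2)"
  let ?T = "(\<lambda>s. c - d * s) ` ?S"
  have "card ?T = card ?S"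
    using assms by (intro card_image) (auto intro!: inj_onI)
  then have "card (UNIV :: 'f set) < card ?S + card ?T"
    using card_squares card_field by simp
  moreover have "card ?S + card ?T = card (?S \<union> ?T) + card (?S \<inter> ?T)"
    by (rule card_Un_Int) auto
  moreover have "card (?S \<union> ?T) \<le> card (UNIV :: 'f set)" by (intro card_mono) auto
  ultimately have "card (?S \<inter> ?T) > 0" by linarith
  then have "?S \<inter> ?T \<noteq> {}" by (metis card.empty less_irrefl)
  then obtain u v where "u ^ 2 = c - d * v ^ 2" by blast
  then show ?thesis by (intro exI[of _ u] exI[of _ v]) (simp add: algebra_simps)
qed

text \<open>Squaring is not injective, since \<open>1 \<noteq> -1\<close>; on a finite set it is then not surjective either.\<close>

lemma nonsquare_exists: "\<exists>e :: 'f. \<forall>x. x ^ 2 \<noteq> e"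
proof (rule ccontr)
  assume "\<not> ?thesis"
  then have "surj (\<lambda>x :: 'f. x ^ 2)" unfolding surj_def by metis
  then have "inj (\<lambda>x :: 'f. x ^ 2)" by (rule finite_UNIV_surj_inj[rotated]) simp
  then have "(1 :: 'f) = - 1" by (rule injD) simp
  then show False by simp
qed

lemma pr_Mat_pow_unipotent: "pr (Mat 1 y 0 1) [^] (n::nat) = pr (Mat 1 (of_nat n * y) 0 1)"
  by (induction n) (simp_all add: one_G mat_eq_Mat algebra_simps)

sublocale group_with_prime G p
proof
  show "\<exists>u\<in>carrier G. u \<noteq> \<one> \<and> u [^] p = \<one>"
    by (intro bexI[of _ "pr (Mat 1 1 0 1)"])
       (simp_all add: pr_Mat_pow_unipotent of_nat_p one_G mat_eq_Mat pr_eq_iff)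
qed (use prime_p p_gt_3 finite_G in simp_all)

end

section \<open>The split torus and the Borel subgroup\<close>

context group
begin

lemma range_int_pow:
  assumes "a \<in> carrier G" "ord a > 0"
  shows "range (\<lambda>k::int. a [^] k) = range (\<lambda>k::nat. a [^] k)"
  using generate_pow[OF assms(1)] generate_pow_nat[OF assms(1)] assms(2) by (auto simp: full_SetCompr_eq)

lemma ord_eqI:
  assumes "x \<in> carrier G" "\<And>n::nat. x [^] n = \<one> \<longleftrightarrow> m dvd n"
  shows "ord x = m"
  using assms pow_eq_id[OF assms(1)] by (metis dvd_antisym dvd_refl)

end

context psl2
begin

text \<open>The orders of the images of the tori in the projective group; in the special linear group they are
  twice as large.\<close>

definition ord_split :: nat where "ord_split = (p - 1) div 2"
definition ord_nonsplit :: nat where "ord_nonsplit = (p + 1) div 2"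

lemma p_eq: "p = 2 * ord_split + 1" and ord_nonsplit_eq: "ord_nonsplit = ord_split + 1"
  using odd_p by (auto simp: ord_split_def ord_nonsplit_def elim!: oddE)

lemma ord_split_pos: "ord_split > 0" and ord_nonsplit_pos: "ord_nonsplit > 0"
  using p_eq ord_nonsplit_eq p_gt_3 by simp_all

lemma ord_split_coprime: "\<not> p dvd 2 * ord_split" and ord_nonsplit_coprime: "\<not> p dvd 2 * ord_nonsplit"
proof -
  have "2 * ord_split < p" using p_eq by simp
  then show "\<not> p dvd 2 * ord_split" using ord_split_pos by (auto dest: dvd_imp_le)
  have "2 * ord_nonsplit = p + 1" using p_eq ord_nonsplit_eq by simp
  then show "\<not> p dvd 2 * ord_nonsplit" using p_gt_3 by (simp only: dvd_add_right_iff[OF dvd_refl]) simp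
qed

lemma dvd_ord_split: "(p - 1) dvd n * 2 \<longleftrightarrow> ord_split dvd n"
proof -
  have "p - 1 = 2 * ord_split" using p_eq by simp
  then show ?thesis unfolding mult.commute[of n] by (simp only: nat_mult_dvd_cancel1[of 2] zero_less_numeral)
qed

lemma dvd_ord_nonsplit: "(p + 1) dvd n * 2 \<longleftrightarrow> ord_nonsplit dvd n"
proof -
  have "p + 1 = 2 * ord_nonsplit" using p_eq ord_nonsplit_eq by simp
  then show ?thesis unfolding mult.commute[of n] by (simp only: nat_mult_dvd_cancel1[of 2] zero_less_numeral)
qed

definition diag :: "'f \<Rightarrow> 'f ^ 2 ^ 2" where "diag s = Mat s 0 0 (inverse s)"

lemma det_diag [simp]: "s \<noteq> 0 \<Longrightarrow> det (diag s) = 1" by (simp add: diag_def)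

lemma diag_mult: "diag s ** diag s' = diag (s * s')"
  by (simp add: diag_def)

lemma pr_diag_pow: "s \<noteq> 0 \<Longrightarrow> pr (diag s) [^] (n::nat) = pr (diag (s ^ n))"
  by (induction n) (simp_all add: one_G mat_eq_Mat diag_mult, simp_all add: diag_def mult.commute)

lemma pr_diag_eq_one: "s \<noteq> 0 \<Longrightarrow> pr (diag s) = \<one> \<longleftrightarrow> s ^ 2 = 1"
  unfolding one_G pr_eq_iff mat_eq_Mat diag_def
  by (auto simp: power2_eq_1_iff)

lemma split_torus_exists:
  "\<exists>g. g \<noteq> 0 \<and> group.ord G (pr (diag g)) = ord_split \<and>
     range (\<lambda>k::int. pr (diag g) [^] k) = pr ` diag ` {s. s \<noteq> 0}"
proof -
  obtain g :: 'f where g: "g \<noteq> 0" "\<And>n. g ^ n = 1 \<longleftrightarrow> (p - 1) dvd n"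
    and powers: "\<And>x. x \<noteq> 0 \<Longrightarrow> \<exists>k::nat. x = g ^ k"
    using primitive_root by auto
  have ord: "ord (pr (diag g)) = ord_split"
  proof (rule ord_eqI)
    fix n :: nat
    have "pr (diag g) [^] n = \<one> \<longleftrightarrow> g ^ (n * 2) = 1"
      using g by (simp add: pr_diag_pow pr_diag_eq_one power_mult)
    also have "\<dots> \<longleftrightarrow> ord_split dvd n"
      unfolding g(2) by (rule dvd_ord_split)
    finally show "pr (diag g) [^] n = \<one> \<longleftrightarrow> ord_split dvd n" .
  qed (use g in simp)
  have "range (\<lambda>k::int. pr (diag g) [^] k) = range (\<lambda>k::nat. pr (diag g) [^] k)"
    using ord ord_split_pos g by (intro range_int_pow) auto
  also have "\<dots> = (\<lambda>k. pr (diag (g ^ k))) ` UNIV"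
    using g by (simp add: pr_diag_pow)
  also have "\<dots> = pr ` diag ` range (\<lambda>k::nat. g ^ k)" by (simp add: image_image)
  also have "range (\<lambda>k::nat. g ^ k) = {s. s \<noteq> 0}" using powers g(1) by auto
  finally show ?thesis using g(1) ord by blast
qed

definition split_gen :: 'f where
  "split_gen = (SOME g. g \<noteq> 0 \<and> ord (pr (diag g)) = ord_split \<and>
     range (\<lambda>k::int. pr (diag g) [^] k) = pr ` diag ` {s. s \<noteq> 0})"

abbreviation split_T :: "('f ^ 2 ^ 2) set set" where "split_T \<equiv> range (\<lambda>k::int. pr (diag split_gen) [^] k)"

lemma split_gen: "split_gen \<noteq> 0" "ord (pr (diag split_gen)) = ord_split"
  "split_T = pr ` diag ` {s. s \<noteq> 0}"
  using someI_ex[OF split_torus_exists] unfolding split_gen_def[symmetric] by blast+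

text \<open>The matrix that exchanges the two coordinate lines; it inverts the diagonal matrices.\<close>

definition split_weyl :: "'f ^ 2 ^ 2" where "split_weyl = Mat 0 1 (- 1) 0"

lemma det_split_weyl [simp]: "det split_weyl = 1" by (simp add: split_weyl_def)

lemma antidiag_in_coset: "b \<noteq> 0 \<Longrightarrow> b * c = - 1 \<Longrightarrow>
  pr (Mat 0 b c 0) \<in> range (\<lambda>k::int. pr (diag split_gen) [^] k \<otimes> pr split_weyl)"
proof -
  assume b: "b \<noteq> 0" "b * c = - 1"
  then have "pr (diag b) \<in> split_T" unfolding split_gen(3) by blast
  then obtain k :: int where k: "pr (diag b) = pr (diag split_gen) [^] k" by blast
  have "c = - inverse b" using b by (simp add: field_simps)
  then have "pr (Mat 0 b c 0) = pr (diag b) \<otimes> pr split_weyl"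
    using b by (simp add: diag_def split_weyl_def)
  then show ?thesis using k by auto
qed

text \<open>A matrix that carries one diagonal matrix with two distinct eigenvalues to another one permutes the coordinate
  lines, so it is diagonal or antidiagonal.\<close>

sublocale split: torus G p "pr (diag split_gen)" "pr split_weyl" ord_split
proof
  show "pr (diag split_gen) \<in> carrier G" "pr split_weyl \<in> carrier G" using split_gen by simp_all
  show "ord (pr (diag split_gen)) = ord_split" by (rule split_gen)
  show "ord_split > 0" by (rule ord_split_pos)
  show "\<not> p dvd 2 * ord_split" by (rule ord_split_coprime)
  show "pr split_weyl \<otimes> pr split_weyl = \<one>" by (simp add: split_weyl_def one_G mat_eq_Mat pr_eq_iff)
  have "pr split_weyl \<otimes> pr (diag split_gen) \<otimes> pr split_weyl = pr (diag (inverse split_gen))"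
    using split_gen(1) by (simp add: split_weyl_def diag_def pr_eq_iff)
  moreover have "pr (diag (inverse split_gen)) \<otimes> pr (diag split_gen) = \<one>"
    using split_gen(1) by (simp add: diag_mult) (simp add: diag_def one_G mat_eq_Mat)
  then have "inv (pr (diag split_gen)) = pr (diag (inverse split_gen))"
    using split_gen(1) by (intro inv_equality) auto
  ultimately show "pr split_weyl \<otimes> pr (diag split_gen) \<otimes> pr split_weyl = inv (pr (diag split_gen))" by simp
  show "pr split_weyl \<notin> split_T"
    unfolding split_gen(3) by (auto simp: pr_eq_iff split_weyl_def diag_def)
  fix g and i :: int
  assume g: "g \<in> carrier G" and i: "pr (diag split_gen) [^] i \<noteq> \<one>"
    and cn: "cnj g (pr (diag split_gen) [^] i) \<in> split_T"
  have "pr (diag split_gen) [^] i \<in> split_T" by blast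
  then obtain s where s: "s \<noteq> 0" "pr (diag split_gen) [^] i = pr (diag s)"
    unfolding split_gen(3) by blast
  obtain s' where s': "s' \<noteq> 0" "cnj g (pr (diag s)) = pr (diag s')"
    using cn unfolding split_gen(3) s(2) by blast
  have ssq: "s ^ 2 \<noteq> 1" using i s by (simp add: pr_diag_eq_one)
  obtain a b c d where A: "g = pr (Mat a b c d)" "a * d - b * c = 1"
    using g by (rule carrierE)
  have "Mat a b c d ** diag s = diag s' ** Mat a b c d \<or>
      Mat a b c d ** diag s = - (diag s' ** Mat a b c d)"
    using s' s A by (simp add: cnj_pr_iff)
  \<comment> \<open>The sign from the projective relation is absorbed into the diagonal matrix.\<close>
  moreover have "- (diag s' ** Mat a b c d) = diag (- s') ** Mat a b c d"
    by (simp add: diag_def)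
  ultimately obtain r where r: "r \<noteq> 0" "Mat a b c d ** diag s = diag r ** Mat a b c d"
    using s' by (metis neg_equal_0_iff_equal)
  have eqs: "a * s = r * a" "b = r * b * s" "c * s * r = c" "d * r = d * s"
    using r s(1) by (auto simp: diag_def field_simps)
  show "g \<in> split_T \<union> range (\<lambda>k::int. pr (diag split_gen) [^] k \<otimes> pr split_weyl)"
  proof (cases "a = 0")
    case False
    then have "r = s" using eqs by simp
    then have "b * (s ^ 2 - 1) = 0" "c * (s ^ 2 - 1) = 0"
      using eqs(2,3) by (simp_all add: algebra_simps power2_eq_square)
    then have "b = 0" "c = 0" using ssq by auto
    then have "d = inverse a" using A False by (simp add: field_simps)
    then have "g = pr (diag a)" using A \<open>b = 0\<close> \<open>c = 0\<close> by (simp add: diag_def)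
    then show ?thesis unfolding split_gen(3) using False by blast
  next
    case True
    then have bc: "b * c = - 1" using A by (simp add: minus_equation_iff)
    then have "b \<noteq> 0" by auto
    then have "r * s = 1" using eqs by simp
    have "d = 0"
    proof (rule ccontr)
      assume "d \<noteq> 0"
      then have "r = s" using eqs by simp
      then show False using \<open>r * s = 1\<close> ssq by (simp add: power2_eq_square)
    qed
    then show ?thesis using antidiag_in_coset[OF \<open>b \<noteq> 0\<close> bc] A True by simp
  qed
qed

definition unip :: "('f ^ 2 ^ 2) set" where "unip = range (\<lambda>y. Mat 1 y 0 1)"

text \<open>A matrix that carries a nontrivial unipotent upper triangular matrix to another one fixes their common
  eigenline, so it is upper triangular.\<close>

sublocale borel G p "pr ` unip" "pr (diag split_gen)" ord_split
proof (rule borel.intro[OF group_with_prime_axioms], rule borel_axioms.intro)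
  let ?U = "pr ` unip" and ?h = "pr (diag split_gen)"
  have sub: "?U \<subseteq> carrier G" by (auto simp: unip_def)
  show "subgroup ?U G"
  proof (rule subgroupI)
    show "?U \<noteq> {}" by (auto simp: unip_def)
    fix x assume "x \<in> ?U"
    then obtain y where y: "x = pr (Mat 1 y 0 1)" by (auto simp: unip_def)
    have "inv x = pr (Mat 1 (- y) 0 1)"
      by (rule inv_equality) (simp_all add: y one_G mat_eq_Mat)
    then show "inv x \<in> ?U" by (auto simp: unip_def)
    fix x' assume "x' \<in> ?U"
    then obtain y' where "x' = pr (Mat 1 y' 0 1)" by (auto simp: unip_def)
    then show "x \<otimes> x' \<in> ?U" using y by (auto simp: unip_def)
  qed (rule sub)
  have "inj_on pr unip" by (auto simp: inj_on_def unip_def pr_eq_iff)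
  then have "card ?U = card unip" by (rule card_image)
  also have "\<dots> = p" unfolding unip_def card_field[symmetric] by (rule card_image) (simp add: inj_on_def)
  finally show "card ?U = p" .
  show "?h \<in> carrier G" "ord ?h = ord_split" "ord_split > 0" using split_gen ord_split_pos by simp_all
  show "\<not> p dvd ord_split" using ord_split_coprime by (metis dvd_mult)
  show "cnj ?h x \<in> ?U" if x: "x \<in> ?U" for x
  proof -
    obtain y where y: "x = pr (Mat 1 y 0 1)" using x by (auto simp: unip_def)
    have "cnj ?h x = pr (Mat 1 (split_gen ^ 2 * y) 0 1)"
      using split_gen(1) unfolding y by (subst cnj_pr_iff) (simp_all add: diag_def field_simps power2_eq_square)
    then show ?thesis by (auto simp: unip_def)
  qed
  show "\<exists>y\<in>?U. \<exists>i::int. g = y \<otimes> ?h [^] i"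
    if g: "g \<in> carrier G" and x: "x \<in> ?U" "x \<noteq> \<one>" and cn: "cnj g x \<in> ?U" for g x
  proof -
    obtain y where y: "x = pr (Mat 1 y 0 1)" using x by (auto simp: unip_def)
    then have "y \<noteq> 0" using x by (auto simp: one_G mat_eq_Mat)
    obtain y' where y': "cnj g x = pr (Mat 1 y' 0 1)" using cn by (auto simp: unip_def)
    obtain a b c d where A: "g = pr (Mat a b c d)" "a * d - b * c = 1"
      using g by (rule carrierE)
    have "Mat a b c d ** Mat 1 y 0 1 = Mat 1 y' 0 1 ** Mat a b c d \<or>
        Mat a b c d ** Mat 1 y 0 1 = - (Mat 1 y' 0 1 ** Mat a b c d)"
      using y' A(2) unfolding y A(1) by (subst (asm) cnj_pr_iff) auto
    then have "c = 0" using \<open>y \<noteq> 0\<close> by auto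
    then have "a \<noteq> 0" using A by auto
    then have d: "d = inverse a" "a \<noteq> 0" using A \<open>c = 0\<close> by (simp_all add: field_simps)
    then have "pr (diag a) \<in> range (\<lambda>k::int. ?h [^] k)" unfolding split_gen(3) by blast
    then obtain i :: int where i: "pr (diag a) = ?h [^] i" by blast
    have "Mat 1 (a * b) 0 1 ** diag a = Mat a b c d"
      using d(2) by (simp add: diag_def d(1) \<open>c = 0\<close>)
    then have "g = pr (Mat 1 (a * b) 0 1) \<otimes> pr (diag a)"
      using d(2) A(1) by simp
    then show ?thesis unfolding i by (auto simp: unip_def)
  qed
  show "\<exists>g\<in>carrier G. \<forall>y\<in>?U. \<forall>i::int. g \<noteq> y \<otimes> ?h [^] i"
  proof (intro bexI[of _ "pr split_weyl"] ballI allI)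
    fix x and i :: int assume "x \<in> ?U"
    then obtain y where y: "x = pr (Mat 1 y 0 1)" by (auto simp: unip_def)
    have "?h [^] i \<in> range (\<lambda>k::int. ?h [^] k)" by blast
    then obtain s where s: "s \<noteq> 0" "?h [^] i = pr (diag s)" unfolding split_gen(3) by blast
    show "pr split_weyl \<noteq> x \<otimes> ?h [^] i"
      unfolding s y using s(1) by (simp add: diag_def split_weyl_def pr_eq_iff)
  qed simp
qed

end

section \<open>The nonsplit torus\<close>

locale psl2_nonsplit = psl2 p G for p and G :: "('f::{field,finite} ^ 2 ^ 2) set monoid" (structure) +
  fixes e :: 'f
  assumes nonsquare: "x ^ 2 \<noteq> e"
begin

text \<open>The matrix of multiplication by \<open>x + y \<surd>e\<close> on the quadratic extension with basis \<open>1, \<surd>e\<close>; its determinant is the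
  norm.\<close>

definition quad :: "'f \<Rightarrow> 'f \<Rightarrow> 'f ^ 2 ^ 2" where "quad x y = Mat x (e * y) y x"

lemma quad_mult [simp]: "quad x y ** quad x' y' = quad (x * x' + e * y * y') (x * y' + y * x')"
  by (simp add: quad_def algebra_simps)

lemma det_quad [simp]: "det (quad x y) = x ^ 2 - e * y ^ 2"
  by (simp add: quad_def power2_eq_square algebra_simps)

lemma quad_eq_iff [simp]: "quad x y = quad x' y' \<longleftrightarrow> x = x' \<and> y = y'"
  by (auto simp: quad_def)

lemma mat_1_quad: "mat 1 = quad 1 0" and uminus_quad [simp]: "- quad x y = quad (- x) (- y)"
  and add_quad [simp]: "quad x y + quad x' y' = quad (x + x') (y + y')"
  by (simp_all add: quad_def mat_eq_Mat algebra_simps)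

lemma quad_zero: "quad 0 0 = 0"
  by (simp add: quad_def vec_eq_iff forall_2)

abbreviation norm_one :: "('f ^ 2 ^ 2) set" where "norm_one \<equiv> {quad x y | x y. x ^ 2 - e * y ^ 2 = 1}"

lemma norm_eq_0: "x ^ 2 - e * y ^ 2 = 0 \<longleftrightarrow> x = 0 \<and> y = 0"
proof
  assume eq: "x ^ 2 - e * y ^ 2 = 0"
  have "y = 0"
  proof (rule ccontr)
    assume "y \<noteq> 0"
    then have "(x / y) ^ 2 = e" using eq by (simp add: field_simps)
    then show False using nonsquare by blast
  qed
  then show "x = 0 \<and> y = 0" using eq by simp
qed simp

definition quad_ring :: "('f ^ 2 ^ 2) ring" where
  "quad_ring = \<lparr>carrier = {A. \<exists>x y. A = quad x y}, mult = (**), one = quad 1 0, zero = quad 0 0, add = (+)\<rparr>"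

lemma field_quad_ring: "field quad_ring"
proof -
  have "cring quad_ring"
  proof (rule cringI)
    show "abelian_group quad_ring"
    proof (rule abelian_groupI)
      show "\<exists>B\<in>carrier quad_ring. B \<oplus>\<^bsub>quad_ring\<^esub> A = \<zero>\<^bsub>quad_ring\<^esub>" if "A \<in> carrier quad_ring" for A
      proof -
        obtain x y where "A = quad x y" using \<open>A \<in> carrier quad_ring\<close> by (auto simp: quad_ring_def)
        then show ?thesis by (intro bexI[of _ "quad (- x) (- y)"]) (auto simp: quad_ring_def)
      qed
    qed (auto simp: quad_ring_def quad_zero add.assoc add.commute intro: quad_zero)
    show "comm_monoid quad_ring"
      by (rule comm_monoidI) (auto simp: quad_ring_def algebra_simps)
  qed (auto simp: quad_ring_def algebra_simps)
  then show ?thesis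
  proof (rule cring.cring_fieldI2)
    fix A assume A: "A \<in> carrier quad_ring" "A \<noteq> \<zero>\<^bsub>quad_ring\<^esub>"
    then obtain x y where xy: "A = quad x y" by (auto simp: quad_ring_def)
    let ?n = "x ^ 2 - e * y ^ 2"
    have n: "?n \<noteq> 0" using A norm_eq_0[of x y] by (auto simp: xy quad_ring_def)
    define i where "i = inverse ?n"
    have "x * (x * i) + e * y * (- y * i) = ?n * i"
      by (simp add: power2_eq_square algebra_simps)
    also have "\<dots> = 1" using n by (simp add: i_def)
    finally show "\<exists>B\<in>carrier quad_ring. A \<otimes>\<^bsub>quad_ring\<^esub> B = \<one>\<^bsub>quad_ring\<^esub>"
      by (intro bexI[of _ "quad (x * i) (- y * i)"]) (auto simp: xy quad_ring_def)
  qed (simp add: quad_ring_def)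
qed

lemma quad_ring_pow: "A [^]\<^bsub>quad_ring\<^esub> (n::nat) = mpow A n"
  by (induction n) (simp_all add: quad_ring_def nat_pow_def mat_1_quad)

lemma mpow_quad: "\<exists>x' y'. mpow (quad x y) n = quad x' y'"
  by (induction n) (auto simp: mat_1_quad)

lemma pr_quad_eq_one: "pr (quad x y) = \<one> \<longleftrightarrow> quad x y ** quad x y = quad 1 0"
proof -
  have "x * x + e * y * y = 1 \<and> x * y + y * x = 0 \<longleftrightarrow> y = 0 \<and> (x = 1 \<or> x = - 1)"
  proof safe
    assume a: "x * x + e * y * y = 1" "x * y + y * x = 0"
    then have "2 * (x * y) = 0" by (simp add: mult.commute)
    then have xy: "x = 0 \<or> y = 0" by simp
    show y: "y = 0"
    proof (rule ccontr)
      assume "y \<noteq> 0"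
      then have "e * y * y = 1" using a xy by simp
      then have "(1 / y) ^ 2 = e" using \<open>y \<noteq> 0\<close> by (simp add: field_simps power2_eq_square)
      then show False using nonsquare by blast
    qed
    assume "x \<noteq> - 1"
    then show "x = 1" using a y square_eq_1_iff[of x] by simp
  qed auto
  then show ?thesis
    by (auto simp: one_G mat_1_quad pr_eq_iff)
qed

text \<open>The norm-one conic has at most \<open>p + 1\<close> points: a point other than \<open>(-1, 0)\<close> is determined by the slope \<open>s\<close> of its line
  through \<open>(-1, 0)\<close>.\<close>

lemma card_norm_one: "card {(x, y). x ^ 2 - e * y ^ 2 = 1} \<le> p + 1"
proof -
  let ?N = "{(x, y). x ^ 2 - e * y ^ 2 = 1}" and ?f = "\<lambda>(x, y). y / (x + 1)"
  have x1: "y = 0" if "x ^ 2 - e * y ^ 2 = 1" "x = - 1" for x y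
    using that nonsquare[of 0] by auto
  have "inj_on ?f (?N - {(- 1, 0)})"
  proof (rule inj_onI)
    fix q q' assume q: "q \<in> ?N - {(- 1, 0)}" "q' \<in> ?N - {(- 1, 0)}" and f: "?f q = ?f q'"
    obtain x y x' y' where xy: "q = (x, y)" "q' = (x', y')" by (cases q, cases q')
    have n: "x ^ 2 - e * y ^ 2 = 1" "x' ^ 2 - e * y' ^ 2 = 1"
      and ne: "\<not> (x = - 1 \<and> y = 0)" "\<not> (x' = - 1 \<and> y' = 0)"
      and eq: "y / (x + 1) = y' / (x' + 1)"
      using q f xy by auto
    define s where "s = y / (x + 1)"
    have nz: "x + 1 \<noteq> 0" "x' + 1 \<noteq> 0"
      using x1 n ne by (metis add_eq_0_iff2 minus_minus)+
    have y: "y = s * (x + 1)" "y' = s * (x' + 1)" using nz by (simp add: s_def, simp add: s_def eq)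
    have "1 - e * s ^ 2 \<noteq> 0" using norm_eq_0[of 1 s] by simp
    \<comment> \<open>Substituting the line into the equation of the conic and cancelling \<open>z + 1\<close> leaves a linear equation.\<close>
    have *: "(1 - e * s ^ 2) * (z + 1) = 2" if "z ^ 2 - e * (s * (z + 1)) ^ 2 = 1" "z + 1 \<noteq> 0" for z
    proof -
      have "(z + 1) * ((1 - e * s ^ 2) * (z + 1) - 2) = z ^ 2 - e * (s * (z + 1)) ^ 2 - 1"
        by (simp add: algebra_simps power2_eq_square)
      then show ?thesis using that by simp
    qed
    have "(1 - e * s ^ 2) * (x + 1) = (1 - e * s ^ 2) * (x' + 1)"
      using * n nz y by metis
    then have "x = x'" using \<open>1 - e * s ^ 2 \<noteq> 0\<close> by simp
    then show "q = q'" using y xy by simp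
  qed
  then have "card (?N - {(- 1, 0)}) \<le> card (UNIV :: 'f set)"
    by (rule card_inj_on_le) auto
  then show ?thesis
    using card_Diff_singleton_if[of ?N "(- 1, 0)"] card_field by (auto split: if_splits)
qed

text \<open>The extension has a primitive element \<open>c\<close>, of order \<open>p\<^sup>2 - 1 = (p - 1) (p + 1)\<close>. Its power \<open>A\<close> with exponent \<open>p - 1\<close>
  has norm 1 by Fermat and order \<open>p + 1\<close>. Since there are at most \<open>p + 1\<close> elements of norm 1, the powers of \<open>A\<close> are
  all of them. Passing to the projective group halves the order.\<close>

lemma nonsplit_torus_exists:
  "\<exists>A. det A = 1 \<and> ord (pr A) = ord_nonsplit \<and>
     range (\<lambda>k::int. pr A [^] k) = pr ` norm_one"
proof -
  have cq: "carrier quad_ring = range (\<lambda>(x, y). quad x y)" by (auto simp: quad_ring_def)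
  have inj: "inj (\<lambda>(x, y). quad x y)" by (auto intro!: injI)
  have "card (carrier quad_ring) = p * p"
    unfolding cq using card_image[OF inj] card_field
    by (simp add: card_cartesian_product flip: UNIV_Times_UNIV)
  moreover have "p * p - 1 = (p - 1) * (p + 1)"
    by (simp add: algebra_simps diff_mult_distrib)
  ultimately have ord_q: "card (carrier quad_ring) - 1 = (p - 1) * (p + 1)" by simp
  obtain c where c: "c \<in> carrier quad_ring" "c \<noteq> quad 0 0" "\<And>n. mpow c n = quad 1 0 \<longleftrightarrow> (p - 1) * (p + 1) dvd n"
    using field.finite_mult_group_generator[OF field_quad_ring] unfolding quad_ring_pow ord_q
    by (auto simp: quad_ring_def)
  obtain x y where xy: "c = quad x y" using c(1) cq by auto
  have "det c \<noteq> 0" using c(2) norm_eq_0[of x y] by (auto simp: xy)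
  define A where "A = mpow c (p - 1)"
  have det_A: "det A = 1"
    using fermat[OF \<open>det c \<noteq> 0\<close>] by (simp add: A_def det_mpow)
  have pow: "mpow A n = mpow c ((p - 1) * n)" for n by (simp add: A_def mpow_mult)
  have A_E: "\<exists>x y. mpow A n = quad x y" for n
    unfolding pow xy by (rule mpow_quad)
  have p1: "p - 1 > 0" using p_gt_3 by simp
  have qA: "mpow A n = quad 1 0 \<longleftrightarrow> p + 1 dvd n" for n
    unfolding pow c(3) using p1 by (subst nat_mult_dvd_cancel1) auto
  have ord: "ord (pr A) = ord_nonsplit"
  proof (rule ord_eqI)
    fix n :: nat
    have "pr A [^] n = \<one> \<longleftrightarrow> mpow A n ** mpow A n = quad 1 0"
      by (metis A_E pr_quad_eq_one pr_mpow det_A)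
    also have "mpow A n ** mpow A n = mpow A (n * 2)" by (simp add: mult_2_right mpow_add)
    also have "\<dots> = quad 1 0 \<longleftrightarrow> ord_nonsplit dvd n" unfolding qA by (rule dvd_ord_nonsplit)
    finally show "pr A [^] n = \<one> \<longleftrightarrow> ord_nonsplit dvd n" .
  qed (simp add: det_A)
  let ?N = "norm_one"
  have N_eq: "?N = (\<lambda>(x, y). quad x y) ` {(x, y). x ^ 2 - e * y ^ 2 = 1}" by auto
  have "card ?N \<le> p + 1"
    unfolding N_eq by (rule le_trans[OF card_image_le card_norm_one]) simp
  moreover have "inj_on (mpow A) {..<p + 1}"
  proof -
    have *: "i = j" if "mpow A i = mpow A j" "i \<le> j" "j < p + 1" for i j
    proof -
      have "mpow A j = mpow A (j - i) ** mpow A i" using that(2) by (simp flip: mpow_add)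
      then have "mpow A i = mpow A (j - i) ** mpow A i" using that(1) by metis
      moreover obtain C where C: "mpow A i ** C = mat 1"
        using group.r_inv_ex[OF group_SL, of "mpow A i"] by (auto simp: det_mpow det_A)
      ultimately have "mat 1 = mpow A (j - i) ** (mpow A i ** C)"
        by (metis matrix_mul_assoc)
      then have "mpow A (j - i) = quad 1 0" by (simp add: C flip: mat_1_quad)
      then have "p + 1 dvd j - i" using qA by blast
      moreover have "j - i < p + 1" using that by simp
      ultimately show ?thesis using that by (auto dest: dvd_imp_le)
    qed
    show ?thesis
      by (rule inj_onI) (metis * lessThan_iff nat_le_linear)
  qed
  then have "card (mpow A ` {..<p + 1}) = p + 1" by (simp add: card_image)
  moreover have sub: "range (mpow A) \<subseteq> ?N"
  proof
    fix X assume "X \<in> range (mpow A)"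
    then obtain n where n: "X = mpow A n" by blast
    obtain x y where "X = quad x y" using A_E n by blast
    moreover have "det X = 1" by (simp add: n det_mpow det_A)
    ultimately show "X \<in> ?N" by auto
  qed
  ultimately have "mpow A ` {..<p + 1} = ?N"
    by (intro card_seteq) (auto simp: N_eq)
  then have "range (mpow A) = ?N" using sub by blast
  moreover have "range (\<lambda>k::int. pr A [^] k) = range (\<lambda>k::nat. pr A [^] k)"
    using ord ord_nonsplit_pos det_A by (intro range_int_pow) auto
  moreover have "\<dots> = pr ` range (mpow A)" by (simp add: pr_mpow det_A image_image)
  ultimately show ?thesis using det_A ord by (intro exI[of _ A]) simp
qed

definition nonsplit_gen :: "'f ^ 2 ^ 2" where
  "nonsplit_gen = (SOME A. det A = 1 \<and> ord (pr A) = ord_nonsplit \<and>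
     range (\<lambda>k::int. pr A [^] k) = pr ` norm_one)"

abbreviation nonsplit_T :: "('f ^ 2 ^ 2) set set" where "nonsplit_T \<equiv> range (\<lambda>k::int. pr nonsplit_gen [^] k)"

lemma nonsplit_gen: "det nonsplit_gen = 1" "ord (pr nonsplit_gen) = ord_nonsplit"
  "nonsplit_T = pr ` norm_one"
  using someI_ex[OF nonsplit_torus_exists] unfolding nonsplit_gen_def[symmetric] by blast+

text \<open>Multiplication by \<open>u + v \<surd>e\<close> after the conjugation of the quadratic extension. It anticommutes with the
  multiplication by \<open>\<surd>e\<close>.\<close>

definition antiquad :: "'f \<Rightarrow> 'f \<Rightarrow> 'f ^ 2 ^ 2" where "antiquad u v = Mat u (- e * v) v (- u)"

text \<open>The involution that inverts the nonsplit torus; it exists since -1 is the norm of some \<open>u + v \<surd>e\<close>.\<close>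

definition nonsplit_weyl :: "'f ^ 2 ^ 2" where
  "nonsplit_weyl = (SOME A. det A = 1 \<and> (\<exists>u v. A = antiquad u v))"

lemma nonsplit_weyl: "det nonsplit_weyl = 1" "\<exists>u v. nonsplit_weyl = antiquad u v"
proof -
  have "- e \<noteq> 0" using nonsquare[of 0] by auto
  then obtain u v where "u ^ 2 + (- e) * v ^ 2 = - 1" using conic by blast
  then have "det (antiquad u v) = 1"
    by (simp add: antiquad_def power2_eq_square algebra_simps)
  then have "\<exists>A. det A = 1 \<and> (\<exists>u v. A = antiquad u v)" by blast
  from someI_ex[OF this] show "det nonsplit_weyl = 1" "\<exists>u v. nonsplit_weyl = antiquad u v"
    unfolding nonsplit_weyl_def[symmetric] by blast+
qed

text \<open>Since \<open>nonsplit_weyl\<close> squares to -1, the quotient of the two matrices is, up to sign, their product, which lies in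
  the extension field and has norm 1.\<close>

lemma antiquad_in_coset:
  assumes "det (antiquad u v) = 1"
  shows "pr (antiquad u v) \<in> range (\<lambda>k::int. pr nonsplit_gen [^] k \<otimes> pr nonsplit_weyl)"
proof -
  obtain u' v' where n: "nonsplit_weyl = antiquad u' v'" using nonsplit_weyl by blast
  define x y where "x = - (u * u' - e * v * v')" and "y = - (v * u' - u * v')"
  have d': "e * v' * v' - u' * u' = 1" using nonsplit_weyl(1) n by (simp add: antiquad_def algebra_simps)
  have d: "e * v * v - u * u = 1" using assms by (simp add: antiquad_def algebra_simps)
  have "quad x y = - (antiquad u v ** nonsplit_weyl)"
    by (simp add: n antiquad_def quad_def x_def y_def algebra_simps)
  then have det: "det (quad x y) = 1" using assms nonsplit_weyl by (simp add: det_mul del: det_quad)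
  have quad_antiquad: "quad x y ** antiquad u' v' = antiquad (x * u' + e * y * v') (y * u' + x * v')"
    by (simp add: antiquad_def quad_def algebra_simps)
  have "quad x y ** nonsplit_weyl = antiquad u v"
  proof -
    have "x * u' + e * y * v' = u * (e * v' * v' - u' * u')"
      by (simp add: x_def y_def algebra_simps)
    moreover have "y * u' + x * v' = v * (e * v' * v' - u' * u')"
      by (simp add: x_def y_def algebra_simps)
    ultimately show ?thesis unfolding d' n quad_antiquad by simp
  qed
  moreover have "pr (quad x y) \<in> nonsplit_T"
    unfolding nonsplit_gen(3) using det by auto
  then obtain k :: int where "pr (quad x y) = pr nonsplit_gen [^] k" by blast
  ultimately have "pr (antiquad u v) = pr nonsplit_gen [^] k \<otimes> pr nonsplit_weyl"
    using det nonsplit_weyl by (metis pr_mult)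
  then show ?thesis by blast
qed

text \<open>Conjugate elements have equal trace, and an element of norm 1 is determined by its trace up to the sign of its \<open>\<surd>e\<close>-part.
  Hence a conjugating matrix commutes or anticommutes with \<open>\<surd>e\<close>.\<close>

sublocale nonsplit: torus G p "pr nonsplit_gen" "pr nonsplit_weyl" ord_nonsplit
proof
  show "pr nonsplit_gen \<in> carrier G" "pr nonsplit_weyl \<in> carrier G" using nonsplit_gen nonsplit_weyl by simp_all
  show "ord (pr nonsplit_gen) = ord_nonsplit" by (rule nonsplit_gen)
  show "ord_nonsplit > 0" by (rule ord_nonsplit_pos)
  show "\<not> p dvd 2 * ord_nonsplit" by (rule ord_nonsplit_coprime)
  obtain u v where n: "nonsplit_weyl = antiquad u v" using nonsplit_weyl by blast
  have d: "e * v * v - u * u = 1" using nonsplit_weyl(1) n by (simp add: antiquad_def algebra_simps)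
  have w2: "nonsplit_weyl ** nonsplit_weyl = - mat 1"
    using d by (simp add: n antiquad_def mat_eq_Mat algebra_simps)
  show "pr nonsplit_weyl \<otimes> pr nonsplit_weyl = \<one>"
    using nonsplit_weyl w2 by (simp add: one_G)
  have "pr nonsplit_gen \<in> nonsplit_T"
    using int_pow_1[of "pr nonsplit_gen"] nonsplit_gen(1) by (metis pr_closed rangeI)
  then obtain x y where t: "pr nonsplit_gen = pr (quad x y)" "x ^ 2 - e * y ^ 2 = 1"
    unfolding nonsplit_gen(3) by blast
  have "nonsplit_weyl ** quad x y ** nonsplit_weyl = - quad x (- y)"
  proof -
    have "nonsplit_weyl ** quad x y = quad x (- y) ** nonsplit_weyl"
      by (simp add: n antiquad_def quad_def algebra_simps)
    then have "nonsplit_weyl ** quad x y ** nonsplit_weyl = quad x (- y) ** (nonsplit_weyl ** nonsplit_weyl)" by (simp add: matrix_mul_assoc)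
    then show ?thesis by (simp add: w2)
  qed
  then have 1: "pr nonsplit_weyl \<otimes> pr (quad x y) \<otimes> pr nonsplit_weyl = pr (quad x (- y))"
    using t nonsplit_weyl by (simp add: det_mul del: uminus_quad)
  have "pr (quad x (- y)) \<otimes> pr (quad x y) = \<one>"
    using t(2) by (simp add: one_G mat_1_quad power2_eq_square algebra_simps)
  then have "inv (pr (quad x y)) = pr (quad x (- y))"
    using t(2) by (intro inv_equality) auto
  then show "pr nonsplit_weyl \<otimes> pr nonsplit_gen \<otimes> pr nonsplit_weyl = inv (pr nonsplit_gen)" using 1 t by simp
  show "pr nonsplit_weyl \<notin> nonsplit_T"
  proof
    assume "pr nonsplit_weyl \<in> nonsplit_T"
    then obtain x y where "nonsplit_weyl = quad x y \<or> nonsplit_weyl = - quad x y"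
      unfolding nonsplit_gen(3) by (auto simp: pr_eq_iff)
    then have "u = 0" "v = 0 \<or> e = 0" by (auto simp: n antiquad_def quad_def)
    then show False using d by auto
  qed
  fix g and i :: int
  assume g: "g \<in> carrier G" and i: "pr nonsplit_gen [^] i \<noteq> \<one>"
    and cn: "cnj g (pr nonsplit_gen [^] i) \<in> nonsplit_T"
  have "pr nonsplit_gen [^] i \<in> nonsplit_T" by blast
  then obtain x y where s: "x ^ 2 - e * y ^ 2 = 1" "pr nonsplit_gen [^] i = pr (quad x y)"
    unfolding nonsplit_gen(3) by blast
  obtain x' y' where s': "x' ^ 2 - e * y' ^ 2 = 1" "cnj g (pr (quad x y)) = pr (quad x' y')"
    using cn unfolding nonsplit_gen(3) s(2) by blast
  have "y \<noteq> 0"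
  proof
    assume "y = 0"
    then have "quad x y ** quad x y = quad 1 0" using s(1) by (simp add: power2_eq_square)
    then show False using i s pr_quad_eq_one by simp
  qed
  obtain a b c d where A: "g = pr (Mat a b c d)" "a * d - b * c = 1"
    using g by (rule carrierE)
  have "Mat a b c d ** quad x y = quad x' y' ** Mat a b c d \<or>
      Mat a b c d ** quad x y = quad (- x') (- y') ** Mat a b c d"
    using s' s(1) A by (simp add: cnj_pr_iff flip: uminus_quad)
  then obtain X Y where XY: "X ^ 2 - e * Y ^ 2 = 1" "Mat a b c d ** quad x y = quad X Y ** Mat a b c d"
    using s'(1) by (metis power2_minus)
  have eqs: "a * x + b * y = X * a + e * Y * c" "a * e * y + b * x = X * b + e * Y * d"
    "c * x + d * y = Y * a + X * c" "c * e * y + d * x = Y * b + X * d"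
    using XY(2) by (simp_all add: quad_def algebra_simps)
  \<comment> \<open>This expresses the invariance of the trace under conjugation by \<open>Mat a b c d\<close>.\<close>
  have "2 * x = (a * d - b * c) * (2 * x)" using A by simp
  also have "\<dots> = d * (a * x + b * y) - c * (a * e * y + b * x) - b * (c * x + d * y) + a * (c * e * y + d * x)"
    by (simp add: algebra_simps)
  also have "\<dots> = (a * d - b * c) * (2 * X)" unfolding eqs by (simp add: algebra_simps)
  also have "\<dots> = 2 * X" using A by simp
  finally have "X = x" by simp
  then have "e * Y ^ 2 = e * y ^ 2" using s(1) XY(1) by (metis add_left_cancel diff_add_cancel)
  moreover have e0: "e \<noteq> 0" using nonsquare[of 0] by auto
  ultimately have "Y = y \<or> Y = - y" by (simp add: power2_eq_iff)
  then show "g \<in> nonsplit_T \<union> range (\<lambda>k::int. pr nonsplit_gen [^] k \<otimes> pr nonsplit_weyl)"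
  proof
    assume "Y = y"
    then have "b * y = e * c * y" "d * y = a * y"
      using eqs \<open>X = x\<close> by (simp_all add: algebra_simps)
    then have "Mat a b c d = quad a c" using \<open>y \<noteq> 0\<close> by (simp add: quad_def)
    moreover from this have "a ^ 2 - e * c ^ 2 = 1"
      using A(2) by (simp add: quad_def power2_eq_square algebra_simps)
    ultimately have "g \<in> pr ` norm_one" using A(1) by auto
    then show ?thesis unfolding nonsplit_gen(3) by blast
  next
    assume "Y = - y"
    then have "(b + e * c) * y = 0" "(d + a) * y = 0"
      using eqs \<open>X = x\<close> by (simp_all add: algebra_simps)
    then have "b = - e * c" "d = - a" using \<open>y \<noteq> 0\<close> by (simp_all add: eq_neg_iff_add_eq_0)
    then have "Mat a b c d = antiquad a c" by (simp add: antiquad_def)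
    moreover from this have "det (antiquad a c) = 1" using A(2) by (metis det_Mat)
    ultimately show ?thesis using antiquad_in_coset A(1) by auto
  qed
qed

end

section \<open>Elements of order 4 and the square root of 2\<close>

context torus
begin

lemma four_dvd_if_elem_of_order_4:
  assumes g: "g \<in> range (\<lambda>k::int. t [^] k)" and "g \<otimes> g \<noteq> \<one>" "(g \<otimes> g) \<otimes> (g \<otimes> g) = \<one>"
  shows "4 dvd m"
proof -
  obtain k where k: "g = rot k" using g by (auto simp: rot_def)
  then have "\<not> int m dvd k + k" "int m dvd k + k + (k + k)" using assms(2,3) by simp_all
  then have "int m dvd 4 * k" by simp
  then obtain l where l: "4 * k = int m * l" by blast
  have "odd l"
  proof
    assume "even l"
    then obtain j where "l = 2 * j" by blast
    then have "k + k = int m * j" using l by simp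
    then show False using \<open>\<not> int m dvd k + k\<close> by simp
  qed
  then have "coprime 2 l" by simp
  then have "coprime (2 * 2) l" unfolding coprime_mult_left_iff by blast
  then have "coprime 4 l" by simp
  moreover have "4 dvd int m * l" using l by (metis dvd_triv_left)
  ultimately have "4 dvd int m" by (simp add: coprime_dvd_mult_left_iff)
  then have "int 4 dvd int m" by simp
  then show "4 dvd m" using int_dvd_int_iff by blast
qed

lemma elem_of_order_4:
  assumes "4 dvd m"
  shows "\<exists>g\<in>carrier G. g \<otimes> g \<noteq> \<one> \<and> (g \<otimes> g) \<otimes> (g \<otimes> g) = \<one>"
proof -
  obtain j where j: "m = 4 * j" using assms by blast
  then have "j > 0" using m_pos by simp
  then have "\<not> int m dvd int j + int j" using j by (auto dest!: zdvd_imp_le)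
  moreover have "int m dvd int j + int j + (int j + int j)" by (simp add: j)
  ultimately show ?thesis by (intro bexI[of _ "rot (int j)"]) auto
qed

end

context psl2
begin

definition qi :: "'f ^ 2 ^ 2" where "qi = Mat 0 (- 1) 1 0"

text \<open>If \<open>g\<close> has order 4, then the square \<open>X\<close> of a representing matrix satisfies \<open>X\<^sup>2 = \<plusminus>1\<close> without being \<open>\<plusminus>1\<close>, so its trace
  vanishes by Cayley-Hamilton. For determinant 1 the trace of the square is the squared trace minus 2.\<close>

lemma trace_of_elem_of_order_4:
  assumes "g \<in> carrier G" "g \<otimes> g \<noteq> \<one>" "(g \<otimes> g) \<otimes> (g \<otimes> g) = \<one>"
  shows "\<exists>r :: 'f. r ^ 2 = 2"
proof -
  obtain a b c d where A: "g = pr (Mat a b c d)" "a * d - b * c = 1"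
    using assms(1) by (rule carrierE)
  let ?A = "Mat a b c d"
  define X where "X = ?A ** ?A"
  have detX: "det X = 1" using A by (simp add: X_def det_mul del: Mat_mult)
  have gX: "g \<otimes> g = pr X" using A by (simp add: X_def del: Mat_mult)
  obtain x y z w where M: "X = Mat x y z w" by (rule Mat_exhaust)
  have "X ** X = mat 1 \<or> X ** X = - mat 1"
    using assms(3) detX by (simp add: gX one_G pr_eq_iff)
  then obtain s where "X ** X = Mat s 0 0 s" by (auto simp: mat_eq_Mat)
  then have s: "x * x + y * z = s" "x * y + y * w = 0" "z * x + w * z = 0" "z * y + w * w = s"
    by (simp_all add: M)
  have "x * x - w * w = (x * x + y * z) - (z * y + w * w)" by simp
  then have "x * x - w * w = 0" unfolding s by simp
  moreover have "y * (x + w) = 0" "z * (x + w) = 0"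
    using s by (simp_all add: algebra_simps)
  ultimately have "y * (x + w) = 0" "z * (x + w) = 0" "(x - w) * (x + w) = 0"
    by (simp_all add: algebra_simps)
  moreover have "\<not> (y = 0 \<and> z = 0 \<and> x = w)"
  proof
    assume *: "y = 0 \<and> z = 0 \<and> x = w"
    then have "x * x = 1" using detX by (simp add: M)
    then have "x = 1 \<or> x = - 1" by (simp add: square_eq_1_iff)
    then have "X = mat 1 \<or> X = - mat 1" using * by (auto simp: M mat_eq_Mat)
    then show False using assms(2) by (simp add: gX one_G pr_eq_iff)
  qed
  ultimately have "x + w = 0" by auto
  moreover have "x = a * a + b * c" "w = c * b + d * d" using M by (simp_all add: X_def)
  ultimately have "a * a + d * d + 2 * (b * c) = 0" by (simp add: algebra_simps)
  then have "(a + d) ^ 2 = 2 * (a * d - b * c)" by (simp add: power2_eq_square algebra_simps)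
  then show ?thesis using A by auto
qed

text \<open>A matrix of trace \<open>r\<close> and determinant 1 has order 4 in the projective group. Such a matrix is sought in a torus
  as \<open>x + y \<surd>e\<close> with \<open>x = r / 2\<close>; the norm condition reads \<open>e y\<^sup>2 = -1/2\<close>. If \<open>-1/2\<close> is a square, then \<open>x + y\<close> is an eigenvalue
  of such an element of the split torus; otherwise \<open>e = -1/2\<close>, \<open>y = 1\<close> gives such an element of a nonsplit torus.\<close>

lemma four_dvd_if_sqrt2:
  fixes r :: 'f
  assumes r: "r ^ 2 = 2"
  shows "4 dvd ord_split \<or> 4 dvd ord_nonsplit"
proof -
  define h :: 'f where "h = 1 / 2"
  define x where "x = h * r"
  have h: "2 * h = 1" "h + h = 1" by (simp_all add: h_def flip: mult_2)
  have xx: "x ^ 2 = h"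
  proof -
    have "x ^ 2 = (2 * h) * h" using r by (simp add: x_def power2_eq_square algebra_simps)
    then show ?thesis using h by simp
  qed
  have x0: "x \<noteq> 0" using xx by (auto simp: h_def)
  show ?thesis
  proof (cases "\<exists>y. y ^ 2 = - h")
    case True
    then obtain y where y: "y ^ 2 = - h" by blast
    define s where "s = x + y"
    have "s * (x - y) = x ^ 2 - y ^ 2" by (simp add: s_def power2_eq_square algebra_simps)
    then have s1: "s * (x - y) = 1" using xx y h by simp
    then have s0: "s \<noteq> 0" by auto
    have y0: "y \<noteq> 0" using y by (auto simp: h_def)
    have "s ^ 2 = x ^ 2 + y ^ 2 + 2 * (x * y)" by (simp add: s_def power2_eq_square algebra_simps)
    then have s2: "s ^ 2 = 2 * (x * y)" using xx y by simp
    have "(s ^ 2) ^ 2 = 2 * 2 * (x ^ 2 * y ^ 2)" unfolding s2 by (simp add: power2_eq_square algebra_simps)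
    also have "\<dots> = - ((2 * h) * (2 * h))" unfolding xx y by (simp add: algebra_simps)
    finally have s4: "(s ^ 2) ^ 2 = - 1" using h by simp
    let ?g = "pr (diag s)"
    have sq: "?g \<otimes> ?g = pr (diag (s ^ 2))" using s0 by (simp add: diag_mult power2_eq_square)
    have sq2: "(?g \<otimes> ?g) \<otimes> (?g \<otimes> ?g) = pr (diag ((s ^ 2) ^ 2))"
      unfolding sq using s0 by (simp add: diag_mult power2_eq_square)
    have "?g \<otimes> ?g \<noteq> \<one>" unfolding sq using s0 s4 by (simp add: pr_diag_eq_one)
    moreover have "(?g \<otimes> ?g) \<otimes> (?g \<otimes> ?g) = \<one>"
      unfolding sq2 using s4 by (simp add: pr_diag_eq_one)
    moreover have "?g \<in> split_T" unfolding split_gen(3) using s0 by blast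
    ultimately show ?thesis using split.four_dvd_if_elem_of_order_4 by blast
  next
    case False
    then interpret N: psl2_nonsplit p G "- h" by unfold_locales blast
    let ?g = "pr (N.quad x 1)"
    have n: "x ^ 2 - (- h) * 1 ^ 2 = 1" using xx h by simp
    have sq: "?g \<otimes> ?g = pr (N.quad 0 (2 * x))"
      using n xx h by (simp add: power2_eq_square)
    have d: "det (N.quad 0 (2 * x)) = 1"
    proof -
      have "det (N.quad 0 (2 * x)) = (2 * h) * (2 * x ^ 2)" by (simp add: power2_eq_square algebra_simps)
      then show ?thesis using xx h by simp
    qed
    have "?g \<otimes> ?g \<noteq> \<one>" unfolding sq one_G pr_eq_iff N.mat_1_quad using x0 by simp
    moreover have "(?g \<otimes> ?g) \<otimes> (?g \<otimes> ?g) = \<one>"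
    proof -
      have "pr (N.quad 0 (2 * x)) \<otimes> pr (N.quad 0 (2 * x)) = pr (N.quad (- (h * (2 * x) * (2 * x))) 0)"
        using d by simp
      also have "h * (2 * x) * (2 * x) = (2 * h) * (2 * x ^ 2)" by (simp add: power2_eq_square algebra_simps)
      also have "\<dots> = 1" using xx h by simp
      finally show ?thesis unfolding sq by (simp add: one_G N.mat_1_quad pr_eq_iff)
    qed
    moreover have "?g \<in> N.nonsplit_T" unfolding N.nonsplit_gen(3) using n by blast
    ultimately show ?thesis using N.nonsplit.four_dvd_if_elem_of_order_4 by blast
  qed
qed

text \<open>Conjugation by a diagonal matrix of determinant \<open>s\<close>. For a nonsquare \<open>s\<close> it induces an automorphism of the projective
  special group that is not inner.\<close>

definition twist :: "'f \<Rightarrow> 'f ^ 2 ^ 2 \<Rightarrow> 'f ^ 2 ^ 2" where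
  "twist s A = Mat s 0 0 1 ** A ** Mat (inverse s) 0 0 1"

lemma twist_Mat: "s \<noteq> 0 \<Longrightarrow> twist s (Mat a b c d) = Mat a (s * b) (c * inverse s) d"
  by (simp add: twist_def)

lemma twist_mult: "s \<noteq> 0 \<Longrightarrow> twist s (A ** B) = twist s A ** twist s B"
  by (cases A rule: Mat_exhaust; cases B rule: Mat_exhaust) (simp add: twist_Mat algebra_simps)

lemma det_twist [simp]: "s \<noteq> 0 \<Longrightarrow> det (twist s A) = det A"
  by (cases A rule: Mat_exhaust) (simp add: twist_Mat)

lemma twist_uminus: "s \<noteq> 0 \<Longrightarrow> twist s (- A) = - twist s A"
  by (cases A rule: Mat_exhaust) (simp add: twist_Mat)

lemma twist_twist: "s \<noteq> 0 \<Longrightarrow> twist s (twist (inverse s) A) = A"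
  by (cases A rule: Mat_exhaust) (simp add: twist_Mat field_simps)

lemma twist_image_pr: "s \<noteq> 0 \<Longrightarrow> twist s ` pr A = pr (twist s A)"
  by (simp add: pr_def twist_uminus)

lemma twist_iso:
  assumes s: "s \<noteq> 0"
  shows "(`) (twist s) \<in> iso G G"
proof -
  have "bij_betw ((`) (twist s)) (carrier G) (carrier G)"
    by (rule bij_betw_byWitness[where f' = "(`) (twist (inverse s))"])
       (use s twist_twist[of s] twist_twist[of "inverse s"] in
         \<open>auto simp: carrier_G twist_image_pr\<close>)
  moreover have "(`) (twist s) \<in> hom G G"
    using s by (auto simp: hom_def carrier_G twist_image_pr det_mul twist_mult)
  ultimately show ?thesis by (simp add: iso_def)
qed

end

section \<open>Quaternion units and the polyhedral subgroups\<close>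

text \<open>With \<open>u\<^sup>2 + v\<^sup>2 = -1\<close> the matrices \<open>qi\<close>, \<open>qj\<close>, \<open>qk\<close> satisfy the relations of the quaternion units, and every matrix of
  size 2 is a quaternion \<open>\<alpha> + \<beta> qi + \<gamma> qj + \<delta> qk\<close>, whose determinant is the norm.\<close>

locale psl2_quaternion = psl2 p G for p and G :: "('f::{field,finite} ^ 2 ^ 2) set monoid" (structure) +
  fixes u v :: 'f
  assumes uv: "u * u + v * v = - 1"
begin

definition qj :: "'f ^ 2 ^ 2" where "qj = Mat u v v (- u)"
definition qk :: "'f ^ 2 ^ 2" where "qk = Mat (- v) u u v"

lemma qi_qj: "qi ** qj = qk" by (simp add: qi_def qj_def qk_def)

lemma uu: "u * u = - 1 - v * v"
  using uv by (simp add: eq_diff_eq)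

lemma det_q [simp]: "det qi = 1" "det qj = 1" "det qk = 1"
  by (simp_all add: qi_def qj_def qk_def uu)

lemma vanish_if_uv: "x * u = 0 \<Longrightarrow> x * v = 0 \<Longrightarrow> x = 0"
  using uv by auto

lemma commutes_with_qi:
  assumes "Mat a b c d ** qi = qi ** Mat a b c d"
  shows "b = - c" "d = a"
  using arg_cong[OF assms, of "\<lambda>A. A $ 1 $ 1"] arg_cong[OF assms, of "\<lambda>A. A $ 2 $ 1"]
  by (simp_all add: qi_def)

lemma anticommutes_with_qi:
  assumes "Mat a b c d ** qi = - (qi ** Mat a b c d)"
  shows "c = b" "d = - a"
  using arg_cong[OF assms, of "\<lambda>A. A $ 1 $ 1"] arg_cong[OF assms, of "\<lambda>A. A $ 2 $ 1"]
  by (simp_all add: qi_def)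

text \<open>A quaternion that commutes or anticommutes with \<open>qi\<close> and with \<open>qj\<close> is a multiple of one of the units \<open>1\<close>, \<open>qi\<close>, \<open>qj\<close>, \<open>qk\<close>; so
  its norm is a square. For determinant 1 this computes the centraliser of the Klein four-group, and for a nonsquare
  determinant it is a contradiction.\<close>

lemma quaternion_centraliser:
  assumes i: "A ** qi = qi ** A \<or> A ** qi = - (qi ** A)"
    and j: "A ** qj = qj ** A \<or> A ** qj = - (qj ** A)"
  shows "\<exists>l. det A = l ^ 2 \<and> (A = Mat l 0 0 l \<or> A = Mat 0 (- l) l 0 \<or>
    A = Mat (l * u) (l * v) (l * v) (- (l * u)) \<or> A = Mat (- (l * v)) (l * u) (l * u) (l * v))"
proof -
  obtain a b c d where A: "A = Mat a b c d" by (rule Mat_exhaust)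
  from i show ?thesis
  proof
    assume "A ** qi = qi ** A"
    then have bd: "b = - c" "d = a" using commutes_with_qi unfolding A by blast+
    from j show ?thesis
    proof
      assume "A ** qj = qj ** A"
      then have "2 * (c * u) = 0" "2 * (c * v) = 0"
        unfolding A bd by (simp_all add: qj_def algebra_simps)
      then have "c * u = 0" "c * v = 0" by simp_all
      then have "c = 0" by (rule vanish_if_uv)
      then show ?thesis by (intro exI[of _ a]) (simp add: A bd power2_eq_square)
    next
      assume "A ** qj = - (qj ** A)"
      then have "2 * (a * u) = 0" "2 * (a * v) = 0"
        unfolding A bd by (simp_all add: qj_def algebra_simps)
      then have "a * u = 0" "a * v = 0" by simp_all
      then have "a = 0" by (rule vanish_if_uv)
      then show ?thesis by (intro exI[of _ c]) (simp add: A bd power2_eq_square)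
    qed
  next
    assume "A ** qi = - (qi ** A)"
    then have bd: "c = b" "d = - a" using anticommutes_with_qi unfolding A by blast+
    have det: "det A = - (a * a + b * b)" by (simp add: A bd)
    from j show ?thesis
    proof
      assume "A ** qj = qj ** A"
      from arg_cong[OF this, of "\<lambda>A. A $ 1 $ 2"] have eq: "a * v + b * (- u) = u * b + v * (- a)"
        by (simp only: A bd qj_def Mat_mult Mat_nth uminus_Mat)
      have "2 * (a * v - b * u) = (a * v + b * (- u)) - (u * b + v * (- a))"
        by (simp add: algebra_simps)
      then have "2 * (a * v - b * u) = 0" unfolding eq by simp
      then have ab: "a * v = b * u" by simp
      define l where "l = - (a * u + b * v)"
      have "l * u = - (a * (u * u) + (b * u) * v)" by (simp add: l_def algebra_simps)
      also have "\<dots> = - a * (u * u + v * v)" unfolding ab[symmetric] by (simp add: algebra_simps)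
      finally have lu: "l * u = a" by (simp add: uv)
      have "l * v = - ((a * v) * u + b * (v * v))" by (simp add: l_def algebra_simps)
      also have "\<dots> = - b * (u * u + v * v)" unfolding ab by (simp add: algebra_simps)
      finally have lv: "l * v = b" by (simp add: uv)
      have "l ^ 2 = - (l * u * a + l * v * b)" unfolding power2_eq_square by (simp add: l_def algebra_simps)
      then have "det A = l ^ 2" using lu lv det by simp
      then show ?thesis using lu lv by (intro exI[of _ l]) (simp add: A bd)
    next
      assume "A ** qj = - (qj ** A)"
      from arg_cong[OF this, of "\<lambda>A. A $ 1 $ 1"] have eq: "a * u + b * v = - (u * a + v * b)"
        by (simp only: A bd qj_def Mat_mult Mat_nth uminus_Mat)
      have "2 * (b * v + a * u) = (a * u + b * v) + (u * a + v * b)"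
        by (simp add: algebra_simps)
      then have "2 * (b * v + a * u) = 0" unfolding eq by simp
      then have "b * v + a * u = 0" by (simp only: mult_eq_0_iff two_neq_zero simp_thms)
      then have ab: "b * v = - (a * u)" by (simp only: eq_neg_iff_add_eq_0)
      define l where "l = a * v - b * u"
      have "l * v = a * (v * v) - (b * v) * u" by (simp add: l_def algebra_simps)
      also have "\<dots> = a * (u * u + v * v)" unfolding ab by (simp add: algebra_simps)
      finally have lv: "l * v = - a" by (simp add: uv)
      have "l * u = - ((- (a * u)) * v) - b * (u * u)" by (simp add: l_def algebra_simps)
      also have "\<dots> = - b * (u * u + v * v)" unfolding ab[symmetric] by (simp add: algebra_simps)
      finally have lu: "l * u = b" by (simp add: uv)
      have "l ^ 2 = l * v * a - l * u * b" unfolding power2_eq_square by (simp add: l_def algebra_simps)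
      then have "det A = l ^ 2" using lu lv det by simp
      then show ?thesis using lu lv by (intro exI[of _ l]) (simp add: A bd)
    qed
  qed
qed

text \<open>Up to scalars, the quaternions that fix \<open>qi\<close> and carry \<open>qj\<close> to \<open>qk\<close> up to sign are \<open>1 \<plusminus> qi\<close> and \<open>qj \<plusminus> qk\<close>, of norm 2.\<close>

lemma quaternion_swap:
  assumes i: "A ** qi = qi ** A \<or> A ** qi = - (qi ** A)"
    and j: "A ** qj = qk ** A \<or> A ** qj = - (qk ** A)"
  shows "\<exists>s. det A = 2 * s ^ 2"
proof -
  obtain a b c d where A: "A = Mat a b c d" by (rule Mat_exhaust)
  from i show ?thesis
  proof
    assume "A ** qi = qi ** A"
    then have bd: "b = - c" "d = a" using commutes_with_qi unfolding A by blast+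
    let ?P = "a * u + (- c) * v" and ?Q = "(- v) * a + u * c"
      and ?R = "a * v + (- c) * (- u)" and ?S = "(- v) * (- c) + u * a"
    have "a = c \<or> a = - c"
    proof -
      have "a - c = 0" if eq: "A ** qj = qk ** A"
      proof -
        have 1: "?P = ?Q"
          using arg_cong[OF eq, of "\<lambda>A. A $ 1 $ 1"] by (simp only: A bd qj_def qk_def Mat_mult Mat_nth)
        have 2: "?R = ?S"
          using arg_cong[OF eq, of "\<lambda>A. A $ 1 $ 2"] by (simp only: A bd qj_def qk_def Mat_mult Mat_nth)
        have "2 * ((a - c) * u) = (?P - ?Q) - (?R - ?S)"
          "2 * ((a - c) * v) = (?P - ?Q) + (?R - ?S)"
          by (simp_all add: algebra_simps)
        then have "2 * ((a - c) * u) = 0" "2 * ((a - c) * v) = 0" unfolding 1 2 by simp_all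
        then have "(a - c) * u = 0" "(a - c) * v = 0"
          by (simp_all only: mult_eq_0_iff[of 2] two_neq_zero simp_thms)
        then show ?thesis by (rule vanish_if_uv)
      qed
      moreover have "a + c = 0" if eq: "A ** qj = - (qk ** A)"
      proof -
        have 1: "?P = - ?Q"
          using arg_cong[OF eq, of "\<lambda>A. A $ 1 $ 1"] by (simp only: A bd qj_def qk_def Mat_mult Mat_nth uminus_Mat)
        have 2: "?R = - ?S"
          using arg_cong[OF eq, of "\<lambda>A. A $ 1 $ 2"] by (simp only: A bd qj_def qk_def Mat_mult Mat_nth uminus_Mat)
        have "2 * ((a + c) * u) = (?P + ?Q) + (?R + ?S)"
          "2 * ((a + c) * v) = (?R + ?S) - (?P + ?Q)"
          by (simp_all add: algebra_simps)
        then have "2 * ((a + c) * u) = 0" "2 * ((a + c) * v) = 0" unfolding 1 2 by simp_all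
        then have "(a + c) * u = 0" "(a + c) * v = 0"
          by (simp_all only: mult_eq_0_iff[of 2] two_neq_zero simp_thms)
        then show ?thesis by (rule vanish_if_uv)
      qed
      ultimately show ?thesis using j by (auto simp: eq_neg_iff_add_eq_0)
    qed
    then show ?thesis by (intro exI[of _ c]) (auto simp: A bd power2_eq_square)
  next
    assume "A ** qi = - (qi ** A)"
    then have bd: "c = b" "d = - a" using anticommutes_with_qi unfolding A by blast+
    define s where "s = a * u + b * v"
    define r where "r = b * u - a * v"
    have "s = r \<or> s = - r"
    proof -
      have "A ** qj = Mat s (- r) r s" "qk ** A = Mat r (- s) s r"
        by (simp_all add: A bd qj_def qk_def s_def r_def algebra_simps)
      then show ?thesis using j by auto
    qed
    then have "r ^ 2 = s ^ 2" by auto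
    moreover have "s ^ 2 + r ^ 2 = (a * a + b * b) * (u * u + v * v)"
      by (simp add: s_def r_def power2_eq_square algebra_simps)
    ultimately have "det A = 2 * s ^ 2" by (simp add: A bd uv)
    then show ?thesis by blast
  qed
qed

text \<open>The Hurwitz quaternion \<open>(1 + qi + qj + qk) / 2\<close>, which permutes the units \<open>qi\<close>, \<open>qj\<close>, \<open>qk\<close> cyclically.\<close>

definition qc :: "'f ^ 2 ^ 2" where
  "qc = (let h = inverse 2 in Mat (h * (1 + u - v)) (h * (u + v - 1)) (h * (u + v + 1)) (h * (1 - u + v)))"

lemma det_qc [simp]: "det qc = 1" and qc_qi: "qc ** qi = qj ** qc" and qc_qj: "qc ** qj = qk ** qc"
proof -
  define h :: 'f where "h = inverse 2"
  have h: "2 * h = 1" by (simp add: h_def)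
  have qc: "qc = Mat (h * (1 + u - v)) (h * (u + v - 1)) (h * (u + v + 1)) (h * (1 - u + v))"
    by (simp add: qc_def h_def Let_def)
  have "det qc = h * h * (2 - 2 * (u * u + v * v))" by (simp add: qc algebra_simps)
  also have "\<dots> = (2 * h) * (2 * h)" unfolding uv by (simp add: algebra_simps)
  finally show "det qc = 1" by (simp add: h)
  have e1: "h * (u * u) + h * (v * v) = - h"
    using uv by (simp flip: distrib_left)
  have e: "h * (u * u) = - h - h * (v * v)" using e1 by (simp add: eq_diff_eq)
  show "qc ** qi = qj ** qc" "qc ** qj = qk ** qc"
    by (simp_all add: qc qi_def qj_def qk_def algebra_simps e)
qed

sublocale klein G p "pr qi" "pr qj" "pr qc"
proof
  show "pr qi \<in> carrier G" "pr qj \<in> carrier G" "pr qc \<in> carrier G" by simp_all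
  show "pr qi \<otimes> pr qi = \<one>" by (simp add: qi_def one_G mat_eq_Mat pr_eq_iff)
  show "pr qj \<otimes> pr qj = \<one>"
    by (simp add: qj_def one_G mat_eq_Mat pr_eq_iff uu)
  show "pr qj \<otimes> pr qi = pr qi \<otimes> pr qj"
  proof -
    have "qj ** qi = - qk" by (simp add: qj_def qi_def qk_def)
    then show ?thesis by (simp add: qi_qj)
  qed
  show "pr qi \<noteq> \<one>" "pr qj \<noteq> \<one>" "pr qi \<noteq> pr qj"
    using uv by (auto simp: qi_def qj_def one_G mat_eq_Mat pr_eq_iff)
  show "cnj (pr qc) (pr qi) = pr qj" by (simp add: cnj_pr_iff qc_qi)
  show "cnj (pr qc) (pr qj) = pr qi \<otimes> pr qj" by (simp add: cnj_pr_iff qc_qj qi_qj)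
  fix g assume g: "g \<in> carrier G" "cnj g (pr qi) = pr qi" "cnj g (pr qj) = pr qj"
  obtain A where A: "g = pr A" "det A = 1" using g(1) by (auto simp: carrier_G)
  obtain l where l: "det A = l ^ 2" "A = Mat l 0 0 l \<or> A = Mat 0 (- l) l 0 \<or>
    A = Mat (l * u) (l * v) (l * v) (- (l * u)) \<or> A = Mat (- (l * v)) (l * u) (l * u) (l * v)"
    using quaternion_centraliser[of A] g A by (auto simp: cnj_pr_iff)
  have "l = 1 \<or> l = - 1" using l(1) A by (simp add: power2_eq_1_iff)
  then have "A \<in> {mat 1, - mat 1, qi, - qi, qj, - qj, qk, - qk}"
    using l(2) by (elim disjE) (simp_all add: qi_def qj_def qk_def mat_eq_Mat)
  then have "pr A \<in> {pr (mat 1), pr qi, pr qj, pr qk}" by auto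
  then show "g \<in> {\<one>, pr qi, pr qj, pr qi \<otimes> pr qj}"
    by (simp add: A(1) one_G qi_qj)
qed

lemma V_class:
  "\<exists>H\<in>NP. \<not> sn H \<and> shape_of G p H = Dihedral 2"
  using Klein_class by blast

lemma tetrahedral_class: "\<exists>H\<in>NP. shape_of G p H = Polyhedral"
  using polyhedral_class[OF subgroup_A _ A_sub_S] by blast

text \<open>By \<open>quaternion_swap\<close> a transposition in the normaliser of the Klein four-group would have determinant \<open>2 s\<^sup>2 = 1\<close>, making 2 a square.\<close>

lemma tetrahedral_class_self_normalising:
  assumes "\<And>r :: 'f. r ^ 2 \<noteq> 2"
  shows "\<exists>H\<in>NP. sn H \<and> shape_of G p H = Polyhedral"
proof -
  have "sn A"
  proof (rule tetrahedral_self_normalising)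
    fix g assume g: "g \<in> carrier G" "cnj g (pr qi) = pr qi" "cnj g (pr qj) = z"
    obtain A where A: "g = pr A" "det A = 1" using g(1) by (auto simp: carrier_G)
    have "z = pr qk" by (metis z_def pr_mult qi_qj det_q(1,2))
    then obtain s where "det A = 2 * s ^ 2"
      using quaternion_swap[of A] g A by (auto simp: cnj_pr_iff)
    moreover have "(2 * s) ^ 2 = 2 * (2 * s ^ 2)" by (simp add: power2_eq_square)
    ultimately have "(2 * s) ^ 2 = 2" using A(2) by simp
    then show False using assms by blast
  qed
  then show ?thesis using polyhedral_class[OF subgroup_A _ A_sub_S] by blast
qed

text \<open>The quaternion \<open>(1 + qi) / r\<close> has norm 1 and square \<open>qi\<close>, so it provides the square root that makes the normaliser
  octahedral. The second class is obtained by a twist with a nonsquare \<open>n\<close>: were it the same class, some \<open>B\<close> of determinant 1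
  times the matrix of determinant \<open>n\<close> would centralise the quaternion units up to sign, and \<open>n\<close> would be a square.\<close>

lemma octahedral_classes_of_sqrt2:
  fixes r :: 'f
  assumes r: "r ^ 2 = 2"
  shows "\<exists>H\<in>NP. \<exists>K\<in>NP.
    sn H \<and> sn K \<and>
    shape_of G p H = Polyhedral \<and> shape_of G p K = Polyhedral \<and> (\<forall>g\<in>carrier G. cnj g ` H \<noteq> K)"
proof -
  define k where "k = inverse r"
  have "r \<noteq> 0" using r two_neq_zero by (metis zero_power2)
  have "2 * k ^ 2 = r ^ 2 * k ^ 2" using r by simp
  also have "\<dots> = 1" using \<open>r \<noteq> 0\<close> by (simp add: k_def flip: power_mult_distrib)
  finally have k: "k * k + k * k = 1" by (simp add: power2_eq_square)
  define q where "q = Mat k (- k) k k"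
  have q: "det q = 1" "q ** q = qi" "q ** qj = qk ** q"
    using k by (simp_all add: q_def qi_def qj_def qk_def algebra_simps)
  interpret klein_root G p "pr qi" "pr qj" "pr qc" "pr q"
  proof
    show "pr q \<in> carrier G" using q by simp
    show "pr q \<otimes> pr q = pr qi" using q by simp
    have "pr qi \<otimes> pr qj = pr qk" using pr_mult[of qi qj] qi_qj by (simp only: det_q)
    moreover have "cnj (pr q) (pr qj) = pr qk" using q by (simp add: cnj_pr_iff)
    ultimately show "cnj (pr q) (pr qj) = pr qi \<otimes> pr qj" by metis
  qed
  obtain n :: 'f where n: "\<And>x. x ^ 2 \<noteq> n" using nonsquare_exists by blast
  have n0: "n \<noteq> 0" using n[of 0] by auto
  let ?D = "Mat n 0 0 1" and ?D' = "Mat (inverse n) 0 0 1"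
  have DD: "?D' ** ?D = mat 1" using n0 by (simp add: mat_eq_Mat)
  have untwist: "B ** twist n X ** ?D = B ** ?D ** X" for B X
  proof -
    have "B ** twist n X ** ?D = B ** ?D ** X ** (?D' ** ?D)"
      by (simp only: twist_def matrix_mul_assoc)
    then show ?thesis unfolding DD by simp
  qed
  show ?thesis
  proof (rule octahedral_classes[OF twist_iso[OF n0]])
    fix g assume g: "g \<in> carrier G" "cnj g (twist n ` pr qi) = pr qi" "cnj g (twist n ` pr qj) = pr qj"
    obtain B where B: "g = pr B" "det B = 1" using g(1) by (auto simp: carrier_G)
    have *: "B ** ?D ** X = X ** (B ** ?D) \<or> B ** ?D ** X = - (X ** (B ** ?D))"
      if X: "det X = 1" "cnj g (twist n ` pr X) = pr X" for X
    proof -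
      have "B ** twist n X = X ** B \<or> B ** twist n X = - (X ** B)"
        using X B n0 by (simp add: twist_image_pr cnj_pr_iff)
      then have "B ** twist n X ** ?D = X ** B ** ?D \<or> B ** twist n X ** ?D = - (X ** B ** ?D)"
        by (auto simp del: Mat_mult)
      then show ?thesis unfolding untwist by (simp only: matrix_mul_assoc)
    qed
    obtain l where "det (B ** ?D) = l ^ 2"
      using quaternion_centraliser[OF *[of qi] *[of qj]] g by auto
    then have "n = l ^ 2" using B by (simp add: det_mul)
    then show False using n by blast
  qed
qed

end

context psl2
begin

lemma quaternion_exists: "\<exists>u v :: 'f. u * u + v * v = - 1"
  using conic[of 1 "- 1"] by (simp add: power2_eq_square)

lemma sqrt2_if_four_dvd:
  assumes "4 dvd ord_split \<or> 4 dvd ord_nonsplit"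
  shows "\<exists>r :: 'f. r ^ 2 = 2"
  using assms
proof
  assume "4 dvd ord_split"
  from split.elem_of_order_4[OF this] show ?thesis using trace_of_elem_of_order_4 by blast
next
  assume d: "4 dvd ord_nonsplit"
  obtain e :: 'f where "\<And>x. x ^ 2 \<noteq> e" using nonsquare_exists by blast
  then interpret N: psl2_nonsplit p G e by unfold_locales
  from N.nonsplit.elem_of_order_4[OF d] show ?thesis using trace_of_elem_of_order_4 by blast
qed

end

section \<open>Divisors of two consecutive numbers\<close>

lemma card_divisors_ge:
  assumes "n > 0" "D \<subseteq> {d::nat. d dvd n}"
  shows "card D \<le> card {d. d dvd n}"
  using assms by (intro card_mono) (auto intro: finite_divisors_nat)

lemma card_divisors_ge_2:
  assumes "n > 1"
  shows "2 \<le> card {d::nat. d dvd n}"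
proof -
  have "card {1, n} \<le> card {d. d dvd n}" by (rule card_divisors_ge) (use assms in auto)
  then show ?thesis using assms by (simp add: card_insert_if)
qed

lemma card_divisors_even:
  assumes "even n" "n > 4"
  shows "4 \<le> card {d::nat. d dvd n}"
proof -
  obtain k where k: "n = 2 * k" using assms by blast
  have "card {1, 2, k, n} \<le> card {d. d dvd n}"
    by (rule card_divisors_ge) (use assms k in auto)
  then show ?thesis using k assms by (simp add: card_insert_if)
qed

lemma card_divisors_3:
  assumes "3 dvd n" "n > 9"
  shows "4 \<le> card {d::nat. d dvd n}"
proof -
  obtain k where k: "n = 3 * k" using assms by blast
  have "card {1, 3, k, n} \<le> card {d. d dvd n}"
    by (rule card_divisors_ge) (use assms k in auto)
  then show ?thesis using k assms by (simp add: card_insert_if)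
qed

lemma card_divisors_6:
  assumes "6 dvd n" "n > 6"
  shows "6 \<le> card {d::nat. d dvd n}"
proof -
  obtain k where k: "n = 6 * k" using assms by blast
  have "2 * k dvd n" "3 * k dvd n" "2 dvd n" "3 dvd n" unfolding k by (auto intro: dvd_mult2)
  then have "card {1, 2, 3, 2 * k, 3 * k, n} \<le> card {d. d dvd n}"
    by (intro card_divisors_ge) (use assms k in auto)
  moreover have "k > 1" using k assms by simp
  ultimately show ?thesis using k by (simp add: card_insert_if)
qed

lemma card_divisors_6_large:
  assumes "6 dvd n" "n > 18"
  shows "8 \<le> card {d::nat. d dvd n}"
proof -
  obtain k where k: "n = 6 * k" using assms by blast
  then have "k > 3" using assms by simp
  have dv: "2 * k dvd n" "3 * k dvd n" "2 dvd n" "3 dvd n" "6 dvd n" "k dvd n"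
    unfolding k by (auto intro: dvd_mult2)
  show ?thesis
  proof (cases "k = 6")
    case True
    have "card {1::nat, 2, 3, 4, 6, 9, 12, 18} \<le> card {d. d dvd n}"
      by (rule card_divisors_ge) (use k True in auto)
    then show ?thesis by (simp add: card_insert_if)
  next
    case False
    have "card {1, 2, 3, 6, k, 2 * k, 3 * k, n} \<le> card {d. d dvd n}"
      by (rule card_divisors_ge) (use dv assms in auto)
    then show ?thesis using \<open>k > 3\<close> k False by (simp add: card_insert_if)
  qed
qed

definition even_quot :: "nat \<Rightarrow> nat \<Rightarrow> nat set" where
  "even_quot a b = {d. d > 2 \<and> (d dvd a \<and> even (a div d) \<or> d dvd b \<and> even (b div d))}"

definition odd_quot :: "nat \<Rightarrow> nat \<Rightarrow> nat set" where
  "odd_quot a b = {d. d > 2 \<and> (d dvd a \<and> odd (a div d) \<or> d dvd b \<and> odd (b div d))}"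

lemma finite_quot:
  assumes "a > 0" "b > 0"
  shows "finite (even_quot a b)" "finite (odd_quot a b)"
  using finite_divisors_nat[OF assms(1)] finite_divisors_nat[OF assms(2)]
  unfolding even_quot_def odd_quot_def
  by (auto intro: finite_subset[of _ "{d. d dvd a} \<union> {d. d dvd b}"])

lemma even_quot_half:
  assumes "even a \<or> even b" "a > 4" "b > 4"
  shows "\<exists>d. d \<in> even_quot a b"
  using assms(1)
proof
  assume "even a"
  then obtain k where "a = 2 * k" by blast
  then have "k \<in> even_quot a b" using assms by (simp add: even_quot_def)
  then show ?thesis by blast
next
  assume "even b"
  then obtain k where "b = 2 * k" by blast
  then have "k \<in> even_quot a b" using assms by (simp add: even_quot_def)
  then show ?thesis by blast
qed

text \<open>Of the three consecutive numbers \<open>2 a\<close>, \<open>2 a + 1\<close>, \<open>2 a + 2\<close> one is divisible by 3, and it is not the prime in the middle.\<close>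

lemma two_three_cases:
  fixes a :: nat
  assumes "prime (2 * a + 1)" "a > 1"
  shows "6 dvd a \<or> 6 dvd a + 1 \<or> even a \<and> 3 dvd a + 1 \<or> even (a + 1) \<and> 3 dvd a"
proof -
  have "\<not> 3 dvd 2 * a + 1"
    using assms primes_dvd_imp_eq[of "3::nat" "2 * a + 1"] by auto
  then have "3 dvd a \<or> 3 dvd a + 1" by presburger
  then show ?thesis by presburger
qed

text \<open>If 2 and 3 divide different ones of the two numbers, both have at least four divisors, and the bound is attained for
  \<open>a = 14\<close>. Otherwise one number may be prime, and the other one is a multiple of 6 with at least six divisors, or eight if it exceeds 18;
  \<open>a + 1 = 18\<close> is excluded since 35 is not prime.\<close>

lemma divisor_bound_iso:
  fixes a :: nat
  assumes "prime (2 * a + 1)" "a \<ge> 14"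
  shows "20 \<le> 3 * card {d. d dvd a} + 2 * card {d. d dvd a + 1}"
proof -
  consider "6 dvd a" | "6 dvd a + 1" | "even a" "3 dvd a + 1" | "even (a + 1)" "3 dvd a"
    using two_three_cases[OF assms(1)] assms(2) by fastforce
  then show ?thesis
  proof cases
    case 1
    then show ?thesis using card_divisors_6[of a] card_divisors_ge_2[of "a + 1"] assms by simp
  next
    case 2
    have "a \<noteq> 17"
    proof
      assume "a = 17"
      then have "prime (35::nat)" using assms by simp
      then show False using primes_dvd_imp_eq[of 5 "35::nat"] by simp
    qed
    moreover have "a \<noteq> 14" "a \<noteq> 15" "a \<noteq> 16" using 2 by auto
    ultimately have "a + 1 > 18" using assms(2) by simp
    then show ?thesis using 2 card_divisors_6_large[of "a + 1"] card_divisors_ge_2[of a] assms by simp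
  next
    case 3
    then show ?thesis using card_divisors_even[of a] card_divisors_3[of "a + 1"] assms by simp
  next
    case 4
    then show ?thesis using card_divisors_even[of "a + 1"] card_divisors_3[of a] assms by simp
  qed
qed

lemma card_ge_1: "finite A \<Longrightarrow> x \<in> A \<Longrightarrow> 1 \<le> card A"
  using card_gt_0_iff[of A] by fastforce

lemma divisor_bound_non_self_norm:
  assumes "prime (2 * a + 1)" "a \<ge> 11"
  shows "14 \<le> 2 * card {d. d dvd a} + card {d. d dvd a + 1} + 2 * card (even_quot a (a + 1))"
proof -
  let ?Y = "even_quot a (a + 1)"
  have fin: "finite ?Y" using finite_quot assms by simp
  obtain d where "d \<in> ?Y" using even_quot_half[of a "a + 1"] assms by auto
  then have Y1: "1 \<le> card ?Y" using card_ge_1[OF fin] by blast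
  consider "6 dvd a" | "6 dvd a + 1" | "even a" "3 dvd a + 1" | "even (a + 1)" "3 dvd a"
    using two_three_cases[OF assms(1)] assms(2) by fastforce
  then show ?thesis
  proof cases
    case 1
    then show ?thesis using card_divisors_6[of a] card_divisors_ge_2[of "a + 1"] assms by simp
  next
    case 2
    then obtain k where k: "a + 1 = 6 * k" by blast
    then have "k > 1" using assms by simp
    have "a + 1 = 3 * (2 * k)" "a + 1 = (3 * k) * 2" using k by simp_all
    then have "{3, 3 * k} \<subseteq> ?Y"
      using \<open>k > 1\<close> unfolding even_quot_def by auto
    then have "card {3, 3 * k} \<le> card ?Y" using fin by (rule card_mono[rotated])
    then have "2 \<le> card ?Y" using \<open>k > 1\<close> by (simp add: card_insert_if)
    then show ?thesis using 2 card_divisors_6[of "a + 1"] card_divisors_ge_2[of a] assms by simp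
  next
    case 3
    then show ?thesis using card_divisors_even[of a] card_divisors_3[of "a + 1"] Y1 assms by simp
  next
    case 4
    then show ?thesis using card_divisors_even[of "a + 1"] card_divisors_3[of a] Y1 assms by simp
  qed
qed

text \<open>Here \<open>e\<close> is the even and \<open>q\<close> the odd one of the two numbers. Both belong to \<open>W\<close> with quotient 1, and further members
  come from the prime 3: these are \<open>3\<close> and \<open>q / 3\<close> if 3 divides \<open>q\<close>, and otherwise \<open>e / 3\<close>, together with \<open>6\<close> if 4 does not divide \<open>e\<close>.
  For \<open>e = 18\<close> the last two coincide.\<close>

lemma divisor_bound_self_norm_aux:
  fixes e q :: nat
  assumes e: "even e" "e > 10" and o': "odd q" "q > 10"
    and sub: "\<And>d. d > 2 \<Longrightarrow> d dvd e \<Longrightarrow> odd (e div d) \<Longrightarrow> d \<in> W"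
    and sub': "\<And>d. d > 2 \<Longrightarrow> d dvd q \<Longrightarrow> odd (q div d) \<Longrightarrow> d \<in> W"
    and fin: "finite W" and three: "3 dvd e \<or> 3 dvd q"
  shows "3 \<le> card W" "\<not> 4 dvd e \<Longrightarrow> e \<noteq> 18 \<Longrightarrow> 4 \<le> card W"
proof -
  have eW: "e \<in> W" "q \<in> W" using e o' sub[of e] sub'[of q] by auto
  have neq: "e \<noteq> q" using e o' by auto
  have "3 \<le> card W \<and> (\<not> 4 dvd e \<longrightarrow> e \<noteq> 18 \<longrightarrow> 4 \<le> card W)"
    using three
  proof
    assume "3 dvd q"
    then obtain k where k: "q = 3 * k" by blast
    then have k': "odd k" "k > 3" using o' by auto
    have "3 \<in> W" using k k' by (intro sub') auto
    moreover have "k \<in> W" using k k' by (intro sub') auto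
    ultimately have "{3, k, q, e} \<subseteq> W" using eW by auto
    then have "card {3, k, q, e} \<le> card W" using fin by (rule card_mono[rotated])
    moreover have "k \<noteq> e" "3 \<noteq> e" using k' e by auto
    then have "card {3, k, q, e} = 4" using k k' neq by (auto simp: card_insert_if)
    ultimately show ?thesis by simp
  next
    assume "3 dvd e"
    then obtain k where k: "e = 3 * k" by blast
    then have ke: "even k" "k > 3" using e by auto
    have "k \<in> W" using k ke by (intro sub) auto
    have "k \<noteq> q" using ke o' by auto
    have "card {k, e, q} = 3" using k ke neq \<open>k \<noteq> q\<close> by (auto simp: card_insert_if)
    moreover have "card {k, e, q} \<le> card W" using fin eW \<open>k \<in> W\<close> by (intro card_mono) auto
    ultimately have 3: "3 \<le> card W" by simp
    have "4 \<le> card W" if "\<not> 4 dvd e" "e \<noteq> 18"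
    proof -
      obtain j where j: "k = 2 * j" using ke by blast
      have "odd j"
      proof
        assume "even j"
        then have "4 dvd e" using k j by auto
        then show False using that by simp
      qed
      then have "j > 1" "j \<noteq> 3" using j k that e by auto
      have ej: "e = 6 * j" using k j by simp
      then have "6 \<in> W" using \<open>odd j\<close> by (intro sub) auto
      moreover have "6 \<noteq> k" "6 \<noteq> e" "6 \<noteq> q" using j \<open>j \<noteq> 3\<close> e o' by auto
      ultimately have "card {6, k, e, q} = 4"
        using k ke neq \<open>k \<noteq> q\<close> by (auto simp: card_insert_if)
      moreover have "card {6, k, e, q} \<le> card W"
        using fin eW \<open>k \<in> W\<close> \<open>6 \<in> W\<close> by (intro card_mono) auto
      ultimately show ?thesis by simp
    qed
    with 3 show ?thesis by blast
  qed
  then show "3 \<le> card W" "\<not> 4 dvd e \<Longrightarrow> e \<noteq> 18 \<Longrightarrow> 4 \<le> card W" by blast+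
qed

lemma divisor_bound_self_norm:
  assumes pr: "prime (2 * a + 1)" and a: "a \<ge> 11"
  shows "3 \<le> card (odd_quot a (a + 1))"
    "\<not> 4 dvd a \<Longrightarrow> \<not> 4 dvd a + 1 \<Longrightarrow> a \<noteq> 18 \<Longrightarrow> a \<noteq> 17 \<Longrightarrow> 4 \<le> card (odd_quot a (a + 1))"
proof -
  let ?W = "odd_quot a (a + 1)"
  have fin: "finite ?W" using finite_quot a by simp
  have three: "3 dvd a \<or> 3 dvd a + 1"
    using two_three_cases[OF pr] a by presburger
  have W: "d \<in> ?W" if "d > 2" "d dvd a \<and> odd (a div d) \<or> d dvd a + 1 \<and> odd ((a + 1) div d)" for d
    using that by (simp add: odd_quot_def)
  have "3 \<le> card ?W \<and> (\<not> 4 dvd a \<and> \<not> 4 dvd a + 1 \<and> a \<noteq> 18 \<and> a \<noteq> 17 \<longrightarrow> 4 \<le> card ?W)"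
  proof (cases "even a")
    case True
    then show ?thesis
      using divisor_bound_self_norm_aux[of a "a + 1" ?W] W three fin a by auto
  next
    case False
    then show ?thesis
      using divisor_bound_self_norm_aux[of "a + 1" a ?W] W three fin a by auto
  qed
  then show "3 \<le> card ?W" "\<not> 4 dvd a \<Longrightarrow> \<not> 4 dvd a + 1 \<Longrightarrow> a \<noteq> 18 \<Longrightarrow> a \<noteq> 17 \<Longrightarrow> 4 \<le> card ?W"
    by blast+
qed

section \<open>The lower bounds\<close>

lemma card_shapes:
  assumes "finite X" "finite Y" "finite Z"
  shows "card (Cyclic ` X \<union> Dihedral ` Y \<union> Borel ` Z) = card X + card Y + card Z"
    and "Polyhedral \<notin> Cyclic ` X \<union> Dihedral ` Y \<union> Borel ` Z"
proof -
  have "card (Cyclic ` X \<union> Dihedral ` Y \<union> Borel ` Z) = card (Cyclic ` X \<union> Dihedral ` Y) + card (Borel ` Z)"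
    using assms by (intro card_Un_disjoint) auto
  also have "card (Cyclic ` X \<union> Dihedral ` Y) = card (Cyclic ` X) + card (Dihedral ` Y)"
    using assms by (intro card_Un_disjoint) auto
  finally show "card (Cyclic ` X \<union> Dihedral ` Y \<union> Borel ` Z) = card X + card Y + card Z"
    by (simp add: card_image inj_on_def)
qed auto

context psl2
begin

text \<open>The results for the two tori in a common form; a nonsplit torus is chosen by picking some nonsquare.\<close>

lemma torus_classes:
  assumes "d dvd ord_split \<or> d dvd ord_nonsplit" "d > 1"
  shows "\<exists>H\<in>NP. \<not> sn H \<and> shape_of G p H = Cyclic d"
    and "d > 2 \<Longrightarrow> d dvd ord_split \<and> odd (ord_split div d) \<or> d dvd ord_nonsplit \<and> odd (ord_nonsplit div d) \<Longrightarrow>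
      \<exists>H\<in>NP. sn H \<and> shape_of G p H = Dihedral d"
    and "d > 2 \<Longrightarrow> d dvd ord_split \<and> even (ord_split div d) \<or> d dvd ord_nonsplit \<and> even (ord_nonsplit div d) \<Longrightarrow>
      \<exists>H\<in>NP. \<exists>K\<in>NP. \<not> sn H \<and> \<not> sn K \<and> shape_of G p H = Dihedral d \<and> shape_of G p K = Dihedral d \<and>
        (\<forall>g\<in>carrier G. cnj g ` H \<noteq> K)"
    and "d > 2 \<Longrightarrow> \<exists>H\<in>NP. shape_of G p H = Dihedral d"
proof -
  obtain e :: 'f where "\<And>x. x ^ 2 \<noteq> e" using nonsquare_exists by blast
  then interpret N: psl2_nonsplit p G e by unfold_locales
  show "\<exists>H\<in>NP. \<not> sn H \<and> shape_of G p H = Cyclic d"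
    using assms split.cyclic_class N.nonsplit.cyclic_class by blast
  show "d > 2 \<Longrightarrow> d dvd ord_split \<and> odd (ord_split div d) \<or> d dvd ord_nonsplit \<and> odd (ord_nonsplit div d) \<Longrightarrow>
      \<exists>H\<in>NP. sn H \<and> shape_of G p H = Dihedral d"
    using split.dihedral_class N.nonsplit.dihedral_class by blast
  show "d > 2 \<Longrightarrow> d dvd ord_split \<and> even (ord_split div d) \<or> d dvd ord_nonsplit \<and> even (ord_nonsplit div d) \<Longrightarrow>
      \<exists>H\<in>NP. \<exists>K\<in>NP. \<not> sn H \<and> \<not> sn K \<and> shape_of G p H = Dihedral d \<and> shape_of G p K = Dihedral d \<and>
        (\<forall>g\<in>carrier G. cnj g ` H \<noteq> K)"
    using split.dihedral_classes N.nonsplit.dihedral_classes by blast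
  show "d > 2 \<Longrightarrow> \<exists>H\<in>NP. shape_of G p H = Dihedral d"
    using assms split.dihedral_exists N.nonsplit.dihedral_exists by blast
qed

text \<open>The orders of nontrivial subgroups of the tori. As \<open>ord_split\<close> and \<open>ord_nonsplit\<close> are coprime, each order comes from only one torus.\<close>

definition torus_divisors :: "nat set" where "torus_divisors = {d. d > 1 \<and> (d dvd ord_split \<or> d dvd ord_nonsplit)}"

lemma finite_torus_divisors: "finite torus_divisors"
  using finite_divisors_nat[OF ord_split_pos] finite_divisors_nat[OF ord_nonsplit_pos]
  by (auto simp: torus_divisors_def intro: finite_subset[of _ "{d. d dvd ord_split} \<union> {d. d dvd ord_nonsplit}"])

lemma card_torus_divisors: "card torus_divisors + 2 = card {d. d dvd ord_split} + card {d. d dvd ord_nonsplit}"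
proof -
  let ?A = "{d. d dvd ord_split}" and ?B = "{d. d dvd ord_nonsplit}"
  have fin: "finite ?A" "finite ?B" using finite_divisors_nat ord_split_pos ord_nonsplit_pos by blast+
  have co: "d = 1" if "d dvd ord_split" "d dvd ord_nonsplit" for d
    using that ord_nonsplit_eq by (metis dvd_add_right_iff nat_dvd_1_iff_1)
  have "d > 1" if "d dvd ord_split \<or> d dvd ord_nonsplit" "d \<noteq> 1" for d
    using that ord_split_pos ord_nonsplit_pos by (cases d) (auto simp del: One_nat_def)
  then have "torus_divisors = (?A - {1}) \<union> (?B - {1})" unfolding torus_divisors_def by auto
  moreover have "(?A - {1}) \<inter> (?B - {1}) = {}" using co by auto
  ultimately have "card torus_divisors = card (?A - {1}) + card (?B - {1})"
    using fin by (simp add: card_Un_disjoint)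
  moreover have "card ?A > 0" "card ?B > 0" using fin by (auto simp: card_gt_0_iff)
  ultimately show ?thesis using fin by (simp add: card_Diff_singleton_if)
qed

text \<open>Realised shapes: cyclic and dihedral ones for each nontrivial divisor (with the Klein four-group in the role of \<^term>\<open>Dihedral 2\<close>),
  Borel ones for each divisor of \<open>ord_split\<close>, and the tetrahedral one.\<close>

lemma num_iso_classes_ge: "3 * card {d. d dvd ord_split} + 2 * card {d. d dvd ord_nonsplit} - 3 \<le> num_iso_classes G"
proof -
  obtain u v :: 'f where "u * u + v * v = - 1" using quaternion_exists by blast
  then interpret Q: psl2_quaternion p G u v by unfold_locales
  let ?L = "Cyclic ` torus_divisors \<union> Dihedral ` torus_divisors \<union> Borel ` {d. d dvd ord_split} \<union> {Polyhedral}"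
  have finA: "finite {d. d dvd ord_split}" using finite_divisors_nat ord_split_pos by blast
  have "card ?L = card torus_divisors + card torus_divisors + card {d. d dvd ord_split} + 1"
    using card_shapes[OF finite_torus_divisors finite_torus_divisors finA] finite_torus_divisors finA by simp
  moreover have "card ?L \<le> num_iso_classes G"
  proof (rule card_iso_classes_ge[OF finite_G])
    fix l assume "l \<in> ?L"
    then consider d where "d \<in> torus_divisors" "l = Cyclic d" | d where "d \<in> torus_divisors" "l = Dihedral d"
      | d where "d dvd ord_split" "l = Borel d" | "l = Polyhedral" by blast
    then show "\<exists>H\<in>NP. shape_of G p H = l"
    proof cases
      case 1 then show ?thesis using torus_classes(1) unfolding torus_divisors_def by blast
    next
      case (2 d)
      then have "d = 2 \<or> d > 2" by (auto simp: torus_divisors_def)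
      then show ?thesis
        using Q.V_class torus_classes(4)[of d] 2 unfolding torus_divisors_def by auto
    next
      case 3 then show ?thesis using borel_class by blast
    next
      case 4 then show ?thesis using Q.tetrahedral_class by blast
    qed
  qed
  moreover have "card {d. d dvd ord_split} > 0" using finA by (auto simp: card_gt_0_iff)
  ultimately show ?thesis using card_torus_divisors by linarith
qed

text \<open>Besides the cyclic subgroups, the proper subgroups of the Borel subgroup of order divisible by \<open>p\<close> and the Klein four-group, each
  divisor with even quotient contributes two classes of dihedral subgroups.\<close>

lemma num_non_self_norm_classes_ge:
  "2 * card {d. d dvd ord_split} + card {d. d dvd ord_nonsplit} + 2 * card (even_quot ord_split ord_nonsplit) - 2 \<le> num_non_self_norm_classes G"
proof -
  obtain u v :: 'f where "u * u + v * v = - 1" using quaternion_exists by blast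
  then interpret Q: psl2_quaternion p G u v by unfold_locales
  let ?E = "{H \<in> NP. \<not> sn H}"
  let ?L1 = "Cyclic ` torus_divisors \<union> Dihedral ` {2} \<union> Borel ` ({d. d dvd ord_split} - {ord_split})"
  let ?L2 = "Dihedral ` even_quot ord_split ord_nonsplit"
  have finA: "finite {d. d dvd ord_split}" using finite_divisors_nat ord_split_pos by blast
  have finY: "finite (even_quot ord_split ord_nonsplit)" using finite_quot ord_split_pos ord_nonsplit_pos by blast
  have "card ?L1 + 2 * card ?L2 \<le> num_non_self_norm_classes G"
    unfolding num_non_self_norm_classes_def
  proof (rule card_conj_classes_ge)
    show "finite ?E" using finite_nontriv_proper_subgroups[OF finite_G] by simp
    show "subgroup H G" if "H \<in> ?E" for H using that by (simp add: nontriv_proper_subgroups_def)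
    show "finite ?L1" "finite ?L2" using finite_torus_divisors finA finY by simp_all
    show "?L1 \<inter> ?L2 = {}" by (auto simp: even_quot_def)
    show "\<exists>H\<in>?E. shape_of G p H = l" if "l \<in> ?L1" for l
    proof -
      from that consider d where "d \<in> torus_divisors" "l = Cyclic d"
        | d where "d dvd ord_split" "d \<noteq> ord_split" "l = Borel d" | "l = Dihedral 2" by blast
      then show ?thesis
      proof cases
        case 1 then show ?thesis using torus_classes(1) unfolding torus_divisors_def by blast
      next
        case 2 then show ?thesis using borel_class by blast
      next
        case 3 then show ?thesis using Q.V_class by blast
      qed
    qed
    show "\<exists>H\<in>?E. \<exists>K\<in>?E. shape_of G p H = l \<and> shape_of G p K = l \<and> (\<forall>g\<in>carrier G. cnj g ` H \<noteq> K)"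
      if "l \<in> ?L2" for l
    proof -
      obtain d where d: "l = Dihedral d" "d > 2"
        "d dvd ord_split \<and> even (ord_split div d) \<or> d dvd ord_nonsplit \<and> even (ord_nonsplit div d)"
        using \<open>l \<in> ?L2\<close> by (auto simp: even_quot_def)
      then have "d dvd ord_split \<or> d dvd ord_nonsplit" "d > 1" by auto
      from torus_classes(3)[OF this d(2,3)] show ?thesis unfolding d(1) by blast
    qed
  qed
  moreover have "card ?L1 = card torus_divisors + 1 + (card {d. d dvd ord_split} - 1)"
    using finite_torus_divisors finA by (subst card_shapes) (simp_all add: card_Diff_singleton_if)
  moreover have "card ?L2 = card (even_quot ord_split ord_nonsplit)"
    by (intro card_image inj_onI) simp
  moreover have "card {d. d dvd ord_split} > 0" using finA by (auto simp: card_gt_0_iff)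
  ultimately show ?thesis using card_torus_divisors by linarith
qed

text \<open>The Borel subgroup, the dihedral subgroups of odd index in the normaliser of a torus, and either two octahedral classes or one
  tetrahedral class.\<close>

lemma num_self_norm_classes_ge:
  "card (odd_quot ord_split ord_nonsplit) + (if 4 dvd ord_split \<or> 4 dvd ord_nonsplit then 3 else 2) \<le> num_self_norm_classes G"
proof -
  obtain u v :: 'f where "u * u + v * v = - 1" using quaternion_exists by blast
  then interpret Q: psl2_quaternion p G u v by unfold_locales
  let ?E = "{H \<in> NP. sn H}" and ?four = "4 dvd ord_split \<or> 4 dvd ord_nonsplit"
  define L where "L = Cyclic ` {} \<union> Dihedral ` odd_quot ord_split ord_nonsplit \<union> Borel ` {ord_split}"
  define L1 L2 where "L1 = (if ?four then L else insert Polyhedral L)"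
    and "L2 = (if ?four then {Polyhedral} else {})"
  have finW: "finite (odd_quot ord_split ord_nonsplit)" using finite_quot ord_split_pos ord_nonsplit_pos by blast
  have "card L1 + 2 * card L2 \<le> num_self_norm_classes G"
    unfolding num_self_norm_classes_def
  proof (rule card_conj_classes_ge)
    show "finite ?E" using finite_nontriv_proper_subgroups[OF finite_G] by simp
    show "subgroup H G" if "H \<in> ?E" for H using that by (simp add: nontriv_proper_subgroups_def)
    show "finite L1" "finite L2" using finW by (simp_all add: L1_def L2_def L_def)
    show "L1 \<inter> L2 = {}" by (auto simp: L1_def L2_def L_def)
    show "\<exists>H\<in>?E. shape_of G p H = l" if "l \<in> L1" for l
    proof -
      from that consider "\<not> ?four" "l = Polyhedral" | "l = Borel ord_split"
        | d where "l = Dihedral d" "d \<in> odd_quot ord_split ord_nonsplit" by (auto simp: L1_def L_def split: if_splits)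
      then show ?thesis
      proof cases
        case 1
        then have "r ^ 2 \<noteq> 2" for r :: 'f using four_dvd_if_sqrt2 by blast
        then show ?thesis using Q.tetrahedral_class_self_normalising 1 by blast
      next
        case 2 then show ?thesis using borel_class[of ord_split] by auto
      next
        case 3 then show ?thesis using torus_classes(2)[of d] unfolding odd_quot_def by auto
      qed
    qed
    show "\<exists>H\<in>?E. \<exists>K\<in>?E. shape_of G p H = l \<and> shape_of G p K = l \<and> (\<forall>g\<in>carrier G. cnj g ` H \<noteq> K)"
      if "l \<in> L2" for l
    proof -
      have "?four" "l = Polyhedral" using that by (auto simp: L2_def split: if_splits)
      then obtain r :: 'f where "r ^ 2 = 2" using sqrt2_if_four_dvd by blast
      from Q.octahedral_classes_of_sqrt2[OF this] show ?thesis unfolding \<open>l = Polyhedral\<close> by blast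
    qed
  qed
  moreover have "card L = card (odd_quot ord_split ord_nonsplit) + 1" "Polyhedral \<notin> L" "finite L"
    unfolding L_def using card_shapes[of "{}" "odd_quot ord_split ord_nonsplit" "{ord_split}"] finW by simp_all
  then have "card L1 = card (odd_quot ord_split ord_nonsplit) + (if ?four then 1 else 2)"
    by (simp add: L1_def)
  moreover have "card L2 = (if ?four then 1 else 0)" by (simp add: L2_def)
  ultimately show ?thesis by (auto split: if_splits)
qed

text \<open>The exceptional value \<open>ord_split = 18\<close> belongs to \<open>p = 37\<close>; the value 17 would belong to 35, which is not prime.\<close>

lemma class_number_bounds:
  shows "p \<ge> 29 \<Longrightarrow> num_iso_classes G \<ge> 17"
    and "p \<ge> 23 \<Longrightarrow> num_conj_classes G \<ge> 18"
    and "p \<ge> 41 \<Longrightarrow> num_self_norm_classes G \<ge> 6"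
    and "p \<ge> 23 \<Longrightarrow> num_non_self_norm_classes G \<ge> 12"
proof -
  have pr: "prime (2 * ord_split + 1)" using prime_p p_eq by simp
  show "num_iso_classes G \<ge> 17" if "p \<ge> 29"
    using divisor_bound_iso[OF pr] num_iso_classes_ge p_eq that unfolding ord_nonsplit_eq by linarith
  show n: "num_non_self_norm_classes G \<ge> 12" if "p \<ge> 23"
    using divisor_bound_non_self_norm[OF pr] num_non_self_norm_classes_ge p_eq that unfolding ord_nonsplit_eq by linarith
  have not17: "ord_split \<noteq> 17"
  proof
    assume "ord_split = 17"
    then have "prime (35::nat)" using pr by simp
    then show False using primes_dvd_imp_eq[of 5 "35::nat"] by simp
  qed
  have s: "num_self_norm_classes G \<ge> (if ord_split = 18 then 5 else 6)" if "p \<ge> 23"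
  proof -
    have "ord_split \<ge> 11" using that p_eq by simp
    then show ?thesis
      using divisor_bound_self_norm[OF pr] num_self_norm_classes_ge not17 unfolding ord_nonsplit_eq
      by (auto split: if_splits)
  qed
  show "num_self_norm_classes G \<ge> 6" if "p \<ge> 41"
    using s that p_eq by (auto split: if_splits)
  show "num_conj_classes G \<ge> 18" if p: "p \<ge> 23"
  proof (cases "ord_split = 18")
    case False
    then show ?thesis
      using s[OF p] n[OF p] self_normalising_plus_not_le_conj_classes[OF finite_G] by simp
  next
    case True
    have "6 \<le> card {d. d dvd ord_split}" using card_divisors_6[of ord_split] True by simp
    moreover have "2 \<le> card {d. d dvd ord_nonsplit}" using card_divisors_ge_2[of ord_nonsplit] ord_nonsplit_eq True by simp
    moreover obtain d where "d \<in> even_quot ord_split ord_nonsplit" using even_quot_half[of ord_split ord_nonsplit] True ord_nonsplit_eq by auto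
    then have "1 \<le> card (even_quot ord_split ord_nonsplit)"
      by (rule card_ge_1[OF finite_quot(1)[OF ord_split_pos ord_nonsplit_pos]])
    ultimately have "14 \<le> num_non_self_norm_classes G"
      using num_non_self_norm_classes_ge by linarith
    then show ?thesis
      using s[OF p] True self_normalising_plus_not_le_conj_classes[OF finite_G] by simp
  qed
qed

end

theorem theorem1p1:
  fixes p :: nat
    and G :: "('f::{field,finite} ^ 2 ^ 2) set monoid"
  assumes "prime p"
    and "CARD('f) = p"
    and "G = PSL"
  shows "(p \<ge> 29 \<longrightarrow> num_iso_classes G \<ge> 17) \<and>
         (p \<ge> 23 \<longrightarrow> num_conj_classes G \<ge> 18) \<and>
         (p \<ge> 41 \<longrightarrow> num_self_norm_classes G \<ge> 6) \<and>
         (p \<ge> 23 \<longrightarrow> num_non_self_norm_classes G \<ge> 12)"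
proof (cases "p > 3")
  case True
  then interpret psl2 p G using assms by unfold_locales simp_all
  show ?thesis using class_number_bounds by simp
qed simp

end
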